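(* Let $\nu>0$ and let $n,n'\ge0$ be integers. Define $$\mathcal{T}^\nu_{n,n'}(\psi)(z) := \left(\frac{(-1)^{n'}\nu}{\pi\sqrt{n!\,n'!\,\nu^{n+n'}}}\right)\int_{\mathbb{C}} e^{-\nu|\xi|^2+\nu\overline{\xi}z}\,H_{n,n'}^\nu(\xi-z,\overline{\xi}-\overline{z})\,\psi(\xi)\,d\lambda(\xi).$$ Then the integral transform $\mathcal{T}^\nu_{n,n'}$ is a unitary operator from $\mathcal{F}^{2,\nu}_n(\mathbb{C})$ onto $\mathcal{F}^{2,\nu}_{n'}(\mathbb{C})$, and its inverse is given by $\left(\mathcal{T}^\nu_{n,n'}\right)^{-1}=\mathcal{T}^\nu_{n',n}$. Moreover, for every integer $m\ge0$ and $z\in\mathbb{C}$, $$\mathcal{T}^\nu_{n,n'}\left(H_{m,n}^{\nu}\right)(z)=\left(\frac{n!\,\nu^{n}}{n'!\,\nu^{n'}}\right)^{1/2}H_{m,n'}^{\nu}(z,\overline{z}).$$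
   Context: $d\lambda$ denotes Lebesgue measure on $\mathbb{C}\simeq\mathbb{R}^2$, and $L^{2,\nu}(\mathbb{C})$ is the Hilbert space of functions on $\mathbb{C}$ square integrable with respect to $e^{-\nu|z|^2}d\lambda(z)$. The univariate complex Hermite polynomials are $$H_{m,n}^\nu(z,\overline{z})=(-1)^{m+n}e^{\nu z\overline{z}}\frac{\partial^{m+n}}{\partial \overline{z}^{m}\partial z^{n}}\left(e^{-\nu z\overline{z}}\right),\qquad m,n\ge0.$$ The generalized Bargmann-Fock space of level $n$, with the norm of $L^{2,\nu}(\mathbb{C})$, is the $L^2$-eigenspace $$\mathcal{F}^{2,\nu}_n(\mathbb{C})=\{ f\in L^{2,\nu}(\mathbb{C});\ \Delta_\nu f = \nu n f\},\qquad \Delta_\nu := -\frac{\partial^2}{\partial z\,\partial\overline{z}}+\nu\overline{z}\frac{\partial}{\partial\overline{z}}.$$ *)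

theory Defs
  imports "HOL-Analysis.Analysis"
begin

(* Wirtinger derivatives.  The Frechet derivative is the real one, so its values at 1 and \<i>
   are the partial derivatives with respect to x and y, where z = x + iy. *)

definition d_z :: "(complex \<Rightarrow> complex) \<Rightarrow> complex \<Rightarrow> complex" where
  "d_z f z = (frechet_derivative f (at z) 1 - \<i> * frechet_derivative f (at z) \<i>) / 2"

definition d_zbar :: "(complex \<Rightarrow> complex) \<Rightarrow> complex \<Rightarrow> complex" where
  "d_zbar f z = (frechet_derivative f (at z) 1 + \<i> * frechet_derivative f (at z) \<i>) / 2"

(* Functions of class C^k on the plane, in the real sense. *)

primrec class_C :: "nat \<Rightarrow> (complex \<Rightarrow> complex) \<Rightarrow> bool" where
  "class_C 0 f \<longleftrightarrow> continuous_on UNIV f"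
| "class_C (Suc k) f \<longleftrightarrow>
     (\<forall>z. f differentiable (at z)) \<and> (\<forall>v. class_C k (\<lambda>z. frechet_derivative f (at z) v))"

(* H_{m,n}(z, cnj z); the second argument is always the conjugate of the first, so it is
   not a separate parameter. *)

definition hermite :: "real \<Rightarrow> nat \<Rightarrow> nat \<Rightarrow> complex \<Rightarrow> complex" where
  "hermite \<nu> m n z =
     (-1) ^ (m + n) * exp (of_real \<nu> * z * cnj z) *
     (d_zbar ^^ m) ((d_z ^^ n) (\<lambda>w. exp (- (of_real \<nu> * w * cnj w)))) z"

definition L2 :: "real \<Rightarrow> (complex \<Rightarrow> complex) set" where
  "L2 \<nu> = {f \<in> borel_measurable lborel.
     integrable lborel (\<lambda>z. (cmod (f z))\<^sup>2 * exp (- \<nu> * (cmod z)\<^sup>2))}"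

definition L2_inner :: "real \<Rightarrow> (complex \<Rightarrow> complex) \<Rightarrow> (complex \<Rightarrow> complex) \<Rightarrow> complex" where
  "L2_inner \<nu> f g =
     (\<integral>z. f z * cnj (g z) * of_real (exp (- \<nu> * (cmod z)\<^sup>2)) \<partial>lborel)"

definition Delta :: "real \<Rightarrow> (complex \<Rightarrow> complex) \<Rightarrow> complex \<Rightarrow> complex" where
  "Delta \<nu> f z = - d_z (d_zbar f) z + of_real \<nu> * cnj z * d_zbar f z"

(* The eigenvalue equation is read classically, on functions of class C^2.  Since the operator
   is elliptic with smooth coefficients, every weak L^2-solution has exactly one such
   representative; hence the elements of the space are honest functions, and equality in L^2
   is equality of functions. *)

definition fock :: "real \<Rightarrow> nat \<Rightarrow> (complex \<Rightarrow> complex) set" where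
  "fock \<nu> n = {f \<in> L2 \<nu>. class_C 2 f \<and> (\<forall>z. Delta \<nu> f z = of_real \<nu> * of_nat n * f z)}"

(* Meant for V and W linear spaces of continuous L^2-functions, on which L2_inner is definite. *)

definition unitary_onto ::
  "real \<Rightarrow> ((complex \<Rightarrow> complex) \<Rightarrow> complex \<Rightarrow> complex) \<Rightarrow>
    (complex \<Rightarrow> complex) set \<Rightarrow> (complex \<Rightarrow> complex) set \<Rightarrow> bool" where
  "unitary_onto \<nu> T V W \<longleftrightarrow>
     (\<forall>f\<in>V. \<forall>g\<in>V. T (\<lambda>z. f z + g z) = (\<lambda>z. T f z + T g z)) \<and>
     (\<forall>c. \<forall>f\<in>V. T (\<lambda>z. c * f z) = (\<lambda>z. c * T f z)) \<and>
     (\<forall>f\<in>V. \<forall>g\<in>V. L2_inner \<nu> (T f) (T g) = L2_inner \<nu> f g) \<and>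
     bij_betw T V W"

definition integrand ::
  "real \<Rightarrow> nat \<Rightarrow> nat \<Rightarrow> (complex \<Rightarrow> complex) \<Rightarrow> complex \<Rightarrow> complex \<Rightarrow> complex" where
  "integrand \<nu> n n' \<psi> z \<xi> =
     exp (- of_real \<nu> * of_real ((cmod \<xi>)\<^sup>2) + of_real \<nu> * cnj \<xi> * z) *
     hermite \<nu> n n' (\<xi> - z) * \<psi> \<xi>"

definition transform ::
  "real \<Rightarrow> nat \<Rightarrow> nat \<Rightarrow> (complex \<Rightarrow> complex) \<Rightarrow> complex \<Rightarrow> complex" where
  "transform \<nu> n n' \<psi> z =
     of_real ((-1) ^ n' * \<nu> / (pi * sqrt (fact n * fact n' * \<nu> ^ (n + n')))) *
     (\<integral>\<xi>. integrand \<nu> n n' \<psi> z \<xi> \<partial>lborel)"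

end

theory Submission
  imports Defs "HOL-Complex_Analysis.Cauchy_Integral_Formula" "HOL-Probability.Distributions"
begin

text \<open>
  Write $A^* = -\partial + \nu\overline{z}$ for the creation operator. The complex Hermite polynomial
  $H_{m,n}$ is $(A^*)^n$ applied to $(\nu z)^m$, and $\Delta_\nu = A^*\overline{\partial}$ with
  $\overline{\partial}A^* = A^*\overline{\partial} + \nu$, so $(A^*)^n h$ is an eigenfunction for $\nu n$
  whenever $h$ is entire. The proof shows that the transform exchanges
  $(A^*)^n h$ and $(A^*)^{n'} h$ up to a constant, and that every function of level $n$ has the form
  $(A^*)^n h$.

  The Weyl translation $\psi \mapsto e^{-\nu\overline{z}w}\psi(z+w)$ commutes with $A^*$ and turns the
  transform at $z$ into the integral of the translated function against
  $e^{-\nu|w|^2}H_{n,n'}(w)$. For $\psi = (A^*)^n h$, $n$ integrations by parts move $A^*$ onto the Hermite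
  polynomial as $\partial$ and lower it to a multiple of $(\nu\overline{w})^{n'}$; further $n'$ integrations
  by parts turn that factor into $n'$ derivatives of the holomorphic factor, and the mean value property
  evaluates what remains at the origin. The result is a multiple of $(A^*)^{n'}h(z)$
  (\<open>transform_creation\<close>). This contains the formula for the Hermite polynomials and, once the
  representation by $h$ is known, the inverse.

  To find $h$ for an arbitrary $f$ of level $n$, which is only known to be of class $C^2$, elliptic regularity is
  replaced by a mean value property. The average of $f$ over circles around the origin satisfies
  a second-order equation in the radius, and a solution that is regular at $0$ is determined by its value there
  (\<open>circle_average_eigen_zero\<close>). Comparison with the radial function $H_{n,n}$, applied to all Weyl
  translates of $f$, gives the reproducing formula $f = T_{n,n}f$ (\<open>transform_diag_fock\<close>).
  The kernel of $T_{n,n}$ is itself $(A^*)^n$ of a holomorphic function of $z$, so $f = (A^*)^n h$ with $h$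
  entire (\<open>fock_representation\<close>); Gaussian growth of $h$ makes the integrations by parts legitimate.

  Finally, up to the weights the kernels are dominated by convolution with an integrable function, so the transform
  preserves square integrability (\<open>transform_L2\<close>), and the conjugate symmetry of the kernels makes
  $T_{n,n'}$ and $T_{n',n}$ adjoint to each other (\<open>transform_adjoint\<close>). As they are also
  inverse to each other, both are isometric.
\<close>

section \<open>Lebesgue measure on the complex plane\<close>

lemma lborel_complex_eq_distr_pair:
  "(lborel :: complex measure) = distr (lborel :: (real \<times> real) measure) borel (\<lambda>p. Complex (fst p) (snd p))"
proof (rule lborel_eqI)
  fix l u :: complex
  assume le: "\<And>b. b \<in> Basis \<Longrightarrow> l \<bullet> b \<le> u \<bullet> b"
  have [measurable]: "(\<lambda>p. Complex (fst p) (snd p)) \<in> borel_measurable borel"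
    by (intro borel_measurable_continuous_onI continuous_intros)
  have vim: "(\<lambda>p. Complex (fst p) (snd p)) -` box l u = box (Re l, Im l) (Re u, Im u)"
    by (auto simp: box_def Basis_complex_def Basis_prod_def)
  have "Re l \<le> Re u" "Im l \<le> Im u"
    using le[of 1] le[of \<i>] by (auto simp: Basis_complex_def)
  then show "emeasure (distr lborel borel (\<lambda>p. Complex (fst p) (snd p))) (box l u)
      = (\<Prod>b\<in>Basis. (u - l) \<bullet> b)"
    by (simp add: emeasure_distr vim emeasure_lborel_box_eq Basis_prod_def Basis_complex_def
        ennreal_mult[symmetric] prod.union_disjoint)
qed simp

lemma nn_integral_lborel_complex_pair:
  fixes f :: "complex \<Rightarrow> ennreal"
  assumes [measurable]: "f \<in> borel_measurable borel"
  shows "(\<integral>\<^sup>+w. f w \<partial>lborel) = (\<integral>\<^sup>+p. f (Complex (fst p) (snd p)) \<partial>(lborel :: (real \<times> real) measure))"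
proof -
  have [measurable]: "(\<lambda>p. Complex (fst p) (snd p)) \<in> borel_measurable (borel :: (real \<times> real) measure)"
    by (intro borel_measurable_continuous_onI continuous_intros)
  show ?thesis
    by (subst lborel_complex_eq_distr_pair) (simp add: nn_integral_distr)
qed

text \<open>
  A shear translates each horizontal line, so Fubini reduces its invariance to that of the line.
\<close>

lemma nn_integral_lborel_shear_fst:
  fixes f :: "real \<times> real \<Rightarrow> ennreal"
  assumes f [measurable]: "f \<in> borel_measurable borel"
  shows "(\<integral>\<^sup>+p. f (fst p + a * snd p, snd p) \<partial>lborel) = (\<integral>\<^sup>+p. f p \<partial>lborel)"
proof -
  have [measurable]: "f \<in> borel_measurable (lborel \<Otimes>\<^sub>M lborel)"
    using f by (simp add: lborel_prod)
  have "(\<integral>\<^sup>+p. f (fst p + a * snd p, snd p) \<partial>(lborel \<Otimes>\<^sub>M lborel))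
      = (\<integral>\<^sup>+y. \<integral>\<^sup>+x. f (x + a * y, y) \<partial>lborel \<partial>lborel)"
    by (subst lborel_pair.nn_integral_snd[symmetric]) (auto simp: case_prod_beta)
  also have "\<dots> = (\<integral>\<^sup>+y. \<integral>\<^sup>+x. f (x, y) \<partial>lborel \<partial>lborel)"
  proof (rule nn_integral_cong)
    fix y :: real
    show "(\<integral>\<^sup>+x. f (x + a * y, y) \<partial>lborel) = (\<integral>\<^sup>+x. f (x, y) \<partial>lborel)"
      by (subst nn_integral_real_affine[of "\<lambda>x. f (x, y)" 1 "a * y"]) (auto simp: add_ac)
  qed
  also have "\<dots> = (\<integral>\<^sup>+p. f p \<partial>(lborel \<Otimes>\<^sub>M lborel))"
    by (subst lborel_pair.nn_integral_snd[symmetric]) (auto simp: case_prod_beta)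
  finally show ?thesis
    by (simp add: lborel_prod)
qed

lemma nn_integral_lborel_shear_snd:
  fixes f :: "real \<times> real \<Rightarrow> ennreal"
  assumes f [measurable]: "f \<in> borel_measurable borel"
  shows "(\<integral>\<^sup>+p. f (fst p, snd p + a * fst p) \<partial>lborel) = (\<integral>\<^sup>+p. f p \<partial>lborel)"
proof -
  have [measurable]: "f \<in> borel_measurable (lborel \<Otimes>\<^sub>M lborel)"
    using f by (simp add: lborel_prod)
  have "(\<integral>\<^sup>+p. f (fst p, snd p + a * fst p) \<partial>(lborel \<Otimes>\<^sub>M lborel))
      = (\<integral>\<^sup>+x. \<integral>\<^sup>+y. f (x, y + a * x) \<partial>lborel \<partial>lborel)"
    by (subst lborel.nn_integral_fst[symmetric]) (auto simp: case_prod_beta)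
  also have "\<dots> = (\<integral>\<^sup>+x. \<integral>\<^sup>+y. f (x, y) \<partial>lborel \<partial>lborel)"
  proof (rule nn_integral_cong)
    fix x :: real
    show "(\<integral>\<^sup>+y. f (x, y + a * x) \<partial>lborel) = (\<integral>\<^sup>+y. f (x, y) \<partial>lborel)"
      by (subst nn_integral_real_affine[of "\<lambda>y. f (x, y)" 1 "a * x"]) (auto simp: add_ac)
  qed
  also have "\<dots> = (\<integral>\<^sup>+p. f p \<partial>(lborel \<Otimes>\<^sub>M lborel))"
    by (subst lborel.nn_integral_fst[symmetric]) (auto simp: case_prod_beta)
  finally show ?thesis
    by (simp add: lborel_prod)
qed

text \<open>
  A rotation by an angle other than $\pi$ is a product of three shears, and the half turn is the square of a
  quarter turn.
\<close>

lemma nn_integral_lborel_rotation: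
  fixes f :: "complex \<Rightarrow> ennreal"
  assumes f [measurable]: "f \<in> borel_measurable borel" and c: "norm c = 1"
  shows "(\<integral>\<^sup>+w. f (c * w) \<partial>lborel) = (\<integral>\<^sup>+w. f w \<partial>lborel)"
proof -
  have gen: "(\<integral>\<^sup>+w. f (c * w) \<partial>lborel) = (\<integral>\<^sup>+w. f w \<partial>lborel)"
    if [measurable]: "f \<in> borel_measurable borel" and c: "norm c = 1" "Re c \<noteq> -1"
    for f :: "complex \<Rightarrow> ennreal" and c
  proof -
    define a b where "a = Re c" and "b = Im c"
    \<comment> \<open>minus the tangent of half the angle: horizontal, vertical and horizontal shear with coefficients
      $p$, $b$, $p$ compose to the rotation\<close>
    define p where "p = - b / (1 + a)"
    have ab: "a\<^sup>2 + b\<^sup>2 = 1"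
      using c(1) unfolding a_def b_def by (simp add: cmod_def)
    have a1: "1 + a \<noteq> 0"
      using c(2) by (simp add: a_def)
    have 1: "1 + p * b = a"
      using ab a1 unfolding p_def by (simp add: field_simps power2_eq_square)
    have 2: "p * (1 + a) = - b"
      using a1 by (simp add: p_def)
    let ?C = "\<lambda>p. Complex (fst p) (snd p)"
    have [measurable]: "?C \<in> borel_measurable borel"
      by (intro borel_measurable_continuous_onI continuous_intros)
    define F where "F = (\<lambda>p. f (?C p))"
    have [measurable]: "F \<in> borel_measurable borel"
      unfolding F_def by measurable
    define F1 where "F1 = (\<lambda>r. F (fst r + p * snd r, snd r))"
    have [measurable]: "F1 \<in> borel_measurable borel"
      unfolding F1_def
      by (rule measurable_compose[of _ borel borel F]) (auto intro!: borel_measurable_continuous_onI continuous_intros)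
    define F2 where "F2 = (\<lambda>r. F1 (fst r, snd r + b * fst r))"
    have [measurable]: "F2 \<in> borel_measurable borel"
      unfolding F2_def
      by (rule measurable_compose[of _ borel borel F1]) (auto intro!: borel_measurable_continuous_onI continuous_intros)
    have "f (c * ?C r) = F2 (fst r + p * snd r, snd r)" for r
    proof -
      obtain x y where r: "r = (x, y)"
        by (cases r)
      have e1: "y + b * (x + p * y) = a * y + b * x"
      proof -
        have "y + b * (x + p * y) = (1 + p * b) * y + b * x"
          by (simp add: algebra_simps)
        then show ?thesis
          by (simp add: 1)
      qed
      have e2: "x + p * y + p * (a * y + b * x) = a * x - b * y"
      proof -
        have "x + p * y + p * (a * y + b * x) = (1 + p * b) * x + (p * (1 + a)) * y"
          by (simp add: algebra_simps)
        then show ?thesis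
          by (simp add: 1 2)
      qed
      have "c * Complex x y = Complex (a * x - b * y) (a * y + b * x)"
        by (simp add: complex_eq_iff a_def b_def)
      then show ?thesis
        by (simp add: F2_def F1_def F_def r e1 e2)
    qed
    then have "(\<integral>\<^sup>+w. f (c * w) \<partial>lborel) = (\<integral>\<^sup>+r. F2 (fst r + p * snd r, snd r) \<partial>lborel)"
      by (subst nn_integral_lborel_complex_pair) auto
    also have "\<dots> = (\<integral>\<^sup>+r. F2 r \<partial>lborel)"
      by (rule nn_integral_lborel_shear_fst) measurable
    also have "\<dots> = (\<integral>\<^sup>+r. F1 r \<partial>lborel)"
      unfolding F2_def by (rule nn_integral_lborel_shear_snd) measurable
    also have "\<dots> = (\<integral>\<^sup>+r. F r \<partial>lborel)"
      unfolding F1_def by (rule nn_integral_lborel_shear_fst) measurable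
    also have "\<dots> = (\<integral>\<^sup>+w. f w \<partial>lborel)"
      unfolding F_def by (rule nn_integral_lborel_complex_pair[symmetric]) measurable
    finally show ?thesis .
  qed
  show ?thesis
  proof (cases "Re c = -1")
    case True
    have "Im c = 0"
      using c True by (simp add: cmod_def)
    then have "c = \<i> * \<i>"
      using True by (simp add: complex_eq_iff)
    then have "(\<integral>\<^sup>+w. f (c * w) \<partial>lborel) = (\<integral>\<^sup>+w. (\<lambda>u. f (\<i> * u)) (\<i> * w) \<partial>lborel)"
      by (simp add: mult.assoc)
    also have "\<dots> = (\<integral>\<^sup>+w. f (\<i> * w) \<partial>lborel)"
      by (rule gen) auto
    also have "\<dots> = (\<integral>\<^sup>+w. f w \<partial>lborel)"
      by (rule gen) auto
    finally show ?thesis .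
  qed (use gen c f in blast)
qed

lemma distr_lborel_rotation:
  fixes c :: complex
  assumes "norm c = 1"
  shows "distr lborel borel ((*) c) = lborel"
proof (rule measure_eqI)
  fix A assume "A \<in> sets (distr lborel borel ((*) c))"
  then have [measurable]: "A \<in> sets borel"
    by simp
  have "emeasure (distr lborel borel ((*) c)) A = (\<integral>\<^sup>+w. indicator A w \<partial>distr lborel borel ((*) c))"
    by simp
  also have "\<dots> = (\<integral>\<^sup>+w. indicator A (c * w) \<partial>lborel)"
    by (rule nn_integral_distr) auto
  also have "\<dots> = emeasure lborel A"
    by (subst nn_integral_lborel_rotation[OF _ assms]) auto
  finally show "emeasure (distr lborel borel ((*) c)) A = emeasure lborel A" .
qed simp

lemma integral_lborel_rotation:
  fixes f :: "complex \<Rightarrow> complex"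
  assumes "f \<in> borel_measurable borel" "norm c = 1"
  shows "(\<integral>w. f (c * w) \<partial>lborel) = (\<integral>w. f w \<partial>lborel)"
  using assms integral_distr[of "(*) c" lborel borel f] distr_lborel_rotation[of c] by simp

lemma integral_lborel_translation:
  fixes f :: "complex \<Rightarrow> 'b :: {banach, second_countable_topology}"
  assumes "f \<in> borel_measurable borel"
  shows "(\<integral>w. f (c + w) \<partial>lborel) = (\<integral>w. f w \<partial>lborel)"
  using assms integral_distr[of "(+) c" lborel borel f] by (simp add: lborel_distr_plus)

lemma integrable_lborel_translation_iff:
  fixes f :: "complex \<Rightarrow> 'b :: {banach, second_countable_topology}"
  assumes "f \<in> borel_measurable borel"
  shows "integrable lborel (\<lambda>w. f (c + w)) \<longleftrightarrow> integrable lborel f"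
  using assms integrable_distr_eq[of "(+) c" lborel borel f] by (simp add: lborel_distr_plus)

lemma nn_integral_lborel_translation:
  fixes f :: "complex \<Rightarrow> ennreal"
  assumes "f \<in> borel_measurable borel"
  shows "(\<integral>\<^sup>+w. f (c + w) \<partial>lborel) = (\<integral>\<^sup>+w. f w \<partial>lborel)"
  using assms nn_integral_distr[of "(+) c" lborel borel f] by (simp add: lborel_distr_plus)

lemma nn_integral_lborel_uminus:
  fixes f :: "complex \<Rightarrow> ennreal"
  assumes "f \<in> borel_measurable borel"
  shows "(\<integral>\<^sup>+w. f (- w) \<partial>lborel) = (\<integral>\<^sup>+w. f w \<partial>lborel)"
  using nn_integral_lborel_rotation[OF assms, of "-1"] by simp

lemma nn_integral_gaussian_real:
  fixes \<nu> :: real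
  assumes "\<nu> > 0"
  shows "(\<integral>\<^sup>+x. ennreal (exp (- \<nu> * x\<^sup>2)) \<partial>lborel) = ennreal (sqrt (pi / \<nu>))"
proof -
  define s where "s = sqrt (1 / (2 * \<nu>))"
  have s: "s > 0" "2 * s\<^sup>2 = 1 / \<nu>"
    using assms by (auto simp: s_def)
  have eq: "exp (- \<nu> * x\<^sup>2) = sqrt (pi / \<nu>) * normal_density 0 s x" for x :: real
  proof -
    have "2 * pi * s\<^sup>2 = pi / \<nu>"
      using s(2) by (metis mult.assoc mult.commute mult.right_neutral times_divide_eq_right)
    moreover have "x\<^sup>2 / (2 * s\<^sup>2) = \<nu> * x\<^sup>2"
      using assms by (simp add: s(2))
    moreover have "sqrt (pi / \<nu>) \<noteq> 0"
      using assms by simp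
    ultimately show ?thesis
      by (simp add: normal_density_def)
  qed
  have "(\<integral>\<^sup>+x. ennreal (exp (- \<nu> * x\<^sup>2)) \<partial>lborel)
      = ennreal (sqrt (pi / \<nu>)) * (\<integral>\<^sup>+x. ennreal (normal_density 0 s x) \<partial>lborel)"
    using assms unfolding eq by (subst nn_integral_cmult[symmetric]) (auto simp: ennreal_mult)
  also have "(\<integral>\<^sup>+x. ennreal (normal_density 0 s x) \<partial>lborel) = 1"
    using prob_space_normal_density[OF s(1), of 0, THEN prob_space.emeasure_space_1]
    by (simp add: emeasure_density)
  finally show ?thesis
    by simp
qed

text \<open>
  The Gaussian weight is the product of its restrictions to the two axes.
\<close>

lemma nn_integral_gaussian_complex:
  fixes \<nu> :: real
  assumes "\<nu> > 0"
  shows "(\<integral>\<^sup>+w. ennreal (exp (- \<nu> * (cmod w)\<^sup>2)) \<partial>lborel) = ennreal (pi / \<nu>)"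
proof -
  have "ennreal (exp (- \<nu> * (cmod w)\<^sup>2)) = (\<Prod>b\<in>Basis. ennreal (exp (- \<nu> * (w \<bullet> b)\<^sup>2)))" for w
    by (simp add: Basis_complex_def cmod_power2 ennreal_mult[symmetric] exp_add[symmetric] algebra_simps)
  then have "(\<integral>\<^sup>+w. ennreal (exp (- \<nu> * (cmod w)\<^sup>2)) \<partial>lborel)
      = (\<Prod>b\<in>(Basis :: complex set). (\<integral>\<^sup>+x. ennreal (exp (- \<nu> * x\<^sup>2)) \<partial>lborel))"
    by (subst nn_integral_lborel_prod[symmetric]) auto
  also have "\<dots> = ennreal (sqrt (pi / \<nu>)) * ennreal (sqrt (pi / \<nu>))"
    by (simp only: nn_integral_gaussian_real[OF assms]) (simp add: Basis_complex_def)
  also have "\<dots> = ennreal (pi / \<nu>)"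
    using assms by (simp add: ennreal_mult[symmetric])
  finally show ?thesis .
qed

lemma gaussian_complex:
  fixes \<nu> :: real
  assumes "\<nu> > 0"
  shows "has_bochner_integral lborel (\<lambda>w. exp (- \<nu> * (cmod w)\<^sup>2)) (pi / \<nu>)"
  using assms nn_integral_gaussian_complex[OF assms]
  by (intro has_bochner_integral_nn_integral) auto

text \<open>
  Averaging the identity $F(z+v)-F(z) = \int_0^1 D_vF(z+sv)\,ds$ over $z$ gives $0$ on the left and
  $\int D_vF$ on the right, by translation invariance.
\<close>

lemma integral_directional_derivative_zero:
  fixes F F' :: "complex \<Rightarrow> complex"
  assumes deriv: "\<And>z. (F has_derivative D z) (at z)" "\<And>z. D z v = F' z"
    and intF: "integrable lborel F" and intF': "integrable lborel F'"
    and cont: "continuous_on UNIV F'"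
  shows "(\<integral>z. F' z \<partial>lborel) = 0"
proof -
  have mF: "F \<in> borel_measurable borel" and mF' [measurable]: "F' \<in> borel_measurable borel"
    using intF intF' by (auto dest: borel_measurable_integrable)
  define G where "G = (\<lambda>z (s::real). indicator {0..1} s *\<^sub>R F' (s *\<^sub>R v + z))"
  have G_meas [measurable]: "case_prod G \<in> borel_measurable (lborel \<Otimes>\<^sub>M lborel)"
    unfolding G_def by measurable
  have ftc: "(\<integral>s. G z s \<partial>lborel) = F (v + z) - F z" for z
  proof -
    have "((\<lambda>s. F (s *\<^sub>R v + z)) has_vector_derivative F' (s *\<^sub>R v + z)) (at s within {0..1})" for s
    proof -
      have "((\<lambda>s. F (s *\<^sub>R v + z)) has_derivative (\<lambda>h. D (s *\<^sub>R v + z) (h *\<^sub>R v))) (at s within {0..1})"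
        by (rule has_derivative_compose[of "\<lambda>s. s *\<^sub>R v + z" "\<lambda>h. h *\<^sub>R v" _ _ F, OF _ deriv(1)])
          (auto intro!: derivative_eq_intros)
      moreover have "D (s *\<^sub>R v + z) (h *\<^sub>R v) = h *\<^sub>R F' (s *\<^sub>R v + z)" for h
        using has_derivative_linear[OF deriv(1)] deriv(2) by (simp add: linear_scale)
      ultimately show ?thesis
        by (simp add: has_vector_derivative_def)
    qed
    moreover have "continuous_on {0..1} (\<lambda>s. F' (s *\<^sub>R v + z))"
      by (intro continuous_on_compose2[OF cont] continuous_intros) auto
    ultimately show ?thesis
      unfolding G_def by (subst integral_FTC_Icc[where F="\<lambda>s. F (s *\<^sub>R v + z)"]) auto
  qed
  have fin: "(\<integral>\<^sup>+s. \<integral>\<^sup>+z. ennreal (norm (G z s)) \<partial>lborel \<partial>lborel) < \<infinity>"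
  proof -
    have "(\<integral>\<^sup>+z. ennreal (norm (G z s)) \<partial>lborel)
        = indicator {0..1} s * (\<integral>\<^sup>+z. ennreal (norm (F' z)) \<partial>lborel)" for s
    proof -
      have "(\<integral>\<^sup>+z. ennreal (norm (G z s)) \<partial>lborel)
          = indicator {0..1} s * (\<integral>\<^sup>+z. ennreal (norm (F' (s *\<^sub>R v + z))) \<partial>lborel)"
        by (subst nn_integral_cmult[symmetric]) (auto simp: G_def indicator_def intro!: nn_integral_cong)
      then show ?thesis
        by (subst (asm) nn_integral_lborel_translation[where f="\<lambda>z. ennreal (norm (F' z))"]) auto
    qed
    moreover have "(\<integral>\<^sup>+z. ennreal (norm (F' z)) \<partial>lborel) < \<infinity>"
      using intF' by (simp add: integrable_iff_bounded)
    ultimately show ?thesis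
      by (simp add: nn_integral_multc)
  qed
  have int: "integrable (lborel \<Otimes>\<^sub>M lborel) (case_prod G)"
  proof (rule integrableI_bounded)
    have "(\<integral>\<^sup>+p. ennreal (norm (case_prod G p)) \<partial>(lborel \<Otimes>\<^sub>M lborel))
       = (\<integral>\<^sup>+s. \<integral>\<^sup>+z. ennreal (norm (G z s)) \<partial>lborel \<partial>lborel)"
      by (subst lborel_pair.nn_integral_snd[symmetric]) auto
    then show "(\<integral>\<^sup>+p. ennreal (norm (case_prod G p)) \<partial>(lborel \<Otimes>\<^sub>M lborel)) < \<infinity>"
      using fin by simp
  qed measurable
  have "(\<integral>s. \<integral>z. G z s \<partial>lborel \<partial>lborel) = (\<integral>z. \<integral>s. G z s \<partial>lborel \<partial>lborel)"
    by (rule lborel_pair.Fubini_integral[OF int])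
  also have "\<dots> = (\<integral>z. F (v + z) - F z \<partial>lborel)"
    by (simp add: ftc)
  also have "\<dots> = 0"
    using intF mF by (subst Bochner_Integration.integral_diff)
      (auto simp: integrable_lborel_translation_iff integral_lborel_translation)
  finally have "(\<integral>s. \<integral>z. G z s \<partial>lborel \<partial>lborel) = 0" .
  moreover have "(\<integral>z. G z s \<partial>lborel) = indicator {0..1} s *\<^sub>R (\<integral>z. F' z \<partial>lborel)" for s
    unfolding G_def by (simp add: integral_lborel_translation)
  ultimately show ?thesis
    by simp
qed

section \<open>Wirtinger derivatives\<close>

text \<open>
  The derivative in complex form: $p$ and $q$ are the values of $\partial f$ and
  $\overline{\partial} f$. Having them as arguments makes the product rule and the other differentiation rules
  compositional.
\<close>

definition has_wirtinger :: "(complex \<Rightarrow> complex) \<Rightarrow> (complex \<Rightarrow> complex) \<Rightarrow> (complex \<Rightarrow> complex) \<Rightarrow> bool" where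
  "has_wirtinger f p q \<longleftrightarrow> (\<forall>z. (f has_derivative (\<lambda>v. p z * v + q z * cnj v)) (at z))"

lemma has_wirtingerD: "has_wirtinger f p q \<Longrightarrow> (f has_derivative (\<lambda>v. p z * v + q z * cnj v)) (at z)"
  by (simp add: has_wirtinger_def)

lemma frechet_derivative_wirtinger:
  "has_wirtinger f p q \<Longrightarrow> frechet_derivative f (at z) = (\<lambda>v. p z * v + q z * cnj v)"
  using frechet_derivative_at[OF has_wirtingerD] by simp

lemma d_z_eq: "has_wirtinger f p q \<Longrightarrow> d_z f = p"
  by (auto simp: fun_eq_iff d_z_def frechet_derivative_wirtinger algebra_simps)

lemma d_zbar_eq: "has_wirtinger f p q \<Longrightarrow> d_zbar f = q"
  by (auto simp: fun_eq_iff d_zbar_def frechet_derivative_wirtinger algebra_simps)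

lemma has_wirtinger_differentiable:
  assumes "\<And>z. f differentiable (at z)"
  shows "has_wirtinger f (d_z f) (d_zbar f)"
proof -
  have "(f has_derivative (\<lambda>v. d_z f z * v + d_zbar f z * cnj v)) (at z)" for z
  proof -
    let ?D = "frechet_derivative f (at z)"
    have D: "(f has_derivative ?D) (at z)"
      using assms frechet_derivative_works by blast
    have lin: "linear ?D"
      using has_derivative_linear[OF D] .
    have "?D v = d_z f z * v + d_zbar f z * cnj v" for v
    proof -
      have "v = Re v *\<^sub>R 1 + Im v *\<^sub>R \<i>"
        by (simp add: complex_eq_iff)
      then have "?D v = ?D (Re v *\<^sub>R 1 + Im v *\<^sub>R \<i>)"
        by simp
      also have "\<dots> = Re v *\<^sub>R ?D 1 + Im v *\<^sub>R ?D \<i>"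
        using lin by (simp add: linear_add linear_scale)
      also have "\<dots> = d_z f z * v + d_zbar f z * cnj v"
        by (simp add: d_z_def d_zbar_def complex_eq_iff scaleR_conv_of_real field_simps)
      finally show ?thesis .
    qed
    then show ?thesis
      using D by (metis (no_types, lifting) ext)
  qed
  then show ?thesis
    by (simp add: has_wirtinger_def)
qed

lemma has_wirtinger_eq_rhs:
  "has_wirtinger f p q \<Longrightarrow> (\<And>z. p z = p' z) \<Longrightarrow> (\<And>z. q z = q' z) \<Longrightarrow> has_wirtinger f p' q'"
  by (simp add: has_wirtinger_def)

lemma has_wirtinger_mult:
  assumes "has_wirtinger f p q" "has_wirtinger g r s"
  shows "has_wirtinger (\<lambda>z. f z * g z) (\<lambda>z. p z * g z + f z * r z) (\<lambda>z. q z * g z + f z * s z)"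
  unfolding has_wirtinger_def
proof
  fix z
  show "((\<lambda>z. f z * g z) has_derivative
      (\<lambda>v. (p z * g z + f z * r z) * v + (q z * g z + f z * s z) * cnj v)) (at z)"
    by (rule has_derivative_eq_rhs[OF has_derivative_mult[OF assms(1)[THEN has_wirtingerD] assms(2)[THEN has_wirtingerD]]])
      (auto simp: algebra_simps)
qed

lemma has_wirtinger_diff:
  assumes "has_wirtinger f p q" "has_wirtinger g r s"
  shows "has_wirtinger (\<lambda>z. f z - g z) (\<lambda>z. p z - r z) (\<lambda>z. q z - s z)"
  unfolding has_wirtinger_def
proof
  fix z
  show "((\<lambda>z. f z - g z) has_derivative (\<lambda>v. (p z - r z) * v + (q z - s z) * cnj v)) (at z)"
    by (rule has_derivative_eq_rhs[OF has_derivative_diff[OF assms(1)[THEN has_wirtingerD] assms(2)[THEN has_wirtingerD]]])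
      (auto simp: algebra_simps)
qed

lemma has_wirtinger_holomorphic:
  assumes "f holomorphic_on UNIV"
  shows "has_wirtinger f (deriv f) (\<lambda>_. 0)"
  using holomorphic_derivI[OF assms open_UNIV] by (simp add: has_wirtinger_def has_field_derivative_def)

lemma has_wirtinger_const: "has_wirtinger (\<lambda>_. c) (\<lambda>_. 0) (\<lambda>_. 0)"
  by (simp add: has_wirtinger_def)

lemma has_wirtinger_cnj: "has_wirtinger cnj (\<lambda>_. 0) (\<lambda>_. 1)"
  by (auto simp: has_wirtinger_def intro!: has_derivative_cnj[of "\<lambda>x. x" "\<lambda>x. x", simplified])

lemma has_wirtinger_cmult_right:
  "has_wirtinger f p q \<Longrightarrow> has_wirtinger (\<lambda>z. c * f z) (\<lambda>z. c * p z) (\<lambda>z. c * q z)"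
  by (drule has_wirtinger_mult[OF has_wirtinger_const[of c]]) simp

lemma has_wirtinger_cnj_mult:
  "has_wirtinger f p q \<Longrightarrow> has_wirtinger (\<lambda>z. c * cnj z * f z) (\<lambda>z. c * cnj z * p z) (\<lambda>z. c * f z + c * cnj z * q z)"
  using has_wirtinger_mult[OF has_wirtinger_cmult_right[OF has_wirtinger_cnj, of c], of f p q] by simp

lemma continuous_on_has_wirtinger: "has_wirtinger f p q \<Longrightarrow> continuous_on UNIV f"
  by (meson UNIV_I continuous_at_imp_continuous_on has_derivative_continuous has_wirtingerD)

text \<open>
  The weight, complex-valued so that it can be differentiated as a factor of complex functions.
\<close>

definition gaussian :: "real \<Rightarrow> complex \<Rightarrow> complex" where
  "gaussian \<nu> w = exp (- (of_real \<nu> * w * cnj w))"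

lemma gaussian_eq: "gaussian \<nu> w = of_real (exp (- \<nu> * (cmod w)\<^sup>2))"
  by (simp add: gaussian_def exp_of_real[symmetric] complex_norm_square[symmetric] mult.assoc)

lemma has_wirtinger_gaussian:
  "has_wirtinger (gaussian \<nu>) (\<lambda>z. - of_real \<nu> * cnj z * gaussian \<nu> z) (\<lambda>z. - of_real \<nu> * z * gaussian \<nu> z)"
  unfolding has_wirtinger_def gaussian_def
proof
  fix z
  have "((\<lambda>w. - (of_real \<nu> * w * cnj w)) has_derivative
     (\<lambda>v. - (of_real \<nu> * v * cnj z + of_real \<nu> * z * cnj v))) (at z)"
    by (auto intro!: derivative_eq_intros simp: algebra_simps)
  from has_derivative_compose[OF this DERIV_exp[unfolded has_field_derivative_def]]
  show "((\<lambda>w. exp (- (of_real \<nu> * w * cnj w))) has_derivative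
      (\<lambda>v. - of_real \<nu> * cnj z * exp (- (of_real \<nu> * z * cnj z)) * v
         + - of_real \<nu> * z * exp (- (of_real \<nu> * z * cnj z)) * cnj v)) (at z)"
    by (rule has_derivative_eq_rhs) (auto simp: algebra_simps)
qed

section \<open>Functions of class $C^k$\<close>

lemma class_C_lincomb:
  "class_C k f \<Longrightarrow> class_C k g \<Longrightarrow> class_C k (\<lambda>z. a * f z + b * g z)"
proof (induction k arbitrary: f g)
  case 0
  then show ?case
    by (auto intro!: continuous_intros)
next
  case (Suc k)
  have "frechet_derivative (\<lambda>z. a * f z + b * g z) (at z)
      = (\<lambda>v. a * frechet_derivative f (at z) v + b * frechet_derivative g (at z) v)" for z
    using Suc.prems
    by (intro frechet_derivative_at[symmetric] has_derivative_add has_derivative_mult_right)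
      (auto simp: frechet_derivative_works)
  then show ?case
    using Suc by (auto intro!: derivative_intros)
qed

lemma class_C_Suc_wirtinger:
  assumes "has_wirtinger f p q" "class_C k p" "class_C k q"
  shows "class_C (Suc k) f"
proof -
  have "f differentiable (at z)" for z
    using has_wirtingerD[OF assms(1)] by (auto simp: differentiable_def)
  moreover have "class_C k (\<lambda>z. v * p z + cnj v * q z)" for v
    using class_C_lincomb assms(2,3) .
  ultimately show ?thesis
    by (simp add: frechet_derivative_wirtinger[OF assms(1)] mult.commute)
qed

lemma continuous_on_class_C: "class_C k f \<Longrightarrow> continuous_on UNIV f"
  by (cases k) (auto intro!: continuous_at_imp_continuous_on differentiable_imp_continuous_within)

text \<open>
  Class $C^2$ in the form suited to the eigenvalue equation, which is a first-order system for $f$ and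
  $\overline{\partial} f$.
\<close>

lemma class_C_2_d_zbar:
  assumes "class_C 2 f"
  shows "has_wirtinger f (d_z f) (d_zbar f)" "continuous_on UNIV (d_z f)" "continuous_on UNIV (d_zbar f)"
    and "has_wirtinger (d_zbar f) (d_z (d_zbar f)) (d_zbar (d_zbar f))"
    and "continuous_on UNIV (d_z (d_zbar f))" "continuous_on UNIV (d_zbar (d_zbar f))"
proof -
  have lin: "class_C k (\<lambda>z. (g z + c * h z) / 2)" if "class_C k g" "class_C k h" for k g h c
    using class_C_lincomb[OF that, of "1/2" "c/2"] by (simp add: field_simps)
  have parts: "has_wirtinger g (d_z g) (d_zbar g)" "class_C k (d_z g)" "class_C k (d_zbar g)"
    if "class_C (Suc k) g" for k g
  proof -
    show "has_wirtinger g (d_z g) (d_zbar g)"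
      using that by (intro has_wirtinger_differentiable) auto
    show "class_C k (d_z g)" "class_C k (d_zbar g)"
      using that lin[of k "\<lambda>z. frechet_derivative g (at z) 1" "\<lambda>z. frechet_derivative g (at z) \<i>" "- \<i>"]
        lin[of k "\<lambda>z. frechet_derivative g (at z) 1" "\<lambda>z. frechet_derivative g (at z) \<i>" "\<i>"]
      unfolding d_z_def[abs_def] d_zbar_def[abs_def] by (auto simp del: class_C.simps simp: class_C.simps(2))
  qed
  have 2: "class_C (Suc (Suc 0)) f"
    using assms by (simp only: numeral_2_eq_2)
  note p = parts[OF 2]
  show "has_wirtinger f (d_z f) (d_zbar f)"
    by (rule p)
  show "continuous_on UNIV (d_z f)" "continuous_on UNIV (d_zbar f)"
    using p(2,3) continuous_on_class_C by blast+
  note r = parts[OF p(3)]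
  show "has_wirtinger (d_zbar f) (d_z (d_zbar f)) (d_zbar (d_zbar f))"
    by (rule r)
  show "continuous_on UNIV (d_z (d_zbar f))" "continuous_on UNIV (d_zbar (d_zbar f))"
    using r(2,3) by auto
qed

section \<open>The creation operator and the complex Hermite polynomials\<close>

text \<open>
  On holomorphic $h$ this is $(A^*)^n h$ for $A^* = -\partial + \nu\overline{z}$. Since $\partial$ commutes
  with $A^*$ and maps $h$ to its complex derivative, the recursion can take that derivative on the innermost function,
  where it is an ordinary holomorphic derivative.
\<close>

primrec creation :: "real \<Rightarrow> nat \<Rightarrow> (complex \<Rightarrow> complex) \<Rightarrow> complex \<Rightarrow> complex" where
  "creation \<nu> 0 h = h"
| "creation \<nu> (Suc n) h = (\<lambda>z. of_real \<nu> * cnj z * creation \<nu> n h z - creation \<nu> n (deriv h) z)"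

lemma deriv_lincomb:
  assumes "g holomorphic_on UNIV" "h holomorphic_on UNIV"
  shows "deriv (\<lambda>z. a * g z + b * h z) = (\<lambda>z. a * deriv g z + b * deriv h z)"
  using holomorphic_derivI[OF assms(1) open_UNIV] holomorphic_derivI[OF assms(2) open_UNIV]
  by (intro ext DERIV_imp_deriv derivative_eq_intros) auto

lemma creation_lincomb:
  assumes "g holomorphic_on UNIV" "h holomorphic_on UNIV"
  shows "creation \<nu> n (\<lambda>z. a * g z + b * h z) z = a * creation \<nu> n g z + b * creation \<nu> n h z"
  using assms
proof (induction n arbitrary: g h z)
  case (Suc n)
  show ?case
    using Suc.prems
    by (simp add: deriv_lincomb Suc.IH holomorphic_deriv algebra_simps)
qed simp

lemma creation_cmult:
  assumes "h holomorphic_on UNIV"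
  shows "creation \<nu> n (\<lambda>z. c * h z) z = c * creation \<nu> n h z"
  using creation_lincomb[OF assms assms, of \<nu> n c 0] by simp

lemma creation_const: "creation \<nu> n (\<lambda>_. c) z = c * (of_real \<nu> * cnj z) ^ n"
proof (induction n arbitrary: c z)
  case (Suc n)
  have "deriv (\<lambda>_::complex. c) = (\<lambda>_. 0)"
    by (auto simp: fun_eq_iff)
  then show ?case
    by (simp add: Suc)
qed simp

text \<open>
  $\partial$ commutes with $A^*$, while $\overline{\partial}A^* = A^*\overline{\partial} + \nu$ and
  $\overline{\partial} h = 0$ yield the factor $\nu n$. For $n = 0$ that factor is $0$, so the truncated
  $n - 1$ is harmless.
\<close>

lemma has_wirtinger_creation:
  assumes "h holomorphic_on UNIV"
  shows "has_wirtinger (creation \<nu> n h) (creation \<nu> n (deriv h))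
    (\<lambda>z. of_real \<nu> * of_nat n * creation \<nu> (n - 1) h z)"
  using assms
proof (induction n arbitrary: h)
  case 0
  then show ?case
    using has_wirtinger_holomorphic by simp
next
  case (Suc n)
  have h': "deriv h holomorphic_on UNIV"
    using Suc.prems by (simp add: holomorphic_deriv)
  show ?case
    unfolding creation.simps
    by (rule has_wirtinger_eq_rhs[OF has_wirtinger_diff[OF has_wirtinger_cnj_mult[OF Suc.IH[OF Suc.prems]] Suc.IH[OF h']]])
      (cases n; simp add: algebra_simps)+
qed

lemma continuous_on_creation: "h holomorphic_on UNIV \<Longrightarrow> continuous_on UNIV (creation \<nu> n h)"
  using has_wirtinger_creation continuous_on_has_wirtinger by blast

lemma class_C_creation: "h holomorphic_on UNIV \<Longrightarrow> class_C k (creation \<nu> n h)"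
proof (induction k arbitrary: n h)
  case 0
  then show ?case
    by (simp add: continuous_on_creation)
next
  case (Suc k)
  have "class_C k (\<lambda>z. of_real \<nu> * of_nat n * creation \<nu> (n - 1) h z)"
    using class_C_lincomb[OF Suc.IH[OF Suc.prems] Suc.IH[OF Suc.prems], of "of_real \<nu> * of_nat n" _ 0] by simp
  then show ?case
    using Suc by (intro class_C_Suc_wirtinger[OF has_wirtinger_creation[OF Suc.prems]]) (auto intro: holomorphic_deriv)
qed

lemma Delta_creation:
  assumes "h holomorphic_on UNIV"
  shows "Delta \<nu> (creation \<nu> n h) z = of_real \<nu> * of_nat n * creation \<nu> n h z"
proof -
  note w = has_wirtinger_creation[OF assms]
  have "d_z (\<lambda>z. of_real \<nu> * of_nat n * creation \<nu> (n - 1) h z)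
      = (\<lambda>z. of_real \<nu> * of_nat n * creation \<nu> (n - 1) (deriv h) z)"
    by (rule d_z_eq[OF has_wirtinger_cmult_right[OF w]])
  then show ?thesis
    unfolding Delta_def d_zbar_eq[OF w] by (cases n) (simp_all add: algebra_simps)
qed

lemma creation_in_fock:
  assumes "h holomorphic_on UNIV" "creation \<nu> n h \<in> L2 \<nu>"
  shows "creation \<nu> n h \<in> fock \<nu> n"
  using assms by (simp add: fock_def class_C_creation Delta_creation)

lemma holomorphic_weyl:
  assumes "h holomorphic_on UNIV"
  shows "(\<lambda>w. exp (c * w) * h (z + w)) holomorphic_on UNIV"
  by (intro holomorphic_intros holomorphic_on_compose_gen[OF _ assms, unfolded o_def]) auto

text \<open>
  $-\partial$ of the exponential factor contributes $\nu\overline{z}$, which is precisely the difference between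
  $\nu\overline{z+w}$ and $\nu\overline{w}$: the creation operator is invariant under Weyl translations.
\<close>

lemma creation_weyl:
  assumes "h holomorphic_on UNIV"
  shows "creation \<nu> n (\<lambda>w. exp (- of_real \<nu> * cnj z * w) * h (z + w)) w
    = exp (- of_real \<nu> * cnj z * w) * creation \<nu> n h (z + w)"
  using assms
proof (induction n arbitrary: h w)
  case (Suc n)
  define E where "E = (\<lambda>w. exp (- of_real \<nu> * cnj z * w))"
  have h': "deriv h holomorphic_on UNIV"
    using Suc.prems by (simp add: holomorphic_deriv)
  have "deriv (\<lambda>w. E w * h (z + w)) w = 1 * (E w * deriv h (z + w)) + (- of_real \<nu> * cnj z) * (E w * h (z + w))" for w
  proof (rule DERIV_imp_deriv)
    have "((\<lambda>w. h (z + w)) has_field_derivative deriv h (z + w)) (at w)"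
      using DERIV_shift[of h "deriv h (z + w)" w z] holomorphic_derivI[OF Suc.prems open_UNIV, of "w + z"]
      by (simp add: add.commute)
    then show "((\<lambda>w. E w * h (z + w)) has_field_derivative
        1 * (E w * deriv h (z + w)) + (- of_real \<nu> * cnj z) * (E w * h (z + w))) (at w)"
      unfolding E_def by (auto intro!: derivative_eq_intros simp: algebra_simps)
  qed
  then have "deriv (\<lambda>w. E w * h (z + w))
      = (\<lambda>w. 1 * (E w * deriv h (z + w)) + (- of_real \<nu> * cnj z) * (E w * h (z + w)))"
    by blast
  moreover have "(\<lambda>w. E w * h (z + w)) holomorphic_on UNIV" "(\<lambda>w. E w * deriv h (z + w)) holomorphic_on UNIV"
    unfolding E_def using holomorphic_weyl Suc.prems h' by blast+
  ultimately have "creation \<nu> n (deriv (\<lambda>w. E w * h (z + w))) w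
      = 1 * creation \<nu> n (\<lambda>w. E w * deriv h (z + w)) w
        + (- of_real \<nu> * cnj z) * creation \<nu> n (\<lambda>w. E w * h (z + w)) w"
    using creation_lincomb by presburger
  also have "\<dots> = E w * (creation \<nu> n (deriv h) (z + w) - of_real \<nu> * cnj z * creation \<nu> n h (z + w))"
    using Suc.IH[OF Suc.prems] Suc.IH[OF h'] by (simp add: E_def algebra_simps)
  finally show ?case
    using Suc.IH[OF Suc.prems] by (simp add: E_def algebra_simps)
qed simp

text \<open>
  The commutator of $A^*$ with multiplication by $z$ is $-1$.
\<close>

lemma creation_mult_id:
  assumes "h holomorphic_on UNIV"
  shows "creation \<nu> n (\<lambda>z. z * h z) z = z * creation \<nu> n h z - of_nat n * creation \<nu> (n - 1) h z"
  using assms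
proof (induction n arbitrary: h z)
  case (Suc n)
  have h': "deriv h holomorphic_on UNIV"
    using Suc.prems by (simp add: holomorphic_deriv)
  have "deriv (\<lambda>z. z * h z) = (\<lambda>z. 1 * (z * deriv h z) + 1 * h z)"
    using holomorphic_derivI[OF Suc.prems open_UNIV]
    by (intro ext DERIV_imp_deriv) (auto intro!: derivative_eq_intros)
  then have "creation \<nu> n (deriv (\<lambda>z. z * h z)) z = 1 * creation \<nu> n (\<lambda>z. z * deriv h z) z + 1 * creation \<nu> n h z"
    using creation_lincomb[of "\<lambda>z. z * deriv h z" h \<nu> n 1 1] Suc.prems
      holomorphic_on_mult[OF holomorphic_on_id h', unfolded id_def] by presburger
  then have "creation \<nu> (Suc n) (\<lambda>z. z * h z) z
      = of_real \<nu> * cnj z * (z * creation \<nu> n h z - of_nat n * creation \<nu> (n - 1) h z)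
        - (z * creation \<nu> n (deriv h) z - of_nat n * creation \<nu> (n - 1) (deriv h) z + creation \<nu> n h z)"
    by (simp add: Suc.IH[OF Suc.prems] Suc.IH[OF h'])
  also have "\<dots> = z * creation \<nu> (Suc n) h z - of_nat (Suc n) * creation \<nu> n h z"
  proof (cases n)
    case (Suc k)
    then show ?thesis
      unfolding Suc diff_Suc_1 creation.simps by (simp add: algebra_simps)
  qed (simp add: algebra_simps)
  finally show ?case
    by simp
qed simp

lemma d_z_funpow_gaussian:
  "(d_z ^^ n) (gaussian \<nu>) = (\<lambda>w. (-1) ^ n * (creation \<nu> n (\<lambda>_. 1) w * gaussian \<nu> w))"
proof (induction n)
  case (Suc n)
  have "deriv (\<lambda>_::complex. 1::complex) = (\<lambda>_. 0)"
    by (auto simp: fun_eq_iff)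
  then have "has_wirtinger (creation \<nu> n (\<lambda>_. 1)) (\<lambda>_. 0) (\<lambda>z. of_real \<nu> * of_nat n * creation \<nu> (n - 1) (\<lambda>_. 1) z)"
    using has_wirtinger_creation[of "\<lambda>_. 1" \<nu> n] creation_const[of \<nu> n 0]
    by (intro has_wirtinger_eq_rhs[OF has_wirtinger_creation]) (auto simp: creation_const)
  note w = has_wirtinger_cmult_right[OF has_wirtinger_mult[OF this has_wirtinger_gaussian], of "(-1) ^ n"]
  show ?case
    unfolding funpow.simps o_def Suc d_z_eq[OF w] by (simp add: creation_const algebra_simps)
qed simp

lemma holomorphic_scaled_power: "(\<lambda>z. (of_real \<nu> * z) ^ m) holomorphic_on UNIV"
  by (intro holomorphic_intros)

lemma creation_scaled_power_Suc:
  "creation \<nu> n (\<lambda>z. (of_real \<nu> * z) ^ Suc m) w = of_real \<nu> * (w * creation \<nu> n (\<lambda>z. (of_real \<nu> * z) ^ m) w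
      - of_nat n * creation \<nu> (n - 1) (\<lambda>z. (of_real \<nu> * z) ^ m) w)"
proof -
  have "(\<lambda>z::complex. (of_real \<nu> * z) ^ Suc m) = (\<lambda>z. of_real \<nu> * (z * (of_real \<nu> * z) ^ m))"
    by (simp add: mult.assoc)
  moreover have "(\<lambda>z. z * (of_real \<nu> * z) ^ m) holomorphic_on UNIV"
    by (intro holomorphic_intros)
  ultimately show ?thesis
    using creation_cmult creation_mult_id[OF holomorphic_scaled_power] by presburger
qed

text \<open>
  Conjugated with the Gaussian weight, $-\overline{\partial}$ becomes $\nu z - \overline{\partial}$, which
  acts on the image of the creation operator as multiplication of the holomorphic function by $\nu z$.
\<close>

lemma d_zbar_funpow_gaussian:
  "(d_zbar ^^ m) ((d_z ^^ n) (gaussian \<nu>))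
    = (\<lambda>w. (-1) ^ (m + n) * (creation \<nu> n (\<lambda>z. (of_real \<nu> * z) ^ m) w * gaussian \<nu> w))"
proof (induction m)
  case 0
  then show ?case
    by (simp add: d_z_funpow_gaussian)
next
  case (Suc m)
  note w = has_wirtinger_cmult_right[OF has_wirtinger_mult[OF has_wirtinger_creation[OF holomorphic_scaled_power] has_wirtinger_gaussian],
      of "(-1) ^ (m + n)"]
  show ?case
    unfolding funpow.simps o_def Suc d_zbar_eq[OF w] creation_scaled_power_Suc by (auto simp: algebra_simps)
qed

lemma hermite_eq_creation: "hermite \<nu> m n = creation \<nu> n (\<lambda>z. (of_real \<nu> * z) ^ m)"
proof
  fix z
  define C where "C = creation \<nu> n (\<lambda>z. (of_real \<nu> * z) ^ m) z"
  have "hermite \<nu> m n z = (-1) ^ (m + n) * exp (of_real \<nu> * z * cnj z) * ((-1) ^ (m + n) * (C * gaussian \<nu> z))"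
    using d_zbar_funpow_gaussian[of m n \<nu>]
    unfolding hermite_def gaussian_def[abs_def] C_def by simp
  also have "\<dots> = ((-1) ^ (m + n) * (-1) ^ (m + n)) * (exp (of_real \<nu> * z * cnj z) * gaussian \<nu> z) * C"
    by (simp only: mult_ac)
  also have "\<dots> = C"
    by (simp add: gaussian_def exp_minus power_add[symmetric] mult_2[symmetric])
  finally show "hermite \<nu> m n z = creation \<nu> n (\<lambda>z. (of_real \<nu> * z) ^ m) z"
    unfolding C_def .
qed

lemma deriv_scaled_power:
  "deriv (\<lambda>z::complex. (of_real \<nu> * z) ^ m) = (\<lambda>z. of_real \<nu> * of_nat m * (of_real \<nu> * z) ^ (m - 1))"
  by (intro ext DERIV_imp_deriv) (auto intro!: derivative_eq_intros)

lemma creation_deriv_scaled_power: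
  "creation \<nu> n (deriv (\<lambda>z. (of_real \<nu> * z) ^ m)) z = of_real \<nu> * of_nat m * hermite \<nu> (m - 1) n z"
  using creation_cmult[OF holomorphic_scaled_power, of \<nu> n "of_real \<nu> * of_nat m" \<nu> "m - 1" z]
  by (simp add: deriv_scaled_power hermite_eq_creation)

lemma hermite_0_left: "hermite \<nu> 0 n z = (of_real \<nu> * cnj z) ^ n"
  by (simp add: hermite_eq_creation creation_const)

lemma hermite_0_right: "hermite \<nu> m 0 z = (of_real \<nu> * z) ^ m"
  by (simp add: hermite_eq_creation)

lemma hermite_Suc_right:
  "hermite \<nu> m (Suc n) z = of_real \<nu> * cnj z * hermite \<nu> m n z - of_real \<nu> * of_nat m * hermite \<nu> (m - 1) n z"
  using creation_deriv_scaled_power[of \<nu> n m z] by (simp add: hermite_eq_creation)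

lemma hermite_Suc_left:
  "hermite \<nu> (Suc m) n z = of_real \<nu> * z * hermite \<nu> m n z - of_real \<nu> * of_nat n * hermite \<nu> m (n - 1) z"
  unfolding hermite_eq_creation creation_scaled_power_Suc by (simp add: algebra_simps)

lemma has_wirtinger_hermite:
  "has_wirtinger (hermite \<nu> m n) (\<lambda>z. of_real \<nu> * of_nat m * hermite \<nu> (m - 1) n z)
    (\<lambda>z. of_real \<nu> * of_nat n * hermite \<nu> m (n - 1) z)"
  using has_wirtinger_creation[OF holomorphic_scaled_power, of \<nu> n \<nu> m]
  unfolding hermite_eq_creation[symmetric]
  by (rule has_wirtinger_eq_rhs) (simp_all add: creation_deriv_scaled_power)

lemma continuous_on_hermite: "continuous_on UNIV (hermite \<nu> m n)"
  using continuous_on_has_wirtinger[OF has_wirtinger_hermite] .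

lemma cnj_hermite: "cnj (hermite \<nu> m n z) = hermite \<nu> n m z"
proof (induction n arbitrary: m)
  case 0
  then show ?case
    by (simp add: hermite_0_left hermite_0_right)
next
  case (Suc n)
  then show ?case
    by (simp add: hermite_Suc_right hermite_Suc_left)
qed

lemma hermite_rotate:
  assumes "norm c = 1"
  shows "hermite \<nu> m n (c * z) = c ^ m * cnj c ^ n * hermite \<nu> m n z"
proof (induction n arbitrary: m)
  case 0
  then show ?case
    by (simp add: hermite_0_right power_mult_distrib mult_ac)
next
  case (Suc n)
  have 1: "c * cnj c = 1"
    using assms by (simp add: complex_norm_square[symmetric])
  have "of_nat m * (c ^ (m - 1) * X) = of_nat m * (c ^ m * cnj c * X)" for X
  proof (cases m)
    case (Suc k)
    then have "c ^ m * cnj c = c ^ k * (c * cnj c)"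
      by simp
    then show ?thesis
      using 1 Suc by simp
  qed simp
  then have "of_real \<nu> * (of_nat m * (c ^ (m - 1) * (cnj c ^ n * X))) = of_real \<nu> * (of_nat m * (c ^ m * cnj c * (cnj c ^ n * X)))" for X
    by presburger
  from this[of "hermite \<nu> (m - 1) n z"] show ?case
    unfolding hermite_Suc_right Suc right_diff_distrib by (simp add: mult_ac)
qed

lemma hermite_uminus: "hermite \<nu> m n (- z) = (-1) ^ (m + n) * hermite \<nu> m n z"
  using hermite_rotate[of "-1" \<nu> m n z] by (simp add: power_add)

text \<open>
  At the origin only the summand without a factor $\overline{z}$ survives.
\<close>

lemma creation_at_0: "creation \<nu> n h 0 = (-1) ^ n * (deriv ^^ n) h 0"
  by (induction n arbitrary: h) (simp_all add: funpow_Suc_right del: funpow.simps)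

text \<open>
  For $\nu \ne 0$ this value is not zero, so the radial function $H_{n,n}$ can serve as the comparison function in
  the mean value property.
\<close>

lemma hermite_diag_0: "hermite \<nu> n n 0 = (- of_real \<nu>) ^ n * fact n"
  by (induction n) (simp_all add: hermite_0_left hermite_Suc_right algebra_simps)

section \<open>The mean value property\<close>

text \<open>
  The eigenvalue equation as a first-order system: $g = \overline{\partial} f$ and
  $(-\partial + \nu\overline{z})g = \nu n f$. Both derivatives are continuous, so that one may differentiate under
  integrals over circles. The first-order form avoids interchanging mixed second derivatives.
\<close>

definition eigen_pair :: "real \<Rightarrow> nat \<Rightarrow> (complex \<Rightarrow> complex) \<Rightarrow> (complex \<Rightarrow> complex) \<Rightarrow> bool" where
  "eigen_pair \<nu> n f g \<longleftrightarrow>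
     (\<exists>p. has_wirtinger f p g \<and> continuous_on UNIV p) \<and>
     (\<exists>q. has_wirtinger g (\<lambda>z. of_real \<nu> * cnj z * g z - of_real \<nu> * of_nat n * f z) q \<and> continuous_on UNIV q)"

lemma eigen_pair_continuous:
  assumes "eigen_pair \<nu> n f g"
  shows "continuous_on UNIV f" "continuous_on UNIV g"
  using assms continuous_on_has_wirtinger unfolding eigen_pair_def by blast+

lemma eigen_pair_lincomb:
  assumes "eigen_pair \<nu> n f g" "eigen_pair \<nu> n f' g'"
  shows "eigen_pair \<nu> n (\<lambda>z. a * f z - b * f' z) (\<lambda>z. a * g z - b * g' z)"
proof -
  obtain p q p' q' where *: "has_wirtinger f p g" "continuous_on UNIV p"
    "has_wirtinger g (\<lambda>z. of_real \<nu> * cnj z * g z - of_real \<nu> * of_nat n * f z) q" "continuous_on UNIV q"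
    "has_wirtinger f' p' g'" "continuous_on UNIV p'"
    "has_wirtinger g' (\<lambda>z. of_real \<nu> * cnj z * g' z - of_real \<nu> * of_nat n * f' z) q'" "continuous_on UNIV q'"
    using assms unfolding eigen_pair_def by blast
  have "has_wirtinger (\<lambda>z. a * f z - b * f' z) (\<lambda>z. a * p z - b * p' z) (\<lambda>z. a * g z - b * g' z)"
    using * by (intro has_wirtinger_diff has_wirtinger_cmult_right)
  moreover have "has_wirtinger (\<lambda>z. a * g z - b * g' z)
     (\<lambda>z. of_real \<nu> * cnj z * (a * g z - b * g' z) - of_real \<nu> * of_nat n * (a * f z - b * f' z))
     (\<lambda>z. a * q z - b * q' z)"
    by (rule has_wirtinger_eq_rhs[OF has_wirtinger_diff[OF has_wirtinger_cmult_right[OF *(3)] has_wirtinger_cmult_right[OF *(7)]]])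
      (simp_all add: algebra_simps)
  moreover have "continuous_on UNIV (\<lambda>z. a * p z - b * p' z)" "continuous_on UNIV (\<lambda>z. a * q z - b * q' z)"
    using * by (auto intro!: continuous_intros)
  ultimately show ?thesis
    unfolding eigen_pair_def by blast
qed

lemma eigen_pair_creation:
  assumes "h holomorphic_on UNIV"
  shows "eigen_pair \<nu> n (creation \<nu> n h) (\<lambda>z. of_real \<nu> * of_nat n * creation \<nu> (n - 1) h z)"
proof -
  have h': "deriv h holomorphic_on UNIV"
    using assms by (simp add: holomorphic_deriv)
  have "has_wirtinger (\<lambda>z. of_real \<nu> * of_nat n * creation \<nu> (n - 1) h z)
    (\<lambda>z. of_real \<nu> * cnj z * (of_real \<nu> * of_nat n * creation \<nu> (n - 1) h z) - of_real \<nu> * of_nat n * creation \<nu> n h z)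
    (\<lambda>z. of_real \<nu> * of_nat n * (of_real \<nu> * of_nat (n - 1) * creation \<nu> (n - 1 - 1) h z))"
    by (rule has_wirtinger_eq_rhs[OF has_wirtinger_cmult_right[OF has_wirtinger_creation[OF assms]]])
      (cases n; simp add: algebra_simps)+
  moreover have "continuous_on UNIV (\<lambda>z. of_real \<nu> * of_nat n * (of_real \<nu> * of_nat (n - 1) * creation \<nu> (n - 1 - 1) h z))"
    by (intro continuous_intros continuous_on_creation assms)
  ultimately show ?thesis
    unfolding eigen_pair_def using has_wirtinger_creation[OF assms] continuous_on_creation[OF h'] by blast
qed

lemma eigen_pair_fock:
  assumes "f \<in> fock \<nu> n"
  shows "eigen_pair \<nu> n f (d_zbar f)"
proof -
  have c: "class_C 2 f" and D: "\<And>z. Delta \<nu> f z = of_real \<nu> * of_nat n * f z"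
    using assms by (auto simp: fock_def)
  note w = class_C_2_d_zbar[OF c]
  have "of_real \<nu> * cnj z * d_zbar f z - of_real \<nu> * of_nat n * f z = d_z (d_zbar f) z" for z
    using D[of z] by (simp add: Delta_def algebra_simps)
  then show ?thesis
    unfolding eigen_pair_def using w by auto
qed

lemma eigen_pair_weyl:
  assumes "eigen_pair \<nu> n f g"
  shows "eigen_pair \<nu> n (\<lambda>w. exp (- of_real \<nu> * cnj z * w) * f (z + w)) (\<lambda>w. exp (- of_real \<nu> * cnj z * w) * g (z + w))"
proof -
  obtain p q where *: "has_wirtinger f p g" "continuous_on UNIV p"
    "has_wirtinger g (\<lambda>z. of_real \<nu> * cnj z * g z - of_real \<nu> * of_nat n * f z) q" "continuous_on UNIV q"
    using assms unfolding eigen_pair_def by blast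
  define E where "E = (\<lambda>w. exp (- of_real \<nu> * cnj z * w))"
  have E: "has_wirtinger E (\<lambda>w. - of_real \<nu> * cnj z * E w) (\<lambda>_. 0)"
  proof (rule has_wirtinger_eq_rhs[OF has_wirtinger_holomorphic])
    show "E holomorphic_on UNIV"
      unfolding E_def by (intro holomorphic_intros)
    show "deriv E w = - of_real \<nu> * cnj z * E w" for w
      unfolding E_def by (rule DERIV_imp_deriv) (auto intro!: derivative_eq_intros)
  qed simp
  have cE: "continuous_on UNIV E"
    unfolding E_def by (intro continuous_intros)
  have shift: "has_wirtinger (\<lambda>w. h (z + w)) (\<lambda>w. r (z + w)) (\<lambda>w. s (z + w))" if "has_wirtinger h r s" for h r s
    unfolding has_wirtinger_def
  proof
    fix w
    have "((\<lambda>w. z + w) has_derivative (\<lambda>v. v)) (at w)"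
      by (auto intro!: derivative_eq_intros)
    from has_derivative_compose[OF this has_wirtingerD[OF that]]
    show "((\<lambda>w. h (z + w)) has_derivative (\<lambda>v. r (z + w) * v + s (z + w) * cnj v)) (at w)" .
  qed
  have cshift: "continuous_on UNIV (\<lambda>w. h (z + w))" if "continuous_on UNIV h" for h :: "complex \<Rightarrow> complex"
    by (rule continuous_on_compose2[OF that]) (auto intro!: continuous_intros)
  have 1: "has_wirtinger (\<lambda>w. E w * f (z + w)) (\<lambda>w. - of_real \<nu> * cnj z * E w * f (z + w) + E w * p (z + w)) (\<lambda>w. E w * g (z + w))"
    by (rule has_wirtinger_eq_rhs[OF has_wirtinger_mult[OF E shift[OF *(1)]]]) auto
  have 2: "has_wirtinger (\<lambda>w. E w * g (z + w))
      (\<lambda>w. of_real \<nu> * cnj w * (E w * g (z + w)) - of_real \<nu> * of_nat n * (E w * f (z + w))) (\<lambda>w. E w * q (z + w))"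
    by (rule has_wirtinger_eq_rhs[OF has_wirtinger_mult[OF E shift[OF *(3)]]]) (auto simp: algebra_simps)
  have "continuous_on UNIV (\<lambda>w. - of_real \<nu> * cnj z * E w * f (z + w) + E w * p (z + w))"
    "continuous_on UNIV (\<lambda>w. E w * q (z + w))"
    using cE cshift * eigen_pair_continuous[OF assms] by (auto intro!: continuous_intros)
  with 1 2 show ?thesis
    unfolding eigen_pair_def E_def by blast
qed

text \<open>
  An energy argument that tolerates the singularity at $0$: in the derivative of
  $E = |u|^2 + |v|^2$ the singular term contributes $-2|v|^2/r \le 0$, and the rest is at most $C E$ on $[0,R]$.
  Hence $e^{-Cr}E$ is nonincreasing, and it vanishes at $0$.
\<close>

lemma radial_system_unique:
  fixes u v :: "real \<Rightarrow> complex"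
  assumes "\<nu> \<ge> 0"
    and u: "\<And>r. r > 0 \<Longrightarrow> (u has_vector_derivative 2 * v r) (at r)"
    and v: "\<And>r. r > 0 \<Longrightarrow> (v has_vector_derivative
      2 * of_real (\<nu> * r) * v r - 2 * of_real \<nu> * of_nat n * u r - v r / of_real r) (at r)"
    and cont: "continuous_on {0..} u" "continuous_on {0..} v"
    and zero: "u 0 = 0" "v 0 = 0" and "R \<ge> 0"
  shows "u R = 0"
proof (cases "R = 0")
  case False
  then have R: "R > 0"
    using \<open>R \<ge> 0\<close> by simp
  \<comment> \<open>an upper bound for $E'/E$ on $(0,R]$, from $2|u \cdot v| \le E$\<close>
  define C where "C = 2 + 2 * \<nu> * real n + 4 * \<nu> * R"
  define E where "E = (\<lambda>r. (norm (u r))\<^sup>2 + (norm (v r))\<^sup>2)"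
  define v' where "v' = (\<lambda>r. 2 * of_real (\<nu> * r) * v r - 2 * of_real \<nu> * of_nat n * u r - v r / of_real r)"
  define E' where "E' = (\<lambda>r. 2 * (u r \<bullet> (2 * v r)) + 2 * (v r \<bullet> v' r))"
  have dE: "(E has_real_derivative E' r) (at r)" if "r > 0" for r
  proof -
    have du: "(u has_derivative (\<lambda>h. h *\<^sub>R (2 * v r))) (at r)"
      using u[OF that] by (simp add: has_vector_derivative_def)
    have dv: "(v has_derivative (\<lambda>h. h *\<^sub>R v' r)) (at r)"
      using v[OF that] by (simp add: has_vector_derivative_def v'_def)
    have "((\<lambda>r. u r \<bullet> u r + v r \<bullet> v r) has_derivative
        (\<lambda>h. (u r \<bullet> (h *\<^sub>R (2 * v r)) + (h *\<^sub>R (2 * v r)) \<bullet> u r) + (v r \<bullet> (h *\<^sub>R v' r) + (h *\<^sub>R v' r) \<bullet> v r))) (at r)"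
      by (intro has_derivative_add has_derivative_inner du dv)
    then show ?thesis
      unfolding has_field_derivative_def E_def E'_def power2_norm_eq_inner
      by (rule has_derivative_eq_rhs) (auto simp: inner_commute algebra_simps)
  qed
  have bound: "E' r \<le> C * E r" if r: "r > 0" "r \<le> R" for r
  proof -
    have uv: "u r \<bullet> v r \<le> E r / 2" "- (u r \<bullet> v r) \<le> E r / 2"
    proof -
      have "0 \<le> (norm (u r - v r))\<^sup>2" "0 \<le> (norm (u r + v r))\<^sup>2"
        by auto
      then show "u r \<bullet> v r \<le> E r / 2" "- (u r \<bullet> v r) \<le> E r / 2"
        unfolding E_def power2_norm_eq_inner by (simp_all add: inner_commute algebra_simps)
    qed
    have E0: "E r \<ge> 0" "(norm (v r))\<^sup>2 \<le> E r"
      by (auto simp: E_def)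
    have 1: "u r \<bullet> (2 * v r) = 2 * (u r \<bullet> v r)"
      using inner_scaleR_right[of "u r" 2 "v r"] by (simp add: scaleR_conv_of_real)
    have v'_eq: "v' r = (2 * \<nu> * r) *\<^sub>R v r - (2 * \<nu> * real n) *\<^sub>R u r - (1 / r) *\<^sub>R v r"
      by (simp add: v'_def scaleR_conv_of_real field_simps)
    have 2: "v r \<bullet> v' r = 2 * \<nu> * r * (norm (v r))\<^sup>2 - 2 * \<nu> * real n * (u r \<bullet> v r) - (norm (v r))\<^sup>2 / r"
      unfolding v'_eq power2_norm_eq_inner by (simp add: inner_diff_right inner_commute)
    have 3: "2 * \<nu> * r * (norm (v r))\<^sup>2 \<le> 2 * \<nu> * R * E r"
      using assms(1) r E0 by (intro mult_mono) auto
    have 4: "2 * \<nu> * real n * (- (u r \<bullet> v r)) \<le> 2 * \<nu> * real n * (E r / 2)"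
      using uv assms(1) by (intro mult_left_mono) auto
    have 5: "(norm (v r))\<^sup>2 / r \<ge> 0"
      using r by simp
    have "E' r \<le> 4 * (E r / 2) + 2 * (2 * \<nu> * R * E r + 2 * \<nu> * real n * (E r / 2))"
      unfolding E'_def 1 2 using uv(1) 3 4 5 by (simp add: algebra_simps)
    also have "\<dots> = C * E r"
      by (simp add: C_def algebra_simps)
    finally show ?thesis .
  qed
  have "exp (- C * R) * E R \<le> exp (- C * 0) * E 0"
  proof (rule DERIV_nonpos_imp_decreasing_open[OF less_imp_le[OF R]])
    show "\<exists>y. ((\<lambda>r. exp (- C * r) * E r) has_real_derivative y) (at r) \<and> y \<le> 0" if r: "0 < r" "r < R" for r
    proof (intro exI conjI)
      show "((\<lambda>r. exp (- C * r) * E r) has_real_derivative exp (- C * r) * (E' r - C * E r)) (at r)"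
        using dE[OF r(1)] by (auto intro!: derivative_eq_intros simp: algebra_simps)
      show "exp (- C * r) * (E' r - C * E r) \<le> 0"
        using bound[of r] r by (intro mult_nonneg_nonpos) auto
    qed
    show "continuous_on {0..R} (\<lambda>r. exp (- C * r) * E r)"
      unfolding E_def
      by (intro continuous_intros continuous_on_subset[OF cont(1)] continuous_on_subset[OF cont(2)]) auto
  qed
  then have "E R \<le> 0"
    by (simp add: E_def zero mult_le_0_iff)
  then show ?thesis
    by (simp add: E_def sum_power2_le_zero_iff)
qed (simp add: zero)

text \<open>
  Let $u$ be the circular mean of $f$ and $v$ that of $e^{-i\theta}g$. Expressing $\partial$ and
  $\overline{\partial}$ by radial and angular derivatives and integrating the angular ones by parts turns the system for
  $f$ and $g$ into the radial system $u' = 2v$, $v' = 2\nu r v - 2\nu n u - v/r$. Both means vanish at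
  $r = 0$. The phase $\alpha$ lets the circle start at any of its points.
\<close>

lemma circle_average_eigen_zero:
  assumes "\<nu> \<ge> 0" "eigen_pair \<nu> n f g" "f 0 = 0" "R \<ge> 0"
  shows "integral {0..2 * pi} (\<lambda>\<theta>. f (of_real R * cis (\<alpha> + \<theta>))) = 0"
proof -
  define e where "e = (\<lambda>\<theta>. cis (\<alpha> + \<theta>))"
  have e_cont [continuous_intros]: "continuous_on A (\<lambda>x. e (h x))" if "continuous_on A h" for A :: "'x::topological_space set" and h
    unfolding e_def using that by (intro continuous_intros)
  have e_deriv: "(e has_vector_derivative \<i> * e \<theta>) (at \<theta> within A)" for \<theta> A
    unfolding e_def has_vector_derivative_def
    by (auto intro!: derivative_eq_intros simp: scaleR_conv_of_real)
  have e_cnj: "e \<theta> * cnj (e \<theta>) = 1" for \<theta>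
    by (simp add: e_def cis_cnj cis_mult)
  have e_per: "e (2 * pi) = e 0"
    by (simp add: e_def cis_mult[symmetric])
  obtain p q where *: "has_wirtinger f p g" "continuous_on UNIV p"
    "has_wirtinger g (\<lambda>z. of_real \<nu> * cnj z * g z - of_real \<nu> * of_nat n * f z) q" "continuous_on UNIV q"
    using assms(2) unfolding eigen_pair_def by blast
  note cfg = eigen_pair_continuous[OF assms(2)]
  have circ: "continuous_on A (\<lambda>x. h (of_real (r x) * e (k x)))"
    if "continuous_on UNIV h" "continuous_on A r" "continuous_on A k"
    for A :: "'x::topological_space set" and h :: "complex \<Rightarrow> complex" and r k :: "'x \<Rightarrow> real"
    by (rule continuous_on_compose2[OF that(1)]) (auto intro!: continuous_intros that)
  \<comment> \<open>the mean may be differentiated in the radius\<close>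
  have radial: "((\<lambda>r. integral {0..2 * pi} (\<lambda>\<theta>. cnj (e \<theta>) ^ k * h (of_real r * e \<theta>))) has_vector_derivative
      integral {0..2 * pi} (\<lambda>\<theta>. cnj (e \<theta>) ^ k * (a (of_real r * e \<theta>) * e \<theta> + b (of_real r * e \<theta>) * cnj (e \<theta>)))) (at r)"
    if h: "has_wirtinger h a b" "continuous_on UNIV a" "continuous_on UNIV b" for k h a b r
  proof -
    have "((\<lambda>r. integral (cbox 0 (2 * pi)) (\<lambda>\<theta>. cnj (e \<theta>) ^ k * h (of_real r * e \<theta>))) has_vector_derivative
      integral (cbox 0 (2 * pi)) (\<lambda>\<theta>. cnj (e \<theta>) ^ k * (a (of_real r * e \<theta>) * e \<theta> + b (of_real r * e \<theta>) * cnj (e \<theta>)))) (at r within UNIV)"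
    proof (rule leibniz_rule_vector_derivative[where fx="\<lambda>r \<theta>. cnj (e \<theta>) ^ k * (a (of_real r * e \<theta>) * e \<theta> + b (of_real r * e \<theta>) * cnj (e \<theta>))"])
      fix r \<theta>
      have "((\<lambda>r. of_real r * e \<theta>) has_derivative (\<lambda>t. of_real t * e \<theta>)) (at r)"
        by (auto intro!: derivative_eq_intros)
      from has_derivative_mult_right[OF has_derivative_compose[OF this has_wirtingerD[OF h(1)]], of "cnj (e \<theta>) ^ k"]
      show "((\<lambda>r. cnj (e \<theta>) ^ k * h (of_real r * e \<theta>)) has_vector_derivative
          cnj (e \<theta>) ^ k * (a (of_real r * e \<theta>) * e \<theta> + b (of_real r * e \<theta>) * cnj (e \<theta>))) (at r within UNIV)"
        unfolding has_vector_derivative_def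
        by (auto elim!: has_derivative_eq_rhs simp: scaleR_conv_of_real algebra_simps)
    next
      show "(\<lambda>\<theta>. cnj (e \<theta>) ^ k * h (of_real r * e \<theta>)) integrable_on cbox 0 (2 * pi)" for r :: real
        by (intro integrable_continuous continuous_intros circ[OF continuous_on_has_wirtinger[OF h(1)]])
    next
      show "continuous_on (UNIV \<times> cbox 0 (2 * pi)) (\<lambda>(r, \<theta>). cnj (e \<theta>) ^ k * (a (of_real r * e \<theta>) * e \<theta> + b (of_real r * e \<theta>) * cnj (e \<theta>)))"
        unfolding case_prod_beta by (intro continuous_intros circ[OF h(2)] circ[OF h(3)])
    qed auto
    then show ?thesis
      by simp
  qed
  \<comment> \<open>the angular derivative of the periodic function $\overline{e}^k h$ has mean zero\<close>
  have angular: "of_real r * integral {0..2 * pi} (\<lambda>\<theta>. cnj (e \<theta>) ^ k * (a (of_real r * e \<theta>) * e \<theta> - b (of_real r * e \<theta>) * cnj (e \<theta>)))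
      = of_nat k * integral {0..2 * pi} (\<lambda>\<theta>. cnj (e \<theta>) ^ k * h (of_real r * e \<theta>))"
    if h: "has_wirtinger h a b" "continuous_on UNIV a" "continuous_on UNIV b" for k h a b and r :: real
  proof -
    note hc = continuous_on_has_wirtinger[OF h(1)]
    define P where "P = (\<lambda>\<theta>. cnj (e \<theta>) ^ k * (a (of_real r * e \<theta>) * e \<theta> - b (of_real r * e \<theta>) * cnj (e \<theta>)))"
    define Q where "Q = (\<lambda>\<theta>. cnj (e \<theta>) ^ k * h (of_real r * e \<theta>))"
    have int: "P integrable_on {0..2 * pi}" "Q integrable_on {0..2 * pi}"
      unfolding P_def Q_def
      by (intro integrable_continuous_interval continuous_intros circ[OF h(2)] circ[OF h(3)] circ[OF hc])+
    have "((\<lambda>\<theta>. \<i> * (of_real r * P \<theta> - of_nat k * Q \<theta>)) has_integral Q (2 * pi) - Q 0) {0..2 * pi}"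
    proof (rule fundamental_theorem_of_calculus)
      fix \<theta> :: real
      have de: "(e has_derivative (\<lambda>t. of_real t * (\<i> * e \<theta>))) (at \<theta> within {0..2 * pi})"
        using e_deriv[of \<theta>] by (simp add: has_vector_derivative_def scaleR_conv_of_real)
      have 1: "((\<lambda>\<theta>. h (of_real r * e \<theta>)) has_derivative
         (\<lambda>t. a (of_real r * e \<theta>) * (of_real r * (of_real t * (\<i> * e \<theta>))) + b (of_real r * e \<theta>) * cnj (of_real r * (of_real t * (\<i> * e \<theta>)))))
         (at \<theta> within {0..2 * pi})"
        by (rule has_derivative_compose[OF has_derivative_mult_right[OF de] has_wirtingerD[OF h(1)]])
      have 2: "((\<lambda>\<theta>. cnj (e \<theta>) ^ k) has_derivative (\<lambda>t. of_nat k * cnj (of_real t * (\<i> * e \<theta>)) * cnj (e \<theta>) ^ (k - 1)))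
         (at \<theta> within {0..2 * pi})"
        by (rule has_derivative_power[OF has_derivative_cnj[OF de]])
      have 3: "of_nat k * cnj (of_real t * (\<i> * e \<theta>)) * cnj (e \<theta>) ^ (k - 1) = - \<i> * of_real t * of_nat k * cnj (e \<theta>) ^ k" for t
        by (cases k) (simp_all add: algebra_simps)
      note 2 = 2[unfolded 3]
      show "(Q has_vector_derivative \<i> * (of_real r * P \<theta> - of_nat k * Q \<theta>)) (at \<theta> within {0..2 * pi})"
        unfolding Q_def has_vector_derivative_def
        by (rule has_derivative_eq_rhs[OF has_derivative_mult[OF 2 1]])
          (auto simp: P_def scaleR_conv_of_real algebra_simps)
    qed simp
    then have "integral {0..2 * pi} (\<lambda>\<theta>. \<i> * (of_real r * P \<theta> - of_nat k * Q \<theta>)) = Q (2 * pi) - Q 0"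
      by (rule integral_unique)
    moreover have "Q (2 * pi) = Q 0"
      by (simp add: Q_def e_per)
    moreover have "integral {0..2 * pi} (\<lambda>\<theta>. \<i> * (of_real r * P \<theta> - of_nat k * Q \<theta>))
        = \<i> * (of_real r * integral {0..2 * pi} P - of_nat k * integral {0..2 * pi} Q)"
      using int by (simp add: integral_diff integrable_on_mult_right)
    ultimately show ?thesis
      by (simp add: P_def Q_def)
  qed
  define u where "u = (\<lambda>r. integral {0..2 * pi} (\<lambda>\<theta>. f (of_real r * e \<theta>)))"
  define v where "v = (\<lambda>r. integral {0..2 * pi} (\<lambda>\<theta>. cnj (e \<theta>) * g (of_real r * e \<theta>)))"
  define P where "P = (\<lambda>z. of_real \<nu> * cnj z * g z - of_real \<nu> * of_nat n * f z)"
  have cP: "continuous_on UNIV P"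
    unfolding P_def using cfg by (intro continuous_intros)
  note r0 = radial[OF *(1,2) cfg(2), of 0, simplified] and a0 = angular[OF *(1,2) cfg(2), of _ 0, simplified]
  note r1 = radial[OF *(3)[folded P_def] cP *(4), of 1, simplified] and a1 = angular[OF *(3)[folded P_def] cP *(4), of _ 1, simplified]
  have u_deriv: "(u has_vector_derivative 2 * v r) (at r)" if "r > 0" for r
  proof -
    have i1: "(\<lambda>\<theta>. p (of_real r * e \<theta>) * e \<theta>) integrable_on {0..2 * pi}"
      and i2: "(\<lambda>\<theta>. g (of_real r * e \<theta>) * cnj (e \<theta>)) integrable_on {0..2 * pi}"
      by (intro integrable_continuous_interval continuous_intros circ[OF *(2)] circ[OF cfg(2)])+
    have "integral {0..2 * pi} (\<lambda>\<theta>. p (of_real r * e \<theta>) * e \<theta>) = integral {0..2 * pi} (\<lambda>\<theta>. g (of_real r * e \<theta>) * cnj (e \<theta>))"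
      using a0[of r] that i1 i2 by (simp add: integral_diff)
    then have "integral {0..2 * pi} (\<lambda>\<theta>. p (of_real r * e \<theta>) * e \<theta> + g (of_real r * e \<theta>) * cnj (e \<theta>)) = 2 * v r"
      using i1 i2 by (simp add: integral_add v_def mult.commute)
    then show ?thesis
      using r0[of r] by (simp add: u_def)
  qed
  have v_deriv: "(v has_vector_derivative
      2 * of_real (\<nu> * r) * v r - 2 * of_real \<nu> * of_nat n * u r - v r / of_real r) (at r)" if "r > 0" for r
  proof -
    define A where "A = integral {0..2 * pi} (\<lambda>\<theta>. P (of_real r * e \<theta>))"
    define B where "B = integral {0..2 * pi} (\<lambda>\<theta>. cnj (e \<theta>) * (q (of_real r * e \<theta>) * cnj (e \<theta>)))"
    have i: "(\<lambda>\<theta>. P (of_real r * e \<theta>)) integrable_on {0..2 * pi}"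
      "(\<lambda>\<theta>. cnj (e \<theta>) * (q (of_real r * e \<theta>) * cnj (e \<theta>))) integrable_on {0..2 * pi}"
      "(\<lambda>\<theta>. cnj (e \<theta>) * g (of_real r * e \<theta>)) integrable_on {0..2 * pi}"
      "(\<lambda>\<theta>. f (of_real r * e \<theta>)) integrable_on {0..2 * pi}"
      by (intro integrable_continuous_interval continuous_intros circ[OF *(4)] circ[OF cP] circ[OF cfg(1)] circ[OF cfg(2)])+
    have can: "cnj (e \<theta>) * (x * e \<theta> + y) = x + cnj (e \<theta>) * y" "cnj (e \<theta>) * (x * e \<theta> - y) = x - cnj (e \<theta>) * y" for \<theta> x y
      using e_cnj[of \<theta>] by (simp_all add: algebra_simps)
    have "of_real r * (A - B) = v r"
      using a1[of r] i unfolding can by (simp only: integral_diff A_def B_def v_def)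
    then have B: "B = A - v r / of_real r"
      using that by (simp add: field_simps)
    have A: "A = of_real (\<nu> * r) * v r - of_real \<nu> * of_nat n * u r"
    proof -
      have "P (of_real r * e \<theta>) = of_real (\<nu> * r) * (cnj (e \<theta>) * g (of_real r * e \<theta>)) - of_real \<nu> * of_nat n * f (of_real r * e \<theta>)" for \<theta>
        by (simp add: P_def)
      then have "A = integral {0..2 * pi} (\<lambda>\<theta>. of_real (\<nu> * r) * (cnj (e \<theta>) * g (of_real r * e \<theta>)) - of_real \<nu> * of_nat n * f (of_real r * e \<theta>))"
        unfolding A_def by presburger
      also have "\<dots> = of_real (\<nu> * r) * v r - of_real \<nu> * of_nat n * u r"
        unfolding u_def v_def using i(3,4)
        by (subst integral_diff) (auto intro!: integrable_on_mult_right)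
      finally show ?thesis .
    qed
    have "(v has_vector_derivative A + B) (at r)"
      using r1[of r] i unfolding can by (simp only: integral_add A_def B_def v_def)
    then show ?thesis
      unfolding B A by (simp add: algebra_simps)
  qed
  have "u R = 0"
  proof (rule radial_system_unique[where v=v and \<nu>=\<nu> and n=n])
    show "continuous_on {0..} u"
      using r0 unfolding u_def
      by (intro continuous_at_imp_continuous_on) (blast intro: has_vector_derivative_continuous)
    show "continuous_on {0..} v"
      using r1 unfolding v_def
      by (intro continuous_at_imp_continuous_on) (blast intro: has_vector_derivative_continuous)
    show "u 0 = 0"
      by (simp add: u_def assms(3))
    have "((\<lambda>\<theta>. cnj (e \<theta>)) has_integral \<i> * cnj (e (2 * pi)) - \<i> * cnj (e 0)) {0..2 * pi}"
    proof (rule fundamental_theorem_of_calculus)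
      show "((\<lambda>\<theta>. \<i> * cnj (e \<theta>)) has_vector_derivative cnj (e \<theta>)) (at \<theta> within {0..2 * pi})" for \<theta>
        using has_vector_derivative_mult_right[OF has_vector_derivative_cnj[OF e_deriv], of \<i> \<theta> "{0..2 * pi}"] by simp
    qed simp
    then have "integral {0..2 * pi} (\<lambda>\<theta>. cnj (e \<theta>)) = 0"
      by (simp add: integral_unique e_per)
    then show "v 0 = 0"
      by (simp add: v_def)
  qed (use u_deriv v_deriv assms in auto)
  then show ?thesis
    by (simp add: u_def e_def)
qed

lemma hermite_diag_rotate: "norm c = 1 \<Longrightarrow> hermite \<nu> n n (c * w) = hermite \<nu> n n w"
  using complex_norm_square[of c] by (simp add: hermite_rotate power_mult_distrib[symmetric])

lemma gaussian_rotate: "norm c = 1 \<Longrightarrow> gaussian \<nu> (c * w) = gaussian \<nu> w"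
  by (simp add: gaussian_eq norm_mult)

lemma continuous_on_gaussian: "continuous_on UNIV (gaussian \<nu>)"
  using continuous_on_has_wirtinger[OF has_wirtinger_gaussian] .

text \<open>
  Gaussian weight and $H_{n,n}$ are radial, so by rotation invariance $f$ may be replaced by its circular mean.
\<close>

lemma integral_radial_eigen_zero:
  assumes "\<nu> \<ge> 0" "eigen_pair \<nu> n f g" "f 0 = 0"
    and int: "integrable lborel (\<lambda>w. gaussian \<nu> w * hermite \<nu> n n w * f w)"
  shows "(\<integral>w. gaussian \<nu> w * hermite \<nu> n n w * f w \<partial>lborel) = 0"
proof -
  define F where "F = (\<lambda>w. gaussian \<nu> w * hermite \<nu> n n w * f w)"
  have F_cont: "continuous_on UNIV F"
    unfolding F_def
    by (intro continuous_intros continuous_on_gaussian continuous_on_hermite eigen_pair_continuous[OF assms(2)])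
  then have [measurable]: "F \<in> borel_measurable borel"
    by (rule borel_measurable_continuous_onI)
  define G where "G = (\<lambda>w \<theta>. indicator {0..2 * pi} \<theta> *\<^sub>R F (cis \<theta> * w))"
  have [measurable]: "cis \<in> borel_measurable borel"
    by (intro borel_measurable_continuous_onI continuous_intros)
  have [measurable]: "case_prod G \<in> borel_measurable (lborel \<Otimes>\<^sub>M lborel)"
    unfolding G_def by measurable
  have intG: "integrable (lborel \<Otimes>\<^sub>M lborel) (case_prod G)"
  proof (rule integrableI_bounded)
    have "(\<integral>\<^sup>+w. ennreal (norm (G w \<theta>)) \<partial>lborel)
        = indicator {0..2 * pi} \<theta> * (\<integral>\<^sup>+w. ennreal (norm (F w)) \<partial>lborel)" for \<theta>
    proof -
      have "(\<integral>\<^sup>+w. ennreal (norm (G w \<theta>)) \<partial>lborel)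
          = indicator {0..2 * pi} \<theta> * (\<integral>\<^sup>+w. ennreal (norm (F (cis \<theta> * w))) \<partial>lborel)"
        by (subst nn_integral_cmult[symmetric]) (auto simp: G_def indicator_def intro!: nn_integral_cong)
      then show ?thesis
        by (subst (asm) nn_integral_lborel_rotation[where f="\<lambda>w. ennreal (norm (F w))"]) auto
    qed
    moreover have "(\<integral>\<^sup>+w. ennreal (norm (F w)) \<partial>lborel) < \<infinity>"
      using int by (simp add: integrable_iff_bounded F_def)
    ultimately have "(\<integral>\<^sup>+\<theta>. \<integral>\<^sup>+w. ennreal (norm (G w \<theta>)) \<partial>lborel \<partial>lborel) < \<infinity>"
      by (simp add: nn_integral_multc ennreal_mult_less_top)
    then show "(\<integral>\<^sup>+p. ennreal (norm (case_prod G p)) \<partial>(lborel \<Otimes>\<^sub>M lborel)) < \<infinity>"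
      by (subst lborel_pair.nn_integral_snd[symmetric]) auto
  qed measurable
  have zero: "(\<integral>\<theta>. G w \<theta> \<partial>lborel) = 0" for w
  proof -
    have c: "continuous_on {0..2 * pi} (\<lambda>\<theta>. F (cis \<theta> * w))"
      by (rule continuous_on_compose2[OF F_cont]) (auto intro!: continuous_intros)
    have "(\<integral>\<theta>. G w \<theta> \<partial>lborel) = integral {0..2 * pi} (\<lambda>\<theta>. F (cis \<theta> * w))"
      using set_borel_integral_eq_integral(2)[OF borel_integrable_atLeastAtMost'[OF c]]
      by (simp add: G_def set_lebesgue_integral_def)
    also have "\<dots> = integral {0..2 * pi} (\<lambda>\<theta>. (gaussian \<nu> w * hermite \<nu> n n w) * f (of_real (cmod w) * cis (Arg w + \<theta>)))"
    proof -
      have w: "cis \<theta> * w = of_real (cmod w) * cis (Arg w + \<theta>)" for \<theta>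
      proof -
        have "w = of_real (cmod w) * cis (Arg w)"
          using rcis_cmod_Arg[of w] by (simp add: rcis_def)
        then have "cis \<theta> * w = cis \<theta> * (of_real (cmod w) * cis (Arg w))"
          by simp
        then show ?thesis
          by (simp add: cis_mult[symmetric] mult_ac)
      qed
      have "F (cis \<theta> * w) = (gaussian \<nu> w * hermite \<nu> n n w) * f (of_real (cmod w) * cis (Arg w + \<theta>))" for \<theta>
        unfolding w[symmetric] F_def by (simp add: hermite_diag_rotate gaussian_rotate)
      then show ?thesis
        by simp
    qed
    also have "\<dots> = 0"
      using circle_average_eigen_zero[OF assms(1-3), of "cmod w" "Arg w"] by simp
    finally show ?thesis .
  qed
  have "(\<integral>\<theta>. \<integral>w. G w \<theta> \<partial>lborel \<partial>lborel) = (\<integral>w. \<integral>\<theta>. G w \<theta> \<partial>lborel \<partial>lborel)"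
    by (rule lborel_pair.Fubini_integral[OF intG])
  also have "\<dots> = 0"
    by (simp add: zero)
  finally have "(\<integral>\<theta>. \<integral>w. G w \<theta> \<partial>lborel \<partial>lborel) = 0" .
  moreover have "(\<integral>w. G w \<theta> \<partial>lborel) = indicator {0..2 * pi} \<theta> *\<^sub>R (\<integral>w. F w \<partial>lborel)" for \<theta>
    unfolding G_def by (simp add: integral_lborel_rotation)
  ultimately show ?thesis
    by (simp add: F_def)
qed

section \<open>Gaussian growth and integration by parts\<close>

text \<open>
  Growth or decay of order $e^{b|w|^2}$ up to an arbitrarily small loss in the exponent. The loss absorbs
  polynomials, exponentials of linear functions, translations and derivatives of holomorphic functions, so all
  integrability questions reduce to adding exponents.
\<close>

definition subgaussian :: "real \<Rightarrow> (complex \<Rightarrow> complex) set" where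
  "subgaussian b = {u. continuous_on UNIV u \<and>
     (\<forall>a>b. \<exists>C. \<forall>w. norm (u w) \<le> C * exp (a * (cmod w)\<^sup>2))}"

lemma subgaussianD:
  assumes "u \<in> subgaussian b" "b < a"
  obtains C where "C \<ge> 0" "\<And>w. norm (u w) \<le> C * exp (a * (cmod w)\<^sup>2)"
proof -
  obtain C where C: "\<And>w. norm (u w) \<le> C * exp (a * (cmod w)\<^sup>2)"
    using assms unfolding subgaussian_def by blast
  have "0 \<le> C"
    using order_trans[OF norm_ge_zero C[of 0]] by simp
  then show ?thesis
    using C that by blast
qed

lemma subgaussian_continuous: "u \<in> subgaussian b \<Longrightarrow> continuous_on UNIV u"
  by (simp add: subgaussian_def)

lemma subgaussian_mono: "u \<in> subgaussian b \<Longrightarrow> b \<le> c \<Longrightarrow> u \<in> subgaussian c"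
  by (auto simp: subgaussian_def)

lemma subgaussian_mult:
  assumes "u \<in> subgaussian a" "v \<in> subgaussian b"
  shows "(\<lambda>w. u w * v w) \<in> subgaussian (a + b)"
  unfolding subgaussian_def
proof (intro CollectI conjI allI impI)
  show "continuous_on UNIV (\<lambda>w. u w * v w)"
    using assms by (intro continuous_intros subgaussian_continuous)
  fix c assume c: "a + b < c"
  define \<delta> where "\<delta> = (c - a - b) / 2"
  have "a < a + \<delta>" "b < b + \<delta>"
    using c by (auto simp: \<delta>_def)
  then obtain C D where C: "C \<ge> 0" "\<And>w. norm (u w) \<le> C * exp ((a + \<delta>) * (cmod w)\<^sup>2)"
    and D: "D \<ge> 0" "\<And>w. norm (v w) \<le> D * exp ((b + \<delta>) * (cmod w)\<^sup>2)"
    using subgaussianD assms by metis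
  have "norm (u w * v w) \<le> C * D * exp (c * (cmod w)\<^sup>2)" for w
  proof -
    have "norm (u w * v w) \<le> (C * exp ((a + \<delta>) * (cmod w)\<^sup>2)) * (D * exp ((b + \<delta>) * (cmod w)\<^sup>2))"
      unfolding norm_mult using C D by (intro mult_mono) auto
    also have "\<dots> = C * D * exp ((a + \<delta>) * (cmod w)\<^sup>2 + (b + \<delta>) * (cmod w)\<^sup>2)"
      by (simp add: exp_add)
    also have "(a + \<delta>) * (cmod w)\<^sup>2 + (b + \<delta>) * (cmod w)\<^sup>2 = c * (cmod w)\<^sup>2"
      by (simp add: \<delta>_def field_simps)
    finally show ?thesis .
  qed
  then show "\<exists>C. \<forall>w. norm (u w * v w) \<le> C * exp (c * (cmod w)\<^sup>2)"
    by blast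
qed

lemma subgaussian_mult_0:
  "u \<in> subgaussian 0 \<Longrightarrow> v \<in> subgaussian b \<Longrightarrow> (\<lambda>w. u w * v w) \<in> subgaussian b"
  using subgaussian_mult[of u 0 v b] by simp

lemma subgaussian_diff:
  assumes "u \<in> subgaussian b" "v \<in> subgaussian b"
  shows "(\<lambda>w. u w - v w) \<in> subgaussian b"
  unfolding subgaussian_def
proof (intro CollectI conjI allI impI)
  show "continuous_on UNIV (\<lambda>w. u w - v w)"
    using assms by (intro continuous_intros subgaussian_continuous)
  fix a assume "b < a"
  then obtain C D where C: "\<And>w. norm (u w) \<le> C * exp (a * (cmod w)\<^sup>2)"
    and D: "\<And>w. norm (v w) \<le> D * exp (a * (cmod w)\<^sup>2)"
    using subgaussianD assms by metis
  have "norm (u w - v w) \<le> (C + D) * exp (a * (cmod w)\<^sup>2)" for w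
    using norm_triangle_ineq4[of "u w" "v w"] C[of w] D[of w] by (simp add: distrib_right)
  then show "\<exists>C. \<forall>w. norm (u w - v w) \<le> C * exp (a * (cmod w)\<^sup>2)"
    by blast
qed

lemma subgaussian_const: "(\<lambda>_. c) \<in> subgaussian 0"
proof -
  have "norm c \<le> norm c * exp (a * (cmod w)\<^sup>2)" if "a > 0" for a :: real and w :: complex
    using mult_left_mono[of 1 "exp (a * (cmod w)\<^sup>2)" "norm c"] that by simp
  then show ?thesis
    unfolding subgaussian_def by auto
qed

lemma subgaussian_cmult: "u \<in> subgaussian b \<Longrightarrow> (\<lambda>w. c * u w) \<in> subgaussian b"
  using subgaussian_mult_0[OF subgaussian_const] .

lemma subgaussian_add:
  assumes "u \<in> subgaussian b" "v \<in> subgaussian b"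
  shows "(\<lambda>w. u w + v w) \<in> subgaussian b"
  using subgaussian_diff[OF assms(1) subgaussian_cmult[OF assms(2), of "-1"]] by simp

lemma subgaussian_exp: "(\<lambda>w. exp (c * w)) \<in> subgaussian 0"
  unfolding subgaussian_def
proof (intro CollectI conjI allI impI)
  fix a :: real assume a: "0 < a"
  have "norm (exp (c * w)) \<le> exp ((cmod c)\<^sup>2 / (4 * a)) * exp (a * (cmod w)\<^sup>2)" for w
  proof -
    have "0 \<le> (2 * a * cmod w - cmod c)\<^sup>2 / (4 * a)"
      using a by simp
    also have "\<dots> = a * (cmod w)\<^sup>2 - cmod c * cmod w + (cmod c)\<^sup>2 / (4 * a)"
      using a by (simp add: field_simps power2_eq_square)
    finally have "cmod c * cmod w \<le> (cmod c)\<^sup>2 / (4 * a) + a * (cmod w)\<^sup>2"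
      by simp
    moreover have "Re (c * w) \<le> cmod c * cmod w"
      using complex_Re_le_cmod[of "c * w"] by (simp only: norm_mult)
    ultimately show ?thesis
      unfolding norm_exp_eq_Re exp_add[symmetric] by simp
  qed
  then show "\<exists>C. \<forall>w. norm (exp (c * w)) \<le> C * exp (a * (cmod w)\<^sup>2)"
    by blast
qed (intro continuous_intros)

lemma subgaussian_id: "(\<lambda>w. w) \<in> subgaussian 0"
  unfolding subgaussian_def
proof (intro CollectI conjI allI impI)
  fix a :: real assume a: "0 < a"
  have "norm w \<le> (1 + 1 / a) * exp (a * (cmod w)\<^sup>2)" for w :: complex
  proof -
    have "1 + a * (cmod w)\<^sup>2 \<le> exp (a * (cmod w)\<^sup>2)"
      by (rule exp_ge_add_one_self)
    moreover have "0 \<le> a * (cmod w)\<^sup>2"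
      using a by simp
    ultimately have "1 \<le> exp (a * (cmod w)\<^sup>2)" "a * (cmod w)\<^sup>2 \<le> exp (a * (cmod w)\<^sup>2)"
      by linarith+
    then have "1 \<le> exp (a * (cmod w)\<^sup>2)" "(cmod w)\<^sup>2 \<le> 1 / a * exp (a * (cmod w)\<^sup>2)"
      using a by (auto simp: field_simps)
    moreover have "cmod w \<le> 1 + (cmod w)\<^sup>2"
      using zero_le_power2[of "cmod w - 1"] zero_le_power2[of "cmod w"] norm_ge_zero[of w] unfolding power2_diff by (smt (verit) one_power2)
    ultimately show ?thesis
      unfolding distrib_right by linarith
  qed
  then show "\<exists>C. \<forall>w. norm w \<le> C * exp (a * (cmod w)\<^sup>2)"
    by blast
qed (intro continuous_intros)

lemma subgaussian_cnj: "cnj \<in> subgaussian 0"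
  using subgaussian_id by (auto simp: subgaussian_def intro!: continuous_intros)

lemma subgaussian_gaussian: "gaussian \<nu> \<in> subgaussian (- \<nu>)"
  unfolding subgaussian_def
proof (intro CollectI conjI allI impI)
  fix a assume "- \<nu> < a"
  then have "norm (gaussian \<nu> w) \<le> 1 * exp (a * (cmod w)\<^sup>2)" for w
    using mult_right_mono[of "- \<nu>" a "(cmod w)\<^sup>2"] by (simp add: gaussian_eq norm_of_real)
  then show "\<exists>C. \<forall>w. norm (gaussian \<nu> w) \<le> C * exp (a * (cmod w)\<^sup>2)"
    by blast
qed (rule continuous_on_gaussian)

text \<open>
  The difference of the two sides is a square divided by $a - a'$.
\<close>

lemma quadratic_shift_bound:
  fixes a a' x s :: real
  assumes "a' < a"
  shows "a' * (x + s)\<^sup>2 \<le> a * x\<^sup>2 + a' * a / (a - a') * s\<^sup>2"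
proof -
  have "0 \<le> ((a - a') * x - a' * s)\<^sup>2 / (a - a')"
    using assms by simp
  also have "\<dots> = a * x\<^sup>2 + a' * a / (a - a') * s\<^sup>2 - a' * (x + s)\<^sup>2"
    using assms by (simp add: field_simps power2_eq_square)
  finally show ?thesis
    by simp
qed

lemma subgaussian_translate_bound:
  assumes "u \<in> subgaussian b" "b \<ge> 0" "b < a"
  obtains C where "\<And>z w. cmod z \<le> R \<Longrightarrow> norm (u (z + w)) \<le> C * exp (a * (cmod w)\<^sup>2)"
proof -
  define a' where "a' = (a + b) / 2"
  have a': "b < a'" "a' < a" "0 < a'"
    using assms by (auto simp: a'_def)
  obtain C where C: "C \<ge> 0" "\<And>w. norm (u w) \<le> C * exp (a' * (cmod w)\<^sup>2)"
    using subgaussianD[OF assms(1) a'(1)] by blast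
  have "norm (u (z + w)) \<le> C * exp (a' * a / (a - a') * R\<^sup>2) * exp (a * (cmod w)\<^sup>2)" if "cmod z \<le> R" for z w
  proof -
    have "(cmod (z + w))\<^sup>2 \<le> (cmod w + R)\<^sup>2"
      using norm_triangle_ineq[of z w] that by (intro power_mono) auto
    then have "a' * (cmod (z + w))\<^sup>2 \<le> a' * (cmod w + R)\<^sup>2"
      using a' by (intro mult_left_mono) auto
    also have "\<dots> \<le> a' * a / (a - a') * R\<^sup>2 + a * (cmod w)\<^sup>2"
      using quadratic_shift_bound[OF a'(2), of "cmod w" R] by simp
    finally have "C * exp (a' * (cmod (z + w))\<^sup>2) \<le> C * exp (a' * a / (a - a') * R\<^sup>2 + a * (cmod w)\<^sup>2)"
      using C(1) by (intro mult_left_mono) auto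
    then show ?thesis
      using C(2)[of "z + w"] by (simp add: exp_add mult.assoc)
  qed
  then show ?thesis
    using that by blast
qed

lemma subgaussian_translate:
  assumes "u \<in> subgaussian b" "b \<ge> 0"
  shows "(\<lambda>w. u (z + w)) \<in> subgaussian b"
  unfolding subgaussian_def
proof (intro CollectI conjI allI impI)
  show "continuous_on UNIV (\<lambda>w. u (z + w))"
    by (rule continuous_on_compose2[OF subgaussian_continuous[OF assms(1)]]) (auto intro!: continuous_intros)
  fix a assume "b < a"
  then show "\<exists>C. \<forall>w. norm (u (z + w)) \<le> C * exp (a * (cmod w)\<^sup>2)"
    using subgaussian_translate_bound[OF assms, of a "cmod z"] by (metis order_refl)
qed

text \<open>
  Cauchy's inequality on circles of radius $1$.
\<close>

lemma subgaussian_deriv: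
  assumes "h \<in> subgaussian b" "b \<ge> 0" "h holomorphic_on UNIV"
  shows "deriv h \<in> subgaussian b"
  unfolding subgaussian_def
proof (intro CollectI conjI allI impI)
  show "continuous_on UNIV (deriv h)"
    using assms(3) by (simp add: holomorphic_deriv holomorphic_on_imp_continuous_on)
  fix a assume "b < a"
  then obtain C where C: "\<And>z w. cmod z \<le> 1 \<Longrightarrow> norm (h (z + w)) \<le> C * exp (a * (cmod w)\<^sup>2)"
    using subgaussian_translate_bound[OF assms(1,2), of a 1] by blast
  have "norm (deriv h w) \<le> C * exp (a * (cmod w)\<^sup>2)" for w
  proof -
    have "norm ((deriv ^^ 1) h w) \<le> fact 1 * (C * exp (a * (cmod w)\<^sup>2)) / 1 ^ 1"
    proof (rule Cauchy_inequality)
      show "h holomorphic_on ball w 1" "continuous_on (cball w 1) h"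
        using assms(3) holomorphic_on_subset holomorphic_on_imp_continuous_on by blast+
      show "norm (h x) \<le> C * exp (a * (cmod w)\<^sup>2)" if "norm (w - x) = 1" for x
        using C[of "x - w" w] that by (simp add: norm_minus_commute)
    qed simp
    then show ?thesis
      by simp
  qed
  then show "\<exists>C. \<forall>w. norm (deriv h w) \<le> C * exp (a * (cmod w)\<^sup>2)"
    by blast
qed

lemma subgaussian_creation:
  assumes "h \<in> subgaussian b" "b \<ge> 0" "h holomorphic_on UNIV"
  shows "creation \<nu> n h \<in> subgaussian b"
  using assms
proof (induction n arbitrary: h)
  case (Suc n)
  have "creation \<nu> n (deriv h) \<in> subgaussian b"
    using Suc.prems by (intro Suc.IH subgaussian_deriv holomorphic_deriv) auto
  then show ?case
    unfolding creation.simps using Suc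
    by (intro subgaussian_diff subgaussian_mult_0[OF subgaussian_cmult[OF subgaussian_cnj]])
qed simp

lemma subgaussian_scaled_power: "(\<lambda>z. (of_real \<nu> * z) ^ m) \<in> subgaussian 0"
proof (induction m)
  case (Suc m)
  then show ?case
    using subgaussian_mult_0[OF subgaussian_cmult[OF subgaussian_id]] by simp
qed (simp add: subgaussian_const)

lemma subgaussian_hermite: "hermite \<nu> m n \<in> subgaussian 0"
  unfolding hermite_eq_creation by (intro subgaussian_creation subgaussian_scaled_power holomorphic_scaled_power) auto

lemma subgaussian_integrable:
  assumes "u \<in> subgaussian b" "b < 0"
  shows "integrable lborel u"
proof -
  obtain C where C: "\<And>w. norm (u w) \<le> C * exp (b / 2 * (cmod w)\<^sup>2)"
    using subgaussianD[OF assms(1), of "b / 2"] assms(2) by auto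
  have "integrable lborel (\<lambda>w::complex. C * exp (b / 2 * (cmod w)\<^sup>2))"
    using gaussian_complex[of "- (b / 2)"] assms(2) by (intro integrable_mult_right) (auto dest: has_bochner_integral_iff[THEN iffD1])
  then show ?thesis
  proof (rule Bochner_Integration.integrable_bound)
    show "u \<in> borel_measurable lborel"
      using borel_measurable_continuous_onI[OF subgaussian_continuous[OF assms(1)]] by simp
    show "AE w in lborel. norm (u w) \<le> norm (C * exp (b / 2 * (cmod w)\<^sup>2))"
      by (intro always_eventually allI order_trans[OF C]) auto
  qed
qed

text \<open>
  $\partial$ is a combination of the derivatives in the directions $1$ and $i$, and each of these has integral
  zero.
\<close>

lemma integral_wirtinger_zero:
  assumes "has_wirtinger F p q" "F \<in> subgaussian b" "p \<in> subgaussian b" "q \<in> subgaussian b" "b < 0"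
  shows "(\<integral>w. p w \<partial>lborel) = 0"
proof -
  note i = subgaussian_integrable[OF _ assms(5)] and c = subgaussian_continuous[OF assms(3)] subgaussian_continuous[OF assms(4)]
  have "(\<integral>w. p w + q w \<partial>lborel) = 0"
    by (rule integral_directional_derivative_zero[OF has_wirtingerD[OF assms(1)], of 1])
      (use assms i c in \<open>auto intro!: continuous_intros simp: algebra_simps\<close>)
  moreover have "(\<integral>w. \<i> * p w - \<i> * q w \<partial>lborel) = 0"
    by (rule integral_directional_derivative_zero[OF has_wirtingerD[OF assms(1)], of \<i>])
      (use assms i c in \<open>auto intro!: continuous_intros simp: algebra_simps\<close>)
  ultimately show ?thesis
    using i[OF assms(3)] i[OF assms(4)] by simp
qed

text \<open>
  The identity $e^{-\nu|w|^2}A^*u = -\partial(e^{-\nu|w|^2}u)$ makes $\partial$ the transpose of $A^*$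
  for the Gaussian weight.
\<close>

lemma integral_creation_adjoint:
  assumes u: "has_wirtinger u p q" and v: "has_wirtinger v r s"
    and su: "u \<in> subgaussian a" "p \<in> subgaussian a" "q \<in> subgaussian a"
    and sv: "v \<in> subgaussian b" "r \<in> subgaussian b" "s \<in> subgaussian b"
    and "a + b < \<nu>"
  shows "(\<integral>w. gaussian \<nu> w * v w * (of_real \<nu> * cnj w * u w - p w) \<partial>lborel)
    = (\<integral>w. gaussian \<nu> w * r w * u w \<partial>lborel)"
proof -
  define d where "d = - \<nu> + (a + b)"
  have d: "d < 0"
    using assms by (simp add: d_def)
  note m = subgaussian_mult
  note gm = subgaussian_mult[OF subgaussian_gaussian, of _ "a + b" \<nu>, folded d_def]
  have W: "has_wirtinger (\<lambda>w. gaussian \<nu> w * (u w * v w))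
     (\<lambda>w. - of_real \<nu> * cnj w * gaussian \<nu> w * (u w * v w) + gaussian \<nu> w * (p w * v w + u w * r w))
     (\<lambda>w. - of_real \<nu> * w * gaussian \<nu> w * (u w * v w) + gaussian \<nu> w * (q w * v w + u w * s w))"
    by (rule has_wirtinger_mult[OF has_wirtinger_gaussian has_wirtinger_mult[OF u v]])
  have s1: "(\<lambda>w. - of_real \<nu> * cnj w * gaussian \<nu> w * (u w * v w)) \<in> subgaussian d"
    using subgaussian_mult_0[OF subgaussian_cmult[OF subgaussian_cnj, of "- of_real \<nu>"] gm[OF m[OF su(1) sv(1)]]]
    by (simp add: mult.assoc)
  have s2: "(\<lambda>w. - of_real \<nu> * w * gaussian \<nu> w * (u w * v w)) \<in> subgaussian d"
    using subgaussian_mult_0[OF subgaussian_cmult[OF subgaussian_id, of "- of_real \<nu>"] gm[OF m[OF su(1) sv(1)]]]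
    by (simp add: mult.assoc)
  have "(\<integral>w. - of_real \<nu> * cnj w * gaussian \<nu> w * (u w * v w) + gaussian \<nu> w * (p w * v w + u w * r w) \<partial>lborel) = 0"
    by (rule integral_wirtinger_zero[OF W _ _ _ d]) (intro gm m su sv subgaussian_add s1 s2)+
  also have "(\<lambda>w. - of_real \<nu> * cnj w * gaussian \<nu> w * (u w * v w) + gaussian \<nu> w * (p w * v w + u w * r w))
     = (\<lambda>w. gaussian \<nu> w * r w * u w - gaussian \<nu> w * v w * (of_real \<nu> * cnj w * u w - p w))"
    by (simp add: fun_eq_iff algebra_simps)
  also have "(\<integral>w. gaussian \<nu> w * r w * u w - gaussian \<nu> w * v w * (of_real \<nu> * cnj w * u w - p w) \<partial>lborel)
     = (\<integral>w. gaussian \<nu> w * r w * u w \<partial>lborel) - (\<integral>w. gaussian \<nu> w * v w * (of_real \<nu> * cnj w * u w - p w) \<partial>lborel)"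
  proof (rule Bochner_Integration.integral_diff)
    show "integrable lborel (\<lambda>w. gaussian \<nu> w * r w * u w)"
      using subgaussian_integrable[OF gm[OF m[OF su(1) sv(2)]] d] by (simp add: mult_ac)
    have "(\<lambda>w. of_real \<nu> * cnj w * u w - p w) \<in> subgaussian a"
      by (intro subgaussian_diff subgaussian_mult_0[OF subgaussian_cmult[OF subgaussian_cnj]] su)
    from subgaussian_integrable[OF gm[OF m[OF this sv(1)]] d]
    show "integrable lborel (\<lambda>w. gaussian \<nu> w * v w * (of_real \<nu> * cnj w * u w - p w))"
      by (simp add: mult_ac)
  qed
  finally show ?thesis
    by simp
qed

text \<open>
  Each integration by parts trades one creation operator for $\partial H_{j,k} = \nu j H_{j-1,k}$.
\<close>

lemma integral_hermite_creation_lower: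
  assumes "h holomorphic_on UNIV" "h \<in> subgaussian b" "0 \<le> b" "b < \<nu>"
  shows "(\<integral>w. gaussian \<nu> w * hermite \<nu> j k w * creation \<nu> j h w \<partial>lborel)
    = of_real \<nu> ^ j * fact j * (\<integral>w. gaussian \<nu> w * (of_real \<nu> * cnj w) ^ k * h w \<partial>lborel)"
proof (induction j)
  case 0
  then show ?case
    by (simp add: hermite_0_left)
next
  case (Suc j)
  have "(\<integral>w. gaussian \<nu> w * hermite \<nu> (Suc j) k w * creation \<nu> (Suc j) h w \<partial>lborel)
      = (\<integral>w. gaussian \<nu> w * (of_real \<nu> * of_nat (Suc j) * hermite \<nu> (Suc j - 1) k w) * creation \<nu> j h w \<partial>lborel)"
    unfolding creation.simps
    by (rule integral_creation_adjoint[OF has_wirtinger_creation[OF assms(1)] has_wirtinger_hermite, where a=b and b=0])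
      (use assms in \<open>auto intro!: subgaussian_creation subgaussian_cmult subgaussian_hermite subgaussian_deriv holomorphic_deriv\<close>)
  also have "\<dots> = (of_real \<nu> * of_nat (Suc j)) * (\<integral>w. gaussian \<nu> w * hermite \<nu> j k w * creation \<nu> j h w \<partial>lborel)"
    by (subst integral_mult_right_zero[symmetric]) (simp add: mult_ac)
  also have "\<dots> = of_real \<nu> ^ Suc j * fact (Suc j) * (\<integral>w. gaussian \<nu> w * (of_real \<nu> * cnj w) ^ k * h w \<partial>lborel)"
    unfolding Suc by (simp add: algebra_simps)
  finally show ?case .
qed

text \<open>
  The factor $(\nu\overline{w})^k$ is $(A^*)^k 1$, so each integration by parts exchanges one power for a
  derivative of the holomorphic factor.
\<close>

lemma integral_cnj_power:
  assumes "h holomorphic_on UNIV" "h \<in> subgaussian b" "0 \<le> b" "b < \<nu>"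
  shows "(\<integral>w. gaussian \<nu> w * (of_real \<nu> * cnj w) ^ k * h w \<partial>lborel)
    = (\<integral>w. gaussian \<nu> w * (deriv ^^ k) h w \<partial>lborel)"
  using assms(1,2)
proof (induction k arbitrary: h)
  case (Suc k)
  have h': "deriv h holomorphic_on UNIV" "deriv h \<in> subgaussian b"
    using Suc.prems assms(3) by (auto intro: holomorphic_deriv subgaussian_deriv)
  have "(\<integral>w. gaussian \<nu> w * h w * (of_real \<nu> * cnj w * hermite \<nu> 0 k w - of_real \<nu> * of_nat 0 * hermite \<nu> (0 - 1) k w) \<partial>lborel)
      = (\<integral>w. gaussian \<nu> w * deriv h w * hermite \<nu> 0 k w \<partial>lborel)"
    by (rule integral_creation_adjoint[OF has_wirtinger_hermite has_wirtinger_holomorphic[OF Suc.prems(1)], where a=0 and b=b])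
      (use assms Suc.prems h' in \<open>auto intro!: subgaussian_hermite subgaussian_cmult
        subgaussian_mono[OF subgaussian_const] simp del: of_nat_0\<close>)
  then have "(\<integral>w. gaussian \<nu> w * (of_real \<nu> * cnj w) ^ Suc k * h w \<partial>lborel)
      = (\<integral>w. gaussian \<nu> w * (of_real \<nu> * cnj w) ^ k * deriv h w \<partial>lborel)"
    by (simp add: hermite_0_left mult_ac)
  also have "\<dots> = (\<integral>w. gaussian \<nu> w * (deriv ^^ Suc k) h w \<partial>lborel)"
    unfolding Suc.IH[OF h'] by (simp add: funpow_Suc_right del: funpow.simps)
  finally show ?case .
qed simp

lemma integral_gaussian: "\<nu> > 0 \<Longrightarrow> (\<integral>w. gaussian \<nu> w \<partial>lborel) = of_real (pi / \<nu>)"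
  using has_bochner_integral_integral_eq[OF gaussian_complex[of \<nu>]]
  unfolding gaussian_eq[abs_def] by (simp only: integral_complex_of_real)

text \<open>
  For $n = 0$ the radial comparison function is constant, and the vanishing of radial integrals is the usual
  mean value property of $h - h(0)$.
\<close>

lemma integral_gaussian_holomorphic:
  assumes "h holomorphic_on UNIV" "h \<in> subgaussian b" "b < \<nu>" "\<nu> > 0"
  shows "(\<integral>w. gaussian \<nu> w * h w \<partial>lborel) = of_real (pi / \<nu>) * h 0"
proof -
  define b' where "b' = max b 0"
  define f where "f = (\<lambda>w. h w - h 0)"
  have b': "b' < \<nu>" "h \<in> subgaussian b'" "(\<lambda>_. h 0) \<in> subgaussian b'"
    using assms subgaussian_mono[OF assms(2)] subgaussian_mono[OF subgaussian_const] by (auto simp: b'_def)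
  have int: "integrable lborel (\<lambda>w. gaussian \<nu> w * u w)" if "u \<in> subgaussian b'" for u
    using subgaussian_integrable[OF subgaussian_mult[OF subgaussian_gaussian that]] b'(1) by simp
  have "f holomorphic_on UNIV"
    unfolding f_def using assms(1) by (intro holomorphic_intros)
  then have "(\<integral>w. gaussian \<nu> w * hermite \<nu> 0 0 w * f w \<partial>lborel) = 0"
    using eigen_pair_creation[of f \<nu> 0] assms(4) int[OF subgaussian_diff[OF b'(2,3)]]
    by (intro integral_radial_eigen_zero[where g="\<lambda>z. 0"]) (auto simp: f_def hermite_0_left)
  then have "(\<integral>w. gaussian \<nu> w * h w - h 0 * gaussian \<nu> w \<partial>lborel) = 0"
    by (simp add: f_def hermite_0_left algebra_simps)
  then show ?thesis
    using int[OF b'(2)] int[OF subgaussian_mono[OF subgaussian_const, of b' 1]] integral_gaussian[OF assms(4)]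
    by (simp add: b'_def mult.commute)
qed

lemma integral_hermite_creation:
  assumes "h holomorphic_on UNIV" "h \<in> subgaussian b" "0 \<le> b" "b < \<nu>"
  shows "(\<integral>w. gaussian \<nu> w * hermite \<nu> j k w * creation \<nu> j h w \<partial>lborel)
    = of_real (\<nu> ^ j * fact j * (pi / \<nu>)) * ((-1) ^ k * creation \<nu> k h 0)"
proof -
  have D: "(deriv ^^ k) h holomorphic_on UNIV" "(deriv ^^ k) h \<in> subgaussian b"
    using assms by (induction k) (auto intro: holomorphic_deriv subgaussian_deriv)
  show ?thesis
    using integral_hermite_creation_lower[OF assms] integral_cnj_power[OF assms]
      integral_gaussian_holomorphic[OF D] assms
    by (simp add: creation_at_0 power_mult_distrib[symmetric])
qed

section \<open>The transform on images of the creation operator\<close>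

text \<open>
  After the substitution $\xi = z + w$ the kernel depends on $z$ only through a Weyl translation of the
  argument.
\<close>

lemma integrand_translate:
  "integrand \<nu> n n' \<psi> z (z + w)
    = gaussian \<nu> w * hermite \<nu> n n' w * (exp (- of_real \<nu> * cnj z * w) * \<psi> (z + w))"
proof -
  have "- of_real \<nu> * of_real ((cmod (z + w))\<^sup>2) + of_real \<nu> * cnj (z + w) * z
      = - (of_real \<nu> * w * cnj w) + - of_real \<nu> * cnj z * w"
    unfolding complex_norm_square by (simp add: algebra_simps)
  then show ?thesis
    unfolding integrand_def gaussian_def by (simp only: exp_add) simp
qed

lemma integrand_measurable:
  assumes "continuous_on UNIV \<psi>"
  shows "integrand \<nu> n n' \<psi> z \<in> borel_measurable borel"
  unfolding integrand_def[abs_def]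
  by (intro borel_measurable_continuous_onI continuous_intros assms continuous_on_compose2[OF continuous_on_hermite]) auto

lemma transform_translate:
  assumes "continuous_on UNIV \<psi>"
  shows "transform \<nu> n n' \<psi> z = of_real ((-1) ^ n' * \<nu> / (pi * sqrt (fact n * fact n' * \<nu> ^ (n + n')))) *
    (\<integral>w. gaussian \<nu> w * hermite \<nu> n n' w * (exp (- of_real \<nu> * cnj z * w) * \<psi> (z + w)) \<partial>lborel)"
  using integral_lborel_translation[OF integrand_measurable[OF assms], of \<nu> n n' z z]
  unfolding transform_def integrand_translate by simp

text \<open>
  The Weyl translate of $(A^*)^n h$ is $(A^*)^n$ of the translate $G$ of $h$; integrating it against
  $H_{n,n'}$ yields up to a constant $(A^*)^{n'}G(0)$, which is $(A^*)^{n'}h(z)$.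
\<close>

lemma transform_creation:
  assumes "h holomorphic_on UNIV" "h \<in> subgaussian b" "0 \<le> b" "b < \<nu>"
  shows "transform \<nu> n n' (creation \<nu> n h) z
    = of_real (sqrt ((fact n * \<nu> ^ n) / (fact n' * \<nu> ^ n'))) * creation \<nu> n' h z"
proof -
  have \<nu>: "\<nu> > 0"
    using assms by simp
  define G where "G = (\<lambda>w. exp (- of_real \<nu> * cnj z * w) * h (z + w))"
  have G: "G holomorphic_on UNIV" "G \<in> subgaussian b"
    unfolding G_def
    by (rule holomorphic_weyl[OF assms(1)], rule subgaussian_mult_0[OF subgaussian_exp subgaussian_translate[OF assms(2,3)]])
  have cG: "creation \<nu> j G w = exp (- of_real \<nu> * cnj z * w) * creation \<nu> j h (z + w)" for j w
    unfolding G_def by (rule creation_weyl[OF assms(1)])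
  have "transform \<nu> n n' (creation \<nu> n h) z = of_real ((-1) ^ n' * \<nu> / (pi * sqrt (fact n * fact n' * \<nu> ^ (n + n')))) *
     (of_real (\<nu> ^ n * fact n * (pi / \<nu>)) * ((-1) ^ n' * creation \<nu> n' h z))"
    using integral_hermite_creation[OF G assms(3,4), of n n']
    unfolding transform_translate[OF continuous_on_creation[OF assms(1)]] cG by simp
  also have "\<dots> = of_real (\<nu> ^ n * fact n / sqrt (fact n * fact n' * \<nu> ^ (n + n'))) * (((-1) ^ n' * (-1) ^ n') * creation \<nu> n' h z)"
    using \<nu> by (simp add: field_simps)
  also have "((-1) ^ n' * (-1) ^ n' :: complex) = 1"
    by (simp add: power_add[symmetric] mult_2[symmetric])
  also have "\<nu> ^ n * fact n / sqrt (fact n * fact n' * \<nu> ^ (n + n')) = sqrt ((fact n * \<nu> ^ n) / (fact n' * \<nu> ^ n'))"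
  proof -
    define A B where "A = fact n * \<nu> ^ n" and "B = fact n' * \<nu> ^ n'"
    have AB: "A > 0" "B > 0"
      using \<nu> by (auto simp: A_def B_def)
    have "\<nu> ^ n * fact n / sqrt (fact n * fact n' * \<nu> ^ (n + n')) = A / sqrt (A * B)"
      by (simp add: A_def B_def power_add mult_ac)
    also have "\<dots> = sqrt A * sqrt A / (sqrt A * sqrt B)"
      using AB by (simp add: real_sqrt_mult)
    also have "\<dots> = sqrt (A / B)"
      using AB by (simp add: real_sqrt_divide del: real_sqrt_mult_self)
    finally show ?thesis
      unfolding A_def B_def .
  qed
  finally show ?thesis
    by simp
qed

text \<open>
  The reproducing formula. The combination $H_{n,n}(0)\varphi - \varphi(0)H_{n,n}$ of the Weyl translate
  $\varphi$ of $f$ and the comparison function vanishes at the origin and solves the same system, so its radial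
  integral is zero; the integral of $H_{n,n}^2$ is a case of the integration-by-parts formula.
\<close>

lemma transform_diag_fock:
  assumes "\<nu> > 0" and f: "f \<in> fock \<nu> n"
    and int: "integrable lborel (integrand \<nu> n n f z)"
  shows "transform \<nu> n n f z = f z"
proof -
  define H where "H = hermite \<nu> n n"
  define \<phi> where "\<phi> = (\<lambda>w. exp (- of_real \<nu> * cnj z * w) * f (z + w))"
  define c where "c = (of_real (\<nu> ^ n * fact n * (pi / \<nu>)) * (-1) ^ n :: complex)"
  have cf: "continuous_on UNIV f"
    using eigen_pair_continuous[OF eigen_pair_fock[OF f]] by simp
  have int\<phi>: "integrable lborel (\<lambda>w. gaussian \<nu> w * H w * \<phi> w)"
    using int integrable_lborel_translation_iff[OF integrand_measurable[OF cf], of \<nu> n n z z]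
    unfolding integrand_translate H_def \<phi>_def by simp
  have intH: "integrable lborel (\<lambda>w. gaussian \<nu> w * H w * H w)"
    using subgaussian_integrable[OF subgaussian_mult[OF subgaussian_gaussian subgaussian_mult_0[OF subgaussian_hermite subgaussian_hermite]]] assms(1)
    unfolding H_def by (simp add: mult.assoc)
  have eH: "eigen_pair \<nu> n H (\<lambda>z. of_real \<nu> * of_nat n * creation \<nu> (n - 1) (\<lambda>z. (of_real \<nu> * z) ^ n) z)"
    unfolding H_def hermite_eq_creation by (rule eigen_pair_creation[OF holomorphic_scaled_power])
  note e = eigen_pair_lincomb[OF eigen_pair_weyl[OF eigen_pair_fock[OF f], of z, folded \<phi>_def] eH, of "H 0" "\<phi> 0"]
  have "(\<integral>w. gaussian \<nu> w * hermite \<nu> n n w * (H 0 * \<phi> w - \<phi> 0 * H w) \<partial>lborel) = 0"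
  proof (rule integral_radial_eigen_zero[OF _ e])
    show "integrable lborel (\<lambda>w. gaussian \<nu> w * hermite \<nu> n n w * (H 0 * \<phi> w - \<phi> 0 * H w))"
      using Bochner_Integration.integrable_diff[OF integrable_mult_right[OF int\<phi>, of "H 0"] integrable_mult_right[OF intH, of "\<phi> 0"]]
      unfolding H_def[symmetric] by (simp add: algebra_simps)
  qed (use assms in auto)
  also have "(\<lambda>w. gaussian \<nu> w * hermite \<nu> n n w * (H 0 * \<phi> w - \<phi> 0 * H w))
     = (\<lambda>w. H 0 * (gaussian \<nu> w * H w * \<phi> w) - \<phi> 0 * (gaussian \<nu> w * H w * H w))"
    by (simp add: H_def fun_eq_iff algebra_simps)
  finally have "H 0 * (\<integral>w. gaussian \<nu> w * H w * \<phi> w \<partial>lborel) = \<phi> 0 * (\<integral>w. gaussian \<nu> w * H w * H w \<partial>lborel)"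
    using int\<phi> intH by simp
  also have "(\<integral>w. gaussian \<nu> w * H w * H w \<partial>lborel) = c * H 0"
    using integral_hermite_creation[OF holomorphic_scaled_power subgaussian_scaled_power _ assms(1), of n n \<nu> n]
    by (simp add: H_def c_def hermite_eq_creation[symmetric])
  finally have "H 0 * (\<integral>w. gaussian \<nu> w * H w * \<phi> w \<partial>lborel) = H 0 * (c * \<phi> 0)"
    by (simp only: mult_ac)
  moreover have "H 0 \<noteq> 0"
    using assms(1) by (simp add: H_def hermite_diag_0)
  ultimately have "(\<integral>w. gaussian \<nu> w * H w * \<phi> w \<partial>lborel) = c * \<phi> 0"
    using mult_left_cancel by blast
  then have I: "(\<integral>w. gaussian \<nu> w * H w * \<phi> w \<partial>lborel) = c * f z"
    by (simp add: \<phi>_def)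
  have sq: "sqrt (fact n * fact n * \<nu> ^ (n + n)) = fact n * \<nu> ^ n"
  proof -
    have "fact n * fact n * \<nu> ^ (n + n) = (fact n * \<nu> ^ n)\<^sup>2"
      by (simp add: power_add power2_eq_square mult_ac)
    then show ?thesis
      using assms(1) by simp
  qed
  have "transform \<nu> n n f z = of_real ((-1) ^ n * \<nu> / (pi * (fact n * \<nu> ^ n))) * (c * f z)"
    using I unfolding transform_translate[OF cf] sq H_def \<phi>_def by simp
  also have "\<dots> = ((-1) ^ n * (-1) ^ n) * f z"
    using assms(1) unfolding c_def by (simp add: field_simps)
  also have "((-1) ^ n * (-1) ^ n :: complex) = 1"
    by (simp add: power_add[symmetric] mult_2[symmetric])
  finally show ?thesis
    by simp
qed

section \<open>Holomorphic dependence of an integral on a parameter\<close>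

text \<open>
  Local uniform domination in the parameter. By Cauchy's inequality it passes to the complex derivative, so it may be
  used for derivatives of every order.
\<close>

definition dominated_family :: "(complex \<Rightarrow> complex \<Rightarrow> complex) \<Rightarrow> bool" where
  "dominated_family k \<longleftrightarrow> (\<forall>\<xi>. k \<xi> holomorphic_on UNIV) \<and>
     (\<forall>z. (\<lambda>\<xi>. k \<xi> z) \<in> borel_measurable lborel) \<and>
     (\<forall>R. \<exists>B. integrable lborel B \<and> (\<forall>\<xi> z. cmod z \<le> R \<longrightarrow> norm (k \<xi> z) \<le> B \<xi>))"

lemma dominated_familyD:
  assumes "dominated_family k"
  shows "k \<xi> holomorphic_on UNIV" "(\<lambda>\<xi>. k \<xi> z) \<in> borel_measurable lborel"
    and "\<exists>B. integrable lborel B \<and> (\<forall>\<xi> z. cmod z \<le> R \<longrightarrow> norm (k \<xi> z) \<le> B \<xi>)"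
  using assms unfolding dominated_family_def by simp_all

lemma dominated_family_integrable:
  assumes "dominated_family k"
  shows "integrable lborel (\<lambda>\<xi>. k \<xi> z)"
proof -
  obtain B :: "complex \<Rightarrow> real" where B: "integrable lborel B" "\<And>\<xi>. norm (k \<xi> z) \<le> B \<xi>"
    using dominated_familyD(3)[OF assms, of "cmod z"] by blast
  have "norm (k \<xi> z) \<le> norm (B \<xi>)" for \<xi>
    using B(2)[of \<xi>] by simp
  then show ?thesis
    by (intro Bochner_Integration.integrable_bound[OF B(1) dominated_familyD(2)[OF assms]] always_eventually allI)
qed

text \<open>
  On a disc of radius $1$ around $z$ the difference quotients are bounded by the bound for the derivative, and
  dominated convergence applies. The filter at $0$ is restricted to the unit disc so that this bound holds along the
  whole sequence.
\<close>

lemma dominated_family_deriv: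
  assumes "dominated_family k"
  shows "dominated_family (\<lambda>\<xi>. deriv (k \<xi>))"
    and "((\<lambda>z. \<integral>\<xi>. k \<xi> z \<partial>lborel) has_field_derivative (\<integral>\<xi>. deriv (k \<xi>) z \<partial>lborel)) (at z)"
proof -
  have hol: "k \<xi> holomorphic_on UNIV" and meas [measurable]: "(\<lambda>\<xi>. k \<xi> z) \<in> borel_measurable lborel" for \<xi> z
    by (fact dominated_familyD[OF assms])+
  have der: "(k \<xi> has_field_derivative deriv (k \<xi>) z) (at z)" for \<xi> z
    using holomorphic_derivI[OF hol open_UNIV] by simp
  have bound: "\<exists>B. integrable lborel B \<and> (\<forall>\<xi> z. cmod z \<le> R \<longrightarrow> norm (deriv (k \<xi>) z) \<le> B \<xi>)" for R
  proof -
    obtain B :: "complex \<Rightarrow> real" where B: "integrable lborel B" "\<And>\<xi> z. cmod z \<le> R + 1 \<Longrightarrow> norm (k \<xi> z) \<le> B \<xi>"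
      using dominated_familyD(3)[OF assms, of "R + 1"] by blast
    have "norm (deriv (k \<xi>) z) \<le> B \<xi>" if "cmod z \<le> R" for \<xi> z
    proof -
      have "norm ((deriv ^^ 1) (k \<xi>) z) \<le> fact 1 * B \<xi> / 1 ^ 1"
      proof (rule Cauchy_inequality)
        show "k \<xi> holomorphic_on ball z 1" "continuous_on (cball z 1) (k \<xi>)"
          using hol holomorphic_on_subset holomorphic_on_imp_continuous_on by blast+
        show "norm (k \<xi> x) \<le> B \<xi>" if "norm (z - x) = 1" for x
          using B(2)[of x \<xi>] that \<open>cmod z \<le> R\<close> norm_triangle_ineq4[of z "z - x"] by simp
      qed simp
      then show ?thesis
        by simp
    qed
    then show ?thesis
      using B(1) by blast
  qed
  have quot: "(\<lambda>i. (k \<xi> (z + X i) - k \<xi> z) / X i) \<longlonglongrightarrow> deriv (k \<xi>) z"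
    if X: "\<And>i. X i \<noteq> 0" "X \<longlonglongrightarrow> 0" for X \<xi> z
  proof -
    have "((\<lambda>h. (k \<xi> (z + h) - k \<xi> z) / h) \<longlongrightarrow> deriv (k \<xi>) z) (at 0)"
      using der[of \<xi> z] by (simp add: DERIV_def)
    then show ?thesis
      using X unfolding tendsto_at_iff_sequentially by (auto simp: o_def)
  qed
  have meas_deriv [measurable]: "(\<lambda>\<xi>. deriv (k \<xi>) z) \<in> borel_measurable lborel" for z
  proof (rule borel_measurable_LIMSEQ_metric)
    define X :: "nat \<Rightarrow> complex" where "X = (\<lambda>i. inverse (of_nat (Suc i)))"
    have "X \<longlonglongrightarrow> 0"
      unfolding X_def by (rule LIMSEQ_Suc[OF lim_inverse_n])
    moreover have "X i \<noteq> 0" for i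
      by (simp add: X_def del: of_nat_Suc)
    ultimately show "(\<lambda>i. (k \<xi> (z + X i) - k \<xi> z) / X i) \<longlonglongrightarrow> deriv (k \<xi>) z" for \<xi>
      by (intro quot)
    show "(\<lambda>\<xi>. (k \<xi> (z + X i) - k \<xi> z) / X i) \<in> borel_measurable lborel" for i
      by measurable
  qed
  show dom: "dominated_family (\<lambda>\<xi>. deriv (k \<xi>))"
    unfolding dominated_family_def using bound meas_deriv hol by (simp add: holomorphic_deriv)
  show "((\<lambda>z. \<integral>\<xi>. k \<xi> z \<partial>lborel) has_field_derivative (\<integral>\<xi>. deriv (k \<xi>) z \<partial>lborel)) (at z)"
  proof -
    obtain B where B: "integrable lborel B" "\<And>\<xi> u. cmod u \<le> cmod z + 1 \<Longrightarrow> norm (deriv (k \<xi>) u) \<le> B \<xi>"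
      using bound[of "cmod z + 1"] by blast
    have "((\<lambda>h. ((\<integral>\<xi>. k \<xi> (z + h) \<partial>lborel) - (\<integral>\<xi>. k \<xi> z \<partial>lborel)) / h) \<longlongrightarrow> (\<integral>\<xi>. deriv (k \<xi>) z \<partial>lborel))
        (at 0 within ball 0 1)"
      unfolding tendsto_at_iff_sequentially
    proof (intro allI impI)
      fix X :: "nat \<Rightarrow> complex"
      assume X: "\<forall>i. X i \<in> ball 0 1 - {0}" "X \<longlonglongrightarrow> 0"
      have "(\<lambda>i. \<integral>\<xi>. (k \<xi> (z + X i) - k \<xi> z) / X i \<partial>lborel) \<longlonglongrightarrow> (\<integral>\<xi>. deriv (k \<xi>) z \<partial>lborel)"
      proof (rule integral_dominated_convergence[where w=B])
        show "AE \<xi> in lborel. (\<lambda>i. (k \<xi> (z + X i) - k \<xi> z) / X i) \<longlonglongrightarrow> deriv (k \<xi>) z"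
          using X by (intro always_eventually allI quot) auto
        have "norm ((k \<xi> (z + X i) - k \<xi> z) / X i) \<le> B \<xi>" for \<xi> i
        proof -
          have Xi: "norm (X i) < 1" "X i \<noteq> 0"
            using X(1) by auto
          have "norm (k \<xi> (z + X i) - k \<xi> z) \<le> B \<xi> * norm (z + X i - z)"
          proof (rule field_differentiable_bound[of "cball z 1" "k \<xi>" "deriv (k \<xi>)"])
            show "(k \<xi> has_field_derivative deriv (k \<xi>) u) (at u within cball z 1)" for u
              by (rule has_field_derivative_at_within[OF der])
            show "norm (deriv (k \<xi>) u) \<le> B \<xi>" if "u \<in> cball z 1" for u
              using that norm_triangle_ineq2[of u z] by (intro B(2)) (simp add: dist_norm norm_minus_commute)
          qed (use Xi in \<open>auto simp: dist_norm\<close>)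
          then show ?thesis
            using Xi by (simp add: norm_divide divide_le_eq)
        qed
        then show "AE \<xi> in lborel. norm ((k \<xi> (z + X i) - k \<xi> z) / X i) \<le> B \<xi>" for i
          by simp
      qed (use B(1) in auto)
      then show "((\<lambda>h. ((\<integral>\<xi>. k \<xi> (z + h) \<partial>lborel) - (\<integral>\<xi>. k \<xi> z \<partial>lborel)) / h) \<circ> X) \<longlonglongrightarrow> (\<integral>\<xi>. deriv (k \<xi>) z \<partial>lborel)"
        using dominated_family_integrable[OF assms] by (simp add: o_def)
    qed
    moreover have "at (0::complex) within ball 0 1 = at 0"
      by (rule at_within_open) auto
    ultimately show ?thesis
      unfolding DERIV_def by (simp only:)
  qed
qed

lemma dominated_family_holomorphic:
  assumes "dominated_family k"
  shows "(\<lambda>z. \<integral>\<xi>. k \<xi> z \<partial>lborel) holomorphic_on UNIV"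
proof (rule holomorphic_onI)
  fix z
  show "(\<lambda>z. \<integral>\<xi>. k \<xi> z \<partial>lborel) field_differentiable at z within UNIV"
    using dominated_family_deriv(2)[OF assms, of z] unfolding field_differentiable_def by (rule exI)
qed

lemma creation_integral:
  assumes "dominated_family k"
  shows "integrable lborel (\<lambda>\<xi>. creation \<nu> n (k \<xi>) z)"
    and "creation \<nu> n (\<lambda>z. \<integral>\<xi>. k \<xi> z \<partial>lborel) z = (\<integral>\<xi>. creation \<nu> n (k \<xi>) z \<partial>lborel)"
  using assms
proof (induction n arbitrary: k z)
  case 0
  {
    case 1
    then show ?case
      using dominated_family_integrable by simp
  next
    case 2
    then show ?case
      by simp
  }
next
  case (Suc n)
  {
    case 1
    note d = dominated_family_deriv[OF 1]
    show ?case
      using Suc.IH(1)[OF 1] Suc.IH(1)[OF d(1)] by simp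
  next
    case 2
    note d = dominated_family_deriv[OF 2]
    have "deriv (\<lambda>z. \<integral>\<xi>. k \<xi> z \<partial>lborel) = (\<lambda>z. \<integral>\<xi>. deriv (k \<xi>) z \<partial>lborel)"
      using d(2) by (auto intro!: DERIV_imp_deriv)
    then show ?case
      using Suc.IH(1)[OF 2] Suc.IH(1)[OF d(1)] Suc.IH(2)[OF 2] Suc.IH(2)[OF d(1)] by simp
  }
qed

section \<open>Square integrable estimates\<close>

text \<open>
  With half of the Gaussian weight on each side, the modulus of the kernel becomes a function of
  $\xi - z$ alone, namely this one.
\<close>

definition kernel_envelope :: "real \<Rightarrow> nat \<Rightarrow> nat \<Rightarrow> complex \<Rightarrow> real" where
  "kernel_envelope \<nu> n n' w = norm (gaussian (\<nu> / 2) w * hermite \<nu> n n' w)"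

text \<open>
  The modulus of $f$ times the square root of the weight: square integrability for the weight becomes
  ordinary square integrability.
\<close>

definition flattened :: "real \<Rightarrow> (complex \<Rightarrow> complex) \<Rightarrow> complex \<Rightarrow> real" where
  "flattened \<nu> f w = norm (f w) * exp (- \<nu> / 2 * (cmod w)\<^sup>2)"

lemma flattened_nonneg: "flattened \<nu> f w \<ge> 0"
  by (simp add: flattened_def)

lemma kernel_envelope_nonneg: "kernel_envelope \<nu> n n' w \<ge> 0"
  by (simp add: kernel_envelope_def)

lemma flattened_square: "(flattened \<nu> f w)\<^sup>2 = (cmod (f w))\<^sup>2 * exp (- \<nu> * (cmod w)\<^sup>2)"
proof -
  have "(exp (- \<nu> / 2 * (cmod w)\<^sup>2))\<^sup>2 = exp (- \<nu> * (cmod w)\<^sup>2)"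
    by (simp add: exp_double[symmetric])
  then show ?thesis
    unfolding flattened_def power_mult_distrib by simp
qed

lemma L2_flattened:
  "f \<in> L2 \<nu> \<longleftrightarrow> f \<in> borel_measurable lborel \<and> integrable lborel (\<lambda>w. (flattened \<nu> f w)\<^sup>2)"
  by (simp add: L2_def flattened_square)

lemma continuous_on_kernel_envelope: "continuous_on UNIV (kernel_envelope \<nu> n n')"
  unfolding kernel_envelope_def[abs_def] by (intro continuous_intros continuous_on_gaussian continuous_on_hermite)

lemma continuous_on_flattened: "continuous_on UNIV f \<Longrightarrow> continuous_on UNIV (flattened \<nu> f)"
  unfolding flattened_def[abs_def] by (intro continuous_intros)

lemma kernel_envelope_subgaussian:
  "(\<lambda>w. gaussian (\<nu> / 2) w * hermite \<nu> n n' w) \<in> subgaussian (- (\<nu> / 2))"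
  using subgaussian_mult[OF subgaussian_gaussian subgaussian_hermite, of "\<nu> / 2" \<nu> n n'] by simp

lemma kernel_envelope_integrable:
  assumes "\<nu> > 0"
  shows "integrable lborel (kernel_envelope \<nu> n n')" "integrable lborel (\<lambda>w. (kernel_envelope \<nu> n n' w)\<^sup>2)"
proof -
  show "integrable lborel (kernel_envelope \<nu> n n')"
    unfolding kernel_envelope_def[abs_def]
    by (rule integrable_norm[OF subgaussian_integrable[OF kernel_envelope_subgaussian]]) (use assms in simp)
  show "integrable lborel (\<lambda>w. (kernel_envelope \<nu> n n' w)\<^sup>2)"
    using integrable_norm[OF subgaussian_integrable[OF subgaussian_mult[OF kernel_envelope_subgaussian[of \<nu> n n'] kernel_envelope_subgaussian[of \<nu> n n']]]] assms
    unfolding kernel_envelope_def power2_eq_square norm_mult[symmetric] by simp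
qed

lemma kernel_envelope_bounded:
  assumes "\<nu> > 0"
  obtains K where "\<And>w. kernel_envelope \<nu> n n' w \<le> K"
proof -
  obtain C where C: "C \<ge> 0" "\<And>w. kernel_envelope \<nu> n n' w \<le> C * exp (- (\<nu> / 4) * (cmod w)\<^sup>2)"
    using subgaussianD[OF kernel_envelope_subgaussian, of \<nu> "- (\<nu> / 4)" n n'] assms
    unfolding kernel_envelope_def by auto
  have "kernel_envelope \<nu> n n' w \<le> C" for w
  proof -
    have "C * exp (- (\<nu> / 4) * (cmod w)\<^sup>2) \<le> C * 1"
      using C(1) assms by (intro mult_left_mono) auto
    then show ?thesis
      using C(2)[of w] by linarith
  qed
  then show ?thesis
    using that by blast
qed

text \<open>
  Completing the square: $-|\xi|^2 + \mathrm{Re}(\overline{\xi}z)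
  = \frac12|z|^2 - \frac12|\xi-z|^2 - \frac12|\xi|^2$.
\<close>

lemma norm_integrand:
  "norm (integrand \<nu> n n' f z \<xi>) = exp (\<nu> / 2 * (cmod z)\<^sup>2) * (kernel_envelope \<nu> n n' (\<xi> - z) * flattened \<nu> f \<xi>)"
proof -
  have sq: "(cmod (\<xi> - z))\<^sup>2 = (cmod \<xi>)\<^sup>2 + (cmod z)\<^sup>2 - 2 * Re (cnj \<xi> * z)"
    unfolding cmod_power2 by (simp add: power2_eq_square algebra_simps)
  have alg: "- \<nu> * A + \<nu> * C = \<nu> / 2 * B + (- (\<nu> / 2) * (A + B - 2 * C)) + - \<nu> / 2 * A" for A B C
    by (simp add: field_simps)
  have "- \<nu> * (cmod \<xi>)\<^sup>2 + \<nu> * Re (cnj \<xi> * z)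
      = \<nu> / 2 * (cmod z)\<^sup>2 + (- (\<nu> / 2) * (cmod (\<xi> - z))\<^sup>2) + - \<nu> / 2 * (cmod \<xi>)\<^sup>2"
    unfolding sq by (rule alg)
  then have "exp (- \<nu> * (cmod \<xi>)\<^sup>2 + \<nu> * Re (cnj \<xi> * z))
      = exp (\<nu> / 2 * (cmod z)\<^sup>2) * exp (- (\<nu> / 2) * (cmod (\<xi> - z))\<^sup>2) * exp (- \<nu> / 2 * (cmod \<xi>)\<^sup>2)"
    by (simp only: exp_add)
  moreover have "norm (exp (- of_real \<nu> * of_real ((cmod \<xi>)\<^sup>2) + of_real \<nu> * cnj \<xi> * z))
      = exp (- \<nu> * (cmod \<xi>)\<^sup>2 + \<nu> * Re (cnj \<xi> * z))"
    unfolding norm_exp_eq_Re by (simp add: mult.assoc algebra_simps)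
  ultimately show ?thesis
    unfolding integrand_def kernel_envelope_def flattened_def gaussian_eq norm_mult norm_of_real
    by (simp add: mult_ac)
qed

lemma mult_le_half_squares: "(a::real) * b \<le> (a\<^sup>2 + b\<^sup>2) / 2"
  using zero_le_power2[of "a - b"] by (simp add: power2_diff)

lemma kernel_envelope_shift_integrable:
  assumes "\<nu> > 0"
  shows "integrable lborel (\<lambda>\<xi>. (kernel_envelope \<nu> n n' (\<xi> - z))\<^sup>2)"
    and "(\<integral>\<xi>. (kernel_envelope \<nu> n n' (\<xi> - z))\<^sup>2 \<partial>lborel) = (\<integral>\<xi>. (kernel_envelope \<nu> n n' \<xi>)\<^sup>2 \<partial>lborel)"
    and "integrable lborel (\<lambda>\<xi>. kernel_envelope \<nu> n n' (\<xi> - z))"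
    and "(\<integral>\<xi>. kernel_envelope \<nu> n n' (\<xi> - z) \<partial>lborel) = (\<integral>\<xi>. kernel_envelope \<nu> n n' \<xi> \<partial>lborel)"
proof -
  have m: "kernel_envelope \<nu> n n' \<in> borel_measurable borel"
    by (rule borel_measurable_continuous_onI[OF continuous_on_kernel_envelope])
  then have m2: "(\<lambda>w. (kernel_envelope \<nu> n n' w)\<^sup>2) \<in> borel_measurable borel"
    by measurable
  note i = kernel_envelope_integrable[OF assms, of n n']
  show "integrable lborel (\<lambda>\<xi>. (kernel_envelope \<nu> n n' (\<xi> - z))\<^sup>2)"
    "(\<integral>\<xi>. (kernel_envelope \<nu> n n' (\<xi> - z))\<^sup>2 \<partial>lborel) = (\<integral>\<xi>. (kernel_envelope \<nu> n n' \<xi>)\<^sup>2 \<partial>lborel)"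
    "integrable lborel (\<lambda>\<xi>. kernel_envelope \<nu> n n' (\<xi> - z))"
    "(\<integral>\<xi>. kernel_envelope \<nu> n n' (\<xi> - z) \<partial>lborel) = (\<integral>\<xi>. kernel_envelope \<nu> n n' \<xi> \<partial>lborel)"
    using integrable_lborel_translation_iff[OF m2, of "- z"] integral_lborel_translation[OF m2, of "- z"]
      integrable_lborel_translation_iff[OF m, of "- z"] integral_lborel_translation[OF m, of "- z"] i
    by simp_all
qed

lemma integrand_integrable:
  assumes "\<nu> > 0" "f \<in> L2 \<nu>" "continuous_on UNIV f"
  shows "integrable lborel (integrand \<nu> n n' f z)"
    and "(\<integral>\<xi>. norm (integrand \<nu> n n' f z \<xi>) \<partial>lborel) \<le> exp (\<nu> / 2 * (cmod z)\<^sup>2) *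
      (((\<integral>\<xi>. (kernel_envelope \<nu> n n' \<xi>)\<^sup>2 \<partial>lborel) + (\<integral>\<xi>. (flattened \<nu> f \<xi>)\<^sup>2 \<partial>lborel)) / 2)"
proof -
  define E where "E = exp (\<nu> / 2 * (cmod z)\<^sup>2)"
  define b where "b = (\<lambda>\<xi>. E * (((kernel_envelope \<nu> n n' (\<xi> - z))\<^sup>2 + (flattened \<nu> f \<xi>)\<^sup>2) / 2))"
  have le: "norm (integrand \<nu> n n' f z \<xi>) \<le> b \<xi>" for \<xi>
    unfolding norm_integrand b_def E_def[symmetric] using mult_le_half_squares by (intro mult_left_mono) (auto simp: E_def)
  have iF: "integrable lborel (\<lambda>\<xi>. (flattened \<nu> f \<xi>)\<^sup>2)"
    using assms(2) by (simp add: L2_flattened)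
  note ik = kernel_envelope_shift_integrable[OF assms(1), of n n' z]
  have ib: "integrable lborel b"
    unfolding b_def using iF ik(1) by simp
  show int: "integrable lborel (integrand \<nu> n n' f z)"
  proof (rule Bochner_Integration.integrable_bound[OF ib])
    show "AE \<xi> in lborel. norm (integrand \<nu> n n' f z \<xi>) \<le> norm (b \<xi>)"
      using order_trans[OF le abs_ge_self] by simp
  qed (use integrand_measurable[OF assms(3)] in simp)
  have "(\<integral>\<xi>. norm (integrand \<nu> n n' f z \<xi>) \<partial>lborel) \<le> (\<integral>\<xi>. b \<xi> \<partial>lborel)"
    using int ib le by (intro integral_mono) auto
  also have "\<dots> = E * (((\<integral>\<xi>. (kernel_envelope \<nu> n n' \<xi>)\<^sup>2 \<partial>lborel) + (\<integral>\<xi>. (flattened \<nu> f \<xi>)\<^sup>2 \<partial>lborel)) / 2)"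
    unfolding b_def using iF ik(1) by (simp add: ik(2))
  finally show "(\<integral>\<xi>. norm (integrand \<nu> n n' f z \<xi>) \<partial>lborel) \<le> exp (\<nu> / 2 * (cmod z)\<^sup>2) *
      (((\<integral>\<xi>. (kernel_envelope \<nu> n n' \<xi>)\<^sup>2 \<partial>lborel) + (\<integral>\<xi>. (flattened \<nu> f \<xi>)\<^sup>2 \<partial>lborel)) / 2)"
    unfolding E_def .
qed

section \<open>Representation of the generalized Bargmann-Fock spaces\<close>

lemma fock_continuous: "f \<in> fock \<nu> n \<Longrightarrow> continuous_on UNIV f"
  using eigen_pair_fock eigen_pair_continuous by blast

lemma fock_L2: "f \<in> fock \<nu> n \<Longrightarrow> f \<in> L2 \<nu>"
  by (simp add: fock_def)

text \<open>
  As a function of $z$ the kernel is a Weyl translate of $H_{n,n'}$ by $-\xi$, hence $(A^*)^{n'}$ of a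
  holomorphic function. The sign comes from the parity of $H_{n,n'}$.
\<close>

lemma integrand_eq_creation:
  "integrand \<nu> n n' f z \<xi> = (-1) ^ (n + n') * creation \<nu> n'
     (\<lambda>w. gaussian \<nu> \<xi> * f \<xi> * (exp (of_real \<nu> * cnj \<xi> * w) * (of_real \<nu> * (w - \<xi>)) ^ n)) z"
proof -
  have "creation \<nu> n' (\<lambda>w. gaussian \<nu> \<xi> * f \<xi> * (exp (of_real \<nu> * cnj \<xi> * w) * (of_real \<nu> * (w - \<xi>)) ^ n)) z
      = gaussian \<nu> \<xi> * f \<xi> * creation \<nu> n' (\<lambda>w. exp (of_real \<nu> * cnj \<xi> * w) * (of_real \<nu> * (w - \<xi>)) ^ n) z"
    by (intro creation_cmult holomorphic_intros)
  also have "creation \<nu> n' (\<lambda>w. exp (of_real \<nu> * cnj \<xi> * w) * (of_real \<nu> * (w - \<xi>)) ^ n) z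
      = exp (of_real \<nu> * cnj \<xi> * z) * hermite \<nu> n n' (z - \<xi>)"
    using creation_weyl[OF holomorphic_scaled_power, of \<nu> n' "- \<xi>" \<nu> n z]
    by (simp add: hermite_eq_creation)
  also have "hermite \<nu> n n' (z - \<xi>) = (-1) ^ (n + n') * hermite \<nu> n n' (\<xi> - z)"
    using hermite_uminus[of \<nu> n n' "\<xi> - z"] by simp
  finally have "creation \<nu> n' (\<lambda>w. gaussian \<nu> \<xi> * f \<xi> * (exp (of_real \<nu> * cnj \<xi> * w) * (of_real \<nu> * (w - \<xi>)) ^ n)) z
      = (-1) ^ (n + n') * (gaussian \<nu> \<xi> * exp (of_real \<nu> * cnj \<xi> * z) * hermite \<nu> n n' (\<xi> - z) * f \<xi>)"
    by (simp add: mult_ac)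
  moreover have "gaussian \<nu> \<xi> * exp (of_real \<nu> * cnj \<xi> * z)
      = exp (- of_real \<nu> * of_real ((cmod \<xi>)\<^sup>2) + of_real \<nu> * cnj \<xi> * z)"
    unfolding gaussian_def complex_norm_square exp_add[symmetric] by (simp add: mult.assoc)
  moreover have "((-1) ^ (n + n') * ((-1) ^ (n + n') * x) :: complex) = x" for x
    by (simp add: mult.assoc[symmetric] power_add[symmetric] mult_2[symmetric])
  ultimately show ?thesis
    by (simp add: integrand_def)
qed

text \<open>
  For $|z| \le R$ the two holomorphic factors cost at most a constant times $e^{\nu|\xi|^2/8}$ each. This
  leaves $e^{-\nu|\xi|^2/4}$ times a square integrable function, which is integrable.
\<close>

lemma dominated_family_integrand:
  assumes "\<nu> > 0" "f \<in> L2 \<nu>" "continuous_on UNIV f"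
  shows "dominated_family (\<lambda>\<xi> w. gaussian \<nu> \<xi> * f \<xi> * (exp (of_real \<nu> * cnj \<xi> * w) * (of_real \<nu> * (w - \<xi>)) ^ n))"
  unfolding dominated_family_def
proof (intro conjI allI)
  show "(\<lambda>w. gaussian \<nu> \<xi> * f \<xi> * (exp (of_real \<nu> * cnj \<xi> * w) * (of_real \<nu> * (w - \<xi>)) ^ n)) holomorphic_on UNIV" for \<xi>
    by (intro holomorphic_intros)
  have "(\<lambda>\<xi>. gaussian \<nu> \<xi> * f \<xi> * (exp (of_real \<nu> * cnj \<xi> * w) * (of_real \<nu> * (w - \<xi>)) ^ n)) \<in> borel_measurable borel" for w
    by (intro borel_measurable_continuous_onI continuous_intros assms continuous_on_gaussian)
  then show "(\<lambda>\<xi>. gaussian \<nu> \<xi> * f \<xi> * (exp (of_real \<nu> * cnj \<xi> * w) * (of_real \<nu> * (w - \<xi>)) ^ n)) \<in> borel_measurable lborel" for w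
    by simp
  fix R0 :: real
  define R where "R = max R0 0"
  obtain C where C: "\<And>w \<xi>. cmod w \<le> R \<Longrightarrow> norm ((of_real \<nu> * (w + \<xi>)) ^ n :: complex) \<le> C * exp (\<nu> / 8 * (cmod \<xi>)\<^sup>2)"
    using subgaussian_translate_bound[OF subgaussian_scaled_power[of \<nu> n], of "\<nu> / 8" R] assms(1) by auto
  obtain D where D: "D \<ge> 0" "\<And>\<xi>. norm (exp (of_real (\<nu> * R) * \<xi> :: complex)) \<le> D * exp (\<nu> / 8 * (cmod \<xi>)\<^sup>2)"
    using subgaussianD[OF subgaussian_exp[of "of_real (\<nu> * R)"], of "\<nu> / 8"] assms(1) by auto
  have C0: "C \<ge> 0"
    using order_trans[OF norm_ge_zero C[of 0 0]] by (simp add: R_def)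
  define B where "B = (\<lambda>\<xi>. C * D * ((exp (- \<nu> / 2 * (cmod \<xi>)\<^sup>2) + (flattened \<nu> f \<xi>)\<^sup>2) / 2))"
  have "norm (gaussian \<nu> \<xi> * f \<xi> * (exp (of_real \<nu> * cnj \<xi> * w) * (of_real \<nu> * (w - \<xi>)) ^ n)) \<le> B \<xi>"
    if "cmod w \<le> R0" for \<xi> w
  proof -
    have w: "cmod w \<le> R"
      using that by (simp add: R_def)
    have "Re (cnj \<xi> * w) \<le> cmod \<xi> * R"
      using complex_Re_le_cmod[of "cnj \<xi> * w"] mult_left_mono[OF w, of "cmod \<xi>"] by (simp only: norm_mult complex_mod_cnj) simp
    then have "\<nu> * Re (cnj \<xi> * w) \<le> \<nu> * (cmod \<xi> * R)"
      using assms(1) by (intro mult_left_mono) auto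
    then have 1: "norm (exp (of_real \<nu> * cnj \<xi> * w)) \<le> D * exp (\<nu> / 8 * (cmod \<xi>)\<^sup>2)"
    proof -
      have "Re (of_real \<nu> * cnj \<xi> * w) = \<nu> * Re (cnj \<xi> * w)"
        by (simp add: algebra_simps)
      then have "norm (exp (of_real \<nu> * cnj \<xi> * w)) = exp (\<nu> * Re (cnj \<xi> * w))"
        unfolding norm_exp_eq_Re by (simp only:)
      also have "\<dots> \<le> exp (\<nu> * (cmod \<xi> * R))"
        using \<open>\<nu> * Re (cnj \<xi> * w) \<le> \<nu> * (cmod \<xi> * R)\<close> by (simp only: exp_le_cancel_iff)
      also have "\<dots> \<le> D * exp (\<nu> / 8 * (cmod \<xi>)\<^sup>2)"
        using D(2)[of "of_real (cmod \<xi>)"] unfolding norm_exp_eq_Re by (simp add: mult_ac)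
      finally show ?thesis .
    qed
    have 2: "norm ((of_real \<nu> * (w - \<xi>)) ^ n :: complex) \<le> C * exp (\<nu> / 8 * (cmod \<xi>)\<^sup>2)"
      using C[OF w, of "- \<xi>"] by simp
    have "norm (exp (of_real \<nu> * cnj \<xi> * w) * (of_real \<nu> * (w - \<xi>)) ^ n)
        \<le> (D * exp (\<nu> / 8 * (cmod \<xi>)\<^sup>2)) * (C * exp (\<nu> / 8 * (cmod \<xi>)\<^sup>2))"
      unfolding norm_mult[of "exp _"] using 1 2 D(1) by (intro mult_mono) auto
    also have "\<dots> = C * D * exp (\<nu> / 8 * (cmod \<xi>)\<^sup>2 + \<nu> / 8 * (cmod \<xi>)\<^sup>2)"
      unfolding exp_add by (simp only: mult_ac)
    also have "\<nu> / 8 * (cmod \<xi>)\<^sup>2 + \<nu> / 8 * (cmod \<xi>)\<^sup>2 = \<nu> / 4 * (cmod \<xi>)\<^sup>2"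
      by simp
    finally have 3: "norm (exp (of_real \<nu> * cnj \<xi> * w) * (of_real \<nu> * (w - \<xi>)) ^ n) \<le> C * D * exp (\<nu> / 4 * (cmod \<xi>)\<^sup>2)" .
    have "norm (gaussian \<nu> \<xi> * f \<xi> * (exp (of_real \<nu> * cnj \<xi> * w) * (of_real \<nu> * (w - \<xi>)) ^ n))
        \<le> exp (- \<nu> * (cmod \<xi>)\<^sup>2) * norm (f \<xi>) * (C * D * exp (\<nu> / 4 * (cmod \<xi>)\<^sup>2))"
      unfolding norm_mult[of "gaussian \<nu> \<xi> * f \<xi>"] norm_mult[of "gaussian \<nu> \<xi>"] using 3
      by (intro mult_mono) (auto simp: gaussian_eq)
    also have "\<dots> = C * D * ((exp (- \<nu> * (cmod \<xi>)\<^sup>2) * exp (\<nu> / 4 * (cmod \<xi>)\<^sup>2)) * norm (f \<xi>))"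
      by (simp only: mult_ac)
    also have "exp (- \<nu> * (cmod \<xi>)\<^sup>2) * exp (\<nu> / 4 * (cmod \<xi>)\<^sup>2) = exp (- \<nu> / 4 * (cmod \<xi>)\<^sup>2) * exp (- \<nu> / 2 * (cmod \<xi>)\<^sup>2)"
      unfolding exp_add[symmetric] by (simp add: field_simps)
    also have "C * D * ((exp (- \<nu> / 4 * (cmod \<xi>)\<^sup>2) * exp (- \<nu> / 2 * (cmod \<xi>)\<^sup>2)) * norm (f \<xi>))
        = C * D * (exp (- \<nu> / 4 * (cmod \<xi>)\<^sup>2) * flattened \<nu> f \<xi>)"
      unfolding flattened_def by (simp only: mult_ac)
    also have "\<dots> \<le> B \<xi>"
    proof -
      have "(exp (- \<nu> / 4 * (cmod \<xi>)\<^sup>2))\<^sup>2 = exp (- \<nu> / 2 * (cmod \<xi>)\<^sup>2)"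
        by (simp add: exp_double[symmetric])
      then show ?thesis
        unfolding B_def using C0 D(1) mult_le_half_squares[of "exp (- \<nu> / 4 * (cmod \<xi>)\<^sup>2)" "flattened \<nu> f \<xi>"]
        by (intro mult_left_mono) auto
    qed
    finally show ?thesis .
  qed
  moreover have "integrable lborel B"
  proof -
    have "integrable lborel (\<lambda>w::complex. exp (- \<nu> / 2 * (cmod w)\<^sup>2))"
      using gaussian_complex[of "\<nu> / 2"] assms(1) by (auto simp: has_bochner_integral_iff)
    then show ?thesis
      unfolding B_def using assms(2) by (simp add: L2_flattened)
  qed
  ultimately show "\<exists>B. integrable lborel B \<and> (\<forall>\<xi> z. cmod z \<le> R0 \<longrightarrow>
      norm (gaussian \<nu> \<xi> * f \<xi> * (exp (of_real \<nu> * cnj \<xi> * z) * (of_real \<nu> * (z - \<xi>)) ^ n)) \<le> B \<xi>)"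
    by blast
qed

text \<open>
  The reproducing formula with $(A^*)^n$ pulled out of the integral. The remaining integral $h$ is, up to sign, the
  integral of the kernel of type $(n,0)$, which gives its growth.
\<close>

lemma fock_representation:
  assumes "\<nu> > 0" "f \<in> fock \<nu> n"
  obtains h where "h holomorphic_on UNIV" "h \<in> subgaussian (\<nu> / 2)" "f = creation \<nu> n h"
proof -
  note cf = fock_continuous[OF assms(2)] and L2f = fock_L2[OF assms(2)]
  define k where "k = (\<lambda>\<xi> w. gaussian \<nu> \<xi> * f \<xi> * (exp (of_real \<nu> * cnj \<xi> * w) * (of_real \<nu> * (w - \<xi>)) ^ n))"
  define h where "h = (\<lambda>w. \<integral>\<xi>. k \<xi> w \<partial>lborel)"
  have dom: "dominated_family k"
    unfolding k_def by (rule dominated_family_integrand[OF assms(1) L2f cf])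
  have hol: "h holomorphic_on UNIV"
    unfolding h_def by (rule dominated_family_holomorphic[OF dom])
  have sub: "h \<in> subgaussian (\<nu> / 2)"
    unfolding subgaussian_def
  proof (intro CollectI conjI allI impI)
    show "continuous_on UNIV h"
      using hol by (rule holomorphic_on_imp_continuous_on)
    define M where "M = ((\<integral>\<xi>. (kernel_envelope \<nu> n 0 \<xi>)\<^sup>2 \<partial>lborel) + (\<integral>\<xi>. (flattened \<nu> f \<xi>)\<^sup>2 \<partial>lborel)) / 2"
    have "M \<ge> 0"
      unfolding M_def by simp
    fix a assume a: "\<nu> / 2 < a"
    have "norm (h z) \<le> M * exp (a * (cmod z)\<^sup>2)" for z
    proof -
      have "norm (h z) \<le> (\<integral>\<xi>. norm (k \<xi> z) \<partial>lborel)"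
        unfolding h_def by (rule integral_norm_bound)
      also have "\<dots> = (\<integral>\<xi>. norm (integrand \<nu> n 0 f z \<xi>) \<partial>lborel)"
        unfolding integrand_eq_creation k_def by (simp add: norm_mult norm_power)
      also have "\<dots> \<le> exp (\<nu> / 2 * (cmod z)\<^sup>2) * M"
        unfolding M_def by (rule integrand_integrable(2)[OF assms(1) L2f cf])
      also have "\<dots> \<le> exp (a * (cmod z)\<^sup>2) * M"
        using a \<open>M \<ge> 0\<close> mult_right_mono[of "\<nu> / 2" a "(cmod z)\<^sup>2"] by (intro mult_right_mono) auto
      finally show ?thesis
        by (simp add: mult.commute)
    qed
    then show "\<exists>C. \<forall>z. norm (h z) \<le> C * exp (a * (cmod z)\<^sup>2)"
      by blast
  qed
  define c where "c = complex_of_real ((-1) ^ n * \<nu> / (pi * sqrt (fact n * fact n * \<nu> ^ (n + n))))"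
  have "f z = creation \<nu> n (\<lambda>w. c * h w) z" for z
  proof -
    have "f z = transform \<nu> n n f z"
      using transform_diag_fock[OF assms integrand_integrable(1)[OF assms(1) L2f cf]] by simp
    also have "\<dots> = c * (\<integral>\<xi>. creation \<nu> n (k \<xi>) z \<partial>lborel)"
      unfolding transform_def integrand_eq_creation k_def c_def by (simp add: mult_2[symmetric])
    also have "\<dots> = creation \<nu> n (\<lambda>w. c * h w) z"
      unfolding h_def creation_integral(2)[OF dom, symmetric] using creation_cmult[OF hol] by (simp add: h_def)
    finally show ?thesis .
  qed
  then have "f = creation \<nu> n (\<lambda>w. c * h w)"
    by blast
  moreover have "(\<lambda>w. c * h w) holomorphic_on UNIV"
    using hol by (intro holomorphic_intros)
  ultimately show ?thesis
    using that subgaussian_cmult[OF sub] by blast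
qed

section \<open>Boundedness and the adjoint\<close>

lemma nn_integral_convolution_fst:
  fixes k A :: "complex \<Rightarrow> ennreal"
  assumes [measurable]: "k \<in> borel_measurable borel" "A \<in> borel_measurable borel"
  shows "(\<integral>\<^sup>+z. \<integral>\<^sup>+\<xi>. k (\<xi> - z) * A z \<partial>lborel \<partial>lborel) = (\<integral>\<^sup>+w. k w \<partial>lborel) * (\<integral>\<^sup>+w. A w \<partial>lborel)"
proof -
  have "(\<integral>\<^sup>+\<xi>. k (\<xi> - z) * A z \<partial>lborel) = (\<integral>\<^sup>+w. k w \<partial>lborel) * A z" for z
    using nn_integral_lborel_translation[of k "- z"] by (simp add: nn_integral_multc)
  then show ?thesis
    by (simp add: nn_integral_cmult)
qed

text \<open>
  Together with its mirror image this is the Schur test for a convolution kernel: integrating over either variable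
  first produces the total mass of $k$.
\<close>

lemma nn_integral_convolution_snd:
  fixes k A :: "complex \<Rightarrow> ennreal"
  assumes [measurable]: "k \<in> borel_measurable borel" "A \<in> borel_measurable borel"
  shows "(\<integral>\<^sup>+z. \<integral>\<^sup>+\<xi>. k (\<xi> - z) * A \<xi> \<partial>lborel \<partial>lborel) = (\<integral>\<^sup>+w. k w \<partial>lborel) * (\<integral>\<^sup>+w. A w \<partial>lborel)"
proof -
  have "(\<integral>\<^sup>+z. k (\<xi> - z) \<partial>lborel) = (\<integral>\<^sup>+w. k w \<partial>lborel)" for \<xi>
  proof -
    have "(\<integral>\<^sup>+z. k (\<xi> - z) \<partial>lborel) = (\<integral>\<^sup>+z. k (\<xi> + z) \<partial>lborel)"
      using nn_integral_lborel_uminus[of "\<lambda>z. k (\<xi> + z)"] by simp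
    then show ?thesis
      by (simp add: nn_integral_lborel_translation)
  qed
  then have "(\<integral>\<^sup>+\<xi>. \<integral>\<^sup>+z. k (\<xi> - z) * A \<xi> \<partial>lborel \<partial>lborel) = (\<integral>\<^sup>+w. k w \<partial>lborel) * (\<integral>\<^sup>+w. A w \<partial>lborel)"
    by (simp add: nn_integral_multc nn_integral_cmult)
  also have "(\<integral>\<^sup>+\<xi>. \<integral>\<^sup>+z. k (\<xi> - z) * A \<xi> \<partial>lborel \<partial>lborel) = (\<integral>\<^sup>+z. \<integral>\<^sup>+\<xi>. k (\<xi> - z) * A \<xi> \<partial>lborel \<partial>lborel)"
    by (rule lborel_pair.Fubini') measurable
  finally show ?thesis .
qed

lemma flattened_square_finite:
  assumes "f \<in> L2 \<nu>"
  shows "(\<integral>\<^sup>+w. ennreal ((flattened \<nu> f w)\<^sup>2) \<partial>lborel) < \<infinity>"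
  using assms by (simp add: L2_flattened integrable_iff_bounded)

lemma kernel_envelope_finite:
  assumes "\<nu> > 0"
  shows "(\<integral>\<^sup>+w. ennreal (kernel_envelope \<nu> n n' w) \<partial>lborel) < \<infinity>"
  using kernel_envelope_integrable(1)[OF assms, of n n'] by (simp add: integrable_iff_bounded kernel_envelope_nonneg)

text \<open>
  The integral of $k\,(sF - t)^2$ is a nonnegative quadratic form in $s$ and $t$.
\<close>

lemma weighted_cauchy_schwarz:
  fixes k F :: "'a \<Rightarrow> real"
  assumes "integrable M k" "integrable M (\<lambda>x. k x * F x)" "integrable M (\<lambda>x. k x * (F x)\<^sup>2)" "\<And>x. k x \<ge> 0"
  shows "(\<integral>x. k x * F x \<partial>M)\<^sup>2 \<le> (\<integral>x. k x \<partial>M) * (\<integral>x. k x * (F x)\<^sup>2 \<partial>M)"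
proof -
  define a b c where "a = (\<integral>x. k x \<partial>M)" and "b = (\<integral>x. k x * F x \<partial>M)" and "c = (\<integral>x. k x * (F x)\<^sup>2 \<partial>M)"
  have q: "0 \<le> c * s\<^sup>2 - 2 * s * t * b + t\<^sup>2 * a" for s t
  proof -
    have "0 \<le> (\<integral>x. k x * (s * F x - t)\<^sup>2 \<partial>M)"
      using assms(4) by (intro integral_nonneg_AE) auto
    also have "(\<lambda>x. k x * (s * F x - t)\<^sup>2) = (\<lambda>x. s\<^sup>2 * (k x * (F x)\<^sup>2) - 2 * s * t * (k x * F x) + t\<^sup>2 * k x)"
      by (simp add: fun_eq_iff power2_eq_square algebra_simps)
    also have "(\<integral>x. s\<^sup>2 * (k x * (F x)\<^sup>2) - 2 * s * t * (k x * F x) + t\<^sup>2 * k x \<partial>M) = c * s\<^sup>2 - 2 * s * t * b + t\<^sup>2 * a"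
      using assms(1-3) unfolding a_def b_def c_def by simp
    finally show ?thesis .
  qed
  have "a \<ge> 0"
    unfolding a_def using assms(4) by (intro integral_nonneg_AE) auto
  show ?thesis
  proof (cases "a = 0")
    case True
    have "b = 0"
    proof (rule ccontr)
      assume "b \<noteq> 0"
      then show False
        \<comment> \<open>for $a = 0$ the form is linear in $t$, and this $t$ makes it equal to $-1$\<close>
        using q[of 1 "(c + 1) / (2 * b)"] True by (simp add: field_simps)
    qed
    then show ?thesis
      using True by (simp add: a_def b_def)
  next
    case False
    then have "0 \<le> a * (a * c - b\<^sup>2)"
      using q[of a b] by (simp add: power2_eq_square algebra_simps)
    then have "b\<^sup>2 \<le> a * c"
      using False \<open>a \<ge> 0\<close> by (simp add: zero_le_mult_iff)
    then show ?thesis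
      by (simp add: a_def b_def c_def)
  qed
qed

text \<open>
  Schur's argument: the Cauchy-Schwarz inequality for the measure with density $k(\xi - z)$ bounds
  the square of the transform pointwise by the convolution of $k$ with the squared modulus, which is integrable.
\<close>

lemma transform_L2:
  assumes "\<nu> > 0" and f: "f \<in> L2 \<nu>" "continuous_on UNIV f"
    and g: "continuous_on UNIV g" "\<And>z. g z = transform \<nu> n n' f z"
  shows "g \<in> L2 \<nu>"
proof -
  define k where "k = kernel_envelope \<nu> n n'"
  define F where "F = flattened \<nu> f"
  define c where "c = \<bar>(-1) ^ n' * \<nu> / (pi * sqrt (fact n * fact n' * \<nu> ^ (n + n')))\<bar>"
  have k0: "k w \<ge> 0" for w
    by (simp add: k_def kernel_envelope_nonneg)
  have [measurable]: "k \<in> borel_measurable borel" "F \<in> borel_measurable borel" "flattened \<nu> g \<in> borel_measurable borel"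
    unfolding k_def F_def
    by (intro borel_measurable_continuous_onI continuous_on_kernel_envelope continuous_on_flattened f g)+
  note shift = kernel_envelope_shift_integrable[OF assms(1), of n n', folded k_def]
  have iF: "integrable lborel (\<lambda>\<xi>. (F \<xi>)\<^sup>2)"
    using f(1) by (simp add: L2_flattened F_def)
  obtain K where K: "\<And>w. k w \<le> K"
    using kernel_envelope_bounded[OF assms(1)] unfolding k_def by blast
  have i2: "integrable lborel (\<lambda>\<xi>. k (\<xi> - z) * (F \<xi>)\<^sup>2)" for z
  proof (rule Bochner_Integration.integrable_bound[OF integrable_mult_right[OF iF, of K]])
    show "AE \<xi> in lborel. norm (k (\<xi> - z) * (F \<xi>)\<^sup>2) \<le> norm (K * (F \<xi>)\<^sup>2)"
    proof (intro always_eventually allI)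
      fix \<xi>
      have "k (\<xi> - z) * (F \<xi>)\<^sup>2 \<le> K * (F \<xi>)\<^sup>2"
        using K by (intro mult_right_mono) auto
      moreover have "0 \<le> k (\<xi> - z) * (F \<xi>)\<^sup>2"
        using k0 by simp
      ultimately show "norm (k (\<xi> - z) * (F \<xi>)\<^sup>2) \<le> norm (K * (F \<xi>)\<^sup>2)"
        unfolding real_norm_def by linarith
    qed
  qed measurable
  have i1: "integrable lborel (\<lambda>\<xi>. k (\<xi> - z) * F \<xi>)" for z
  proof -
    have "integrable lborel (\<lambda>\<xi>. exp (- (\<nu> / 2 * (cmod z)\<^sup>2)) * norm (integrand \<nu> n n' f z \<xi>))"
      by (intro integrable_mult_right integrable_norm integrand_integrable(1)[OF assms(1) f])
    also have "(\<lambda>\<xi>. exp (- (\<nu> / 2 * (cmod z)\<^sup>2)) * norm (integrand \<nu> n n' f z \<xi>)) = (\<lambda>\<xi>. k (\<xi> - z) * F \<xi>)"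
      unfolding norm_integrand mult.assoc[symmetric] exp_add[symmetric] by (simp add: k_def F_def)
    finally show ?thesis .
  qed
  define I where "I = (\<lambda>z. \<integral>\<xi>. k (\<xi> - z) * (F \<xi>)\<^sup>2 \<partial>lborel)"
  have I_meas [measurable]: "I \<in> borel_measurable borel"
    unfolding I_def by measurable
  have I0: "I z \<ge> 0" for z
    unfolding I_def using k0 by (intro integral_nonneg_AE) auto
  have bound: "(flattened \<nu> g z)\<^sup>2 \<le> c\<^sup>2 * (\<integral>w. k w \<partial>lborel) * I z" for z
  proof -
    have "norm (g z) \<le> c * (\<integral>\<xi>. norm (integrand \<nu> n n' f z \<xi>) \<partial>lborel)"
      unfolding g(2) transform_def norm_mult norm_of_real c_def
      by (intro mult_left_mono integral_norm_bound) simp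
    also have "(\<integral>\<xi>. norm (integrand \<nu> n n' f z \<xi>) \<partial>lborel) = exp (\<nu> / 2 * (cmod z)\<^sup>2) * (\<integral>\<xi>. k (\<xi> - z) * F \<xi> \<partial>lborel)"
      unfolding norm_integrand k_def F_def by simp
    finally have "flattened \<nu> g z \<le> (c * (exp (\<nu> / 2 * (cmod z)\<^sup>2) * (\<integral>\<xi>. k (\<xi> - z) * F \<xi> \<partial>lborel))) * exp (- \<nu> / 2 * (cmod z)\<^sup>2)"
      unfolding flattened_def by (intro mult_right_mono) auto
    also have "\<dots> = c * (\<integral>\<xi>. k (\<xi> - z) * F \<xi> \<partial>lborel)"
      by (simp add: exp_minus[of "\<nu> * (cmod z)\<^sup>2 / 2"] field_simps)
    finally have "(flattened \<nu> g z)\<^sup>2 \<le> (c * (\<integral>\<xi>. k (\<xi> - z) * F \<xi> \<partial>lborel))\<^sup>2"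
      by (intro power_mono flattened_nonneg)
    also have "\<dots> \<le> c\<^sup>2 * ((\<integral>w. k w \<partial>lborel) * I z)"
      unfolding power_mult_distrib
      using weighted_cauchy_schwarz[OF shift(3)[of z] i1 i2 k0] shift(4)[of z]
      by (intro mult_left_mono) (simp_all add: I_def)
    finally show ?thesis
      by (simp add: mult.assoc)
  qed
  have iI: "integrable lborel I"
  proof (rule integrableI_bounded)
    have "(\<integral>\<^sup>+z. ennreal (norm (I z)) \<partial>lborel) = (\<integral>\<^sup>+z. \<integral>\<^sup>+\<xi>. ennreal (k (\<xi> - z)) * ennreal ((F \<xi>)\<^sup>2) \<partial>lborel \<partial>lborel)"
    proof (rule nn_integral_cong)
      fix z
      have "ennreal (I z) = (\<integral>\<^sup>+\<xi>. ennreal (k (\<xi> - z) * (F \<xi>)\<^sup>2) \<partial>lborel)"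
        unfolding I_def using k0 by (intro nn_integral_eq_integral[symmetric] i2) auto
      then show "ennreal (norm (I z)) = (\<integral>\<^sup>+\<xi>. ennreal (k (\<xi> - z)) * ennreal ((F \<xi>)\<^sup>2) \<partial>lborel)"
        using I0 k0 by (simp add: ennreal_mult)
    qed
    also have "\<dots> = (\<integral>\<^sup>+w. ennreal (k w) \<partial>lborel) * (\<integral>\<^sup>+w. ennreal ((F w)\<^sup>2) \<partial>lborel)"
      by (rule nn_integral_convolution_snd[of "\<lambda>w. ennreal (k w)" "\<lambda>w. ennreal ((F w)\<^sup>2)"]) measurable
    also have "\<dots> < \<infinity>"
      using kernel_envelope_finite[OF assms(1)] flattened_square_finite[OF f(1)]
      unfolding k_def F_def by (simp add: ennreal_mult_less_top)
    finally show "(\<integral>\<^sup>+z. ennreal (norm (I z)) \<partial>lborel) < \<infinity>" .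
  qed simp
  have "integrable lborel (\<lambda>z. (flattened \<nu> g z)\<^sup>2)"
  proof (rule Bochner_Integration.integrable_bound[OF integrable_mult_right[OF iI, of "c\<^sup>2 * (\<integral>w. k w \<partial>lborel)"]])
    show "AE z in lborel. norm ((flattened \<nu> g z)\<^sup>2) \<le> norm (c\<^sup>2 * (\<integral>w. k w \<partial>lborel) * I z)"
      using order_trans[OF bound abs_ge_self] by simp
  qed measurable
  then show ?thesis
    using borel_measurable_continuous_onI[OF g(1)] by (simp add: L2_flattened)
qed

text \<open>
  Conjugation exchanges the indices of $H_{n,n'}$, and reflecting its argument gives the sign
  $(-1)^{n+n'}$, which accounts for the different signs in the two normalizations. What remains is Fubini, justified by
  $F(\xi)G(z) \le F(\xi)^2 + G(z)^2$ and the two convolution integrals.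
\<close>

lemma transform_adjoint:
  assumes "\<nu> > 0" and f: "f \<in> L2 \<nu>" "continuous_on UNIV f" and g: "g \<in> L2 \<nu>" "continuous_on UNIV g"
  shows "L2_inner \<nu> (transform \<nu> n n' f) g = L2_inner \<nu> f (transform \<nu> n' n g)"
proof -
  define s where "s = \<nu> / (pi * sqrt (fact n * fact n' * \<nu> ^ (n + n')))"
  define \<Phi> where "\<Phi> = (\<lambda>z \<xi>. of_real ((-1) ^ n' * s) * integrand \<nu> n n' f z \<xi> * cnj (g z) * of_real (exp (- \<nu> * (cmod z)\<^sup>2)))"
  define k where "k = kernel_envelope \<nu> n n'"
  define F where "F = flattened \<nu> f"
  define G where "G = flattened \<nu> g"
  have k0: "k w \<ge> 0" for w
    by (simp add: k_def kernel_envelope_nonneg)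
  have [measurable]: "k \<in> borel_measurable borel" "F \<in> borel_measurable borel" "G \<in> borel_measurable borel"
    unfolding k_def F_def G_def
    by (intro borel_measurable_continuous_onI continuous_on_kernel_envelope continuous_on_flattened f g)+
  have \<Phi>_cont: "continuous_on UNIV (\<lambda>p. \<Phi> (fst p) (snd p))"
    unfolding \<Phi>_def integrand_def
    by (intro continuous_intros continuous_on_compose2[OF continuous_on_hermite] continuous_on_compose2[OF f(2)]
        continuous_on_compose2[OF g(2)]) auto
  have \<Phi>_meas [measurable]: "case_prod \<Phi> \<in> borel_measurable (lborel \<Otimes>\<^sub>M lborel)"
    using borel_measurable_continuous_onI[OF \<Phi>_cont] by (simp add: lborel_prod case_prod_beta')
  have norm_\<Phi>: "norm (\<Phi> z \<xi>) = \<bar>s\<bar> * (k (\<xi> - z) * (F \<xi> * G z))" for z \<xi>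
  proof -
    have "exp (\<nu> / 2 * (cmod z)\<^sup>2) * exp (- \<nu> * (cmod z)\<^sup>2) = exp (- \<nu> / 2 * (cmod z)\<^sup>2)"
      unfolding exp_add[symmetric] by simp
    moreover have "norm (\<Phi> z \<xi>) = \<bar>s\<bar> * (k (\<xi> - z) * F \<xi>) * (norm (g z) * (exp (\<nu> / 2 * (cmod z)\<^sup>2) * exp (- \<nu> * (cmod z)\<^sup>2)))"
      unfolding \<Phi>_def norm_mult norm_integrand k_def[symmetric] F_def[symmetric]
      by (simp add: norm_mult norm_power mult_ac)
    ultimately show ?thesis
      by (simp add: G_def flattened_def mult_ac)
  qed
  have int: "integrable (lborel \<Otimes>\<^sub>M lborel) (case_prod \<Phi>)"
  proof (rule integrableI_bounded)
    have "(\<integral>\<^sup>+p. ennreal (norm (case_prod \<Phi> p)) \<partial>(lborel \<Otimes>\<^sub>M lborel))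
        = (\<integral>\<^sup>+z. \<integral>\<^sup>+\<xi>. ennreal (norm (\<Phi> z \<xi>)) \<partial>lborel \<partial>lborel)"
      by (subst lborel.nn_integral_fst[symmetric]) auto
    also have "\<dots> \<le> (\<integral>\<^sup>+z. \<integral>\<^sup>+\<xi>. ennreal \<bar>s\<bar> * (ennreal (k (\<xi> - z)) * ennreal ((F \<xi>)\<^sup>2) + ennreal (k (\<xi> - z)) * ennreal ((G z)\<^sup>2)) \<partial>lborel \<partial>lborel)"
    proof (intro nn_integral_mono)
      fix z \<xi>
      have "F \<xi> * G z \<le> (F \<xi>)\<^sup>2 + (G z)\<^sup>2"
        by (rule order_trans[OF mult_le_half_squares]) simp
      then have "\<bar>s\<bar> * (k (\<xi> - z) * (F \<xi> * G z)) \<le> \<bar>s\<bar> * (k (\<xi> - z) * ((F \<xi>)\<^sup>2 + (G z)\<^sup>2))"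
        using k0 by (intro mult_left_mono) auto
      then have "ennreal (norm (\<Phi> z \<xi>)) \<le> ennreal (\<bar>s\<bar> * (k (\<xi> - z) * ((F \<xi>)\<^sup>2 + (G z)\<^sup>2)))"
        unfolding norm_\<Phi> by (rule ennreal_leI)
      also have "\<dots> = ennreal \<bar>s\<bar> * (ennreal (k (\<xi> - z)) * ennreal ((F \<xi>)\<^sup>2) + ennreal (k (\<xi> - z)) * ennreal ((G z)\<^sup>2))"
        using k0 by (simp add: ennreal_mult ennreal_plus distrib_left)
      finally show "ennreal (norm (\<Phi> z \<xi>)) \<le> ennreal \<bar>s\<bar> * (ennreal (k (\<xi> - z)) * ennreal ((F \<xi>)\<^sup>2) + ennreal (k (\<xi> - z)) * ennreal ((G z)\<^sup>2))" .
    qed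
    also have "\<dots> = ennreal \<bar>s\<bar> * ((\<integral>\<^sup>+z. \<integral>\<^sup>+\<xi>. ennreal (k (\<xi> - z)) * ennreal ((F \<xi>)\<^sup>2) \<partial>lborel \<partial>lborel)
        + (\<integral>\<^sup>+z. \<integral>\<^sup>+\<xi>. ennreal (k (\<xi> - z)) * ennreal ((G z)\<^sup>2) \<partial>lborel \<partial>lborel))"
      by (simp add: nn_integral_cmult nn_integral_add)
    also have "\<dots> < \<infinity>"
      using nn_integral_convolution_snd[of "\<lambda>w. ennreal (k w)" "\<lambda>w. ennreal ((F w)\<^sup>2)"]
        nn_integral_convolution_fst[of "\<lambda>w. ennreal (k w)" "\<lambda>w. ennreal ((G w)\<^sup>2)"]
        kernel_envelope_finite[OF assms(1), of n n'] flattened_square_finite[OF f(1)] flattened_square_finite[OF g(1)]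
      by (simp add: k_def[symmetric] F_def[symmetric] G_def[symmetric] ennreal_mult_less_top)
    finally show "(\<integral>\<^sup>+p. ennreal (norm (case_prod \<Phi> p)) \<partial>(lborel \<Otimes>\<^sub>M lborel)) < \<infinity>" .
  qed measurable
  have sym: "\<Phi> z \<xi> = f \<xi> * cnj (of_real ((-1) ^ n * s) * integrand \<nu> n' n g \<xi> z) * of_real (exp (- \<nu> * (cmod \<xi>)\<^sup>2))" for z \<xi>
  proof -
    have 1: "cnj (hermite \<nu> n' n (z - \<xi>)) = (-1) ^ (n + n') * hermite \<nu> n n' (\<xi> - z)"
      using hermite_uminus[of \<nu> n n' "\<xi> - z"] by (simp add: cnj_hermite)
    have 2: "exp (- of_real \<nu> * of_real ((cmod \<xi>)\<^sup>2) + of_real \<nu> * cnj \<xi> * z) * complex_of_real (exp (- \<nu> * (cmod z)\<^sup>2))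
       = cnj (exp (- of_real \<nu> * of_real ((cmod z)\<^sup>2) + of_real \<nu> * cnj z * \<xi>)) * of_real (exp (- \<nu> * (cmod \<xi>)\<^sup>2))"
      unfolding exp_cnj exp_of_real[symmetric] exp_add[symmetric] by (simp add: algebra_simps)
    have 3: "((-1) ^ n * (-1) ^ (n + n') :: complex) = (-1) ^ n'"
      by (simp add: power_add mult.assoc[symmetric] mult_2[symmetric] power_mult_distrib[symmetric])
    have "f \<xi> * cnj (of_real ((-1) ^ n * s) * integrand \<nu> n' n g \<xi> z) * of_real (exp (- \<nu> * (cmod \<xi>)\<^sup>2))
       = of_real s * ((-1) ^ n * (-1) ^ (n + n')) * hermite \<nu> n n' (\<xi> - z) * f \<xi> * cnj (g z)
         * (cnj (exp (- of_real \<nu> * of_real ((cmod z)\<^sup>2) + of_real \<nu> * cnj z * \<xi>)) * of_real (exp (- \<nu> * (cmod \<xi>)\<^sup>2)))"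
      unfolding integrand_def complex_cnj_mult 1 by (simp add: mult_ac)
    also have "\<dots> = \<Phi> z \<xi>"
      unfolding 2[symmetric] 3 \<Phi>_def integrand_def by (simp add: mult_ac)
    finally show ?thesis ..
  qed
  have "L2_inner \<nu> (transform \<nu> n n' f) g = (\<integral>z. \<integral>\<xi>. \<Phi> z \<xi> \<partial>lborel \<partial>lborel)"
    unfolding L2_inner_def transform_def \<Phi>_def s_def by (simp add: mult.assoc)
  also have "\<dots> = (\<integral>\<xi>. \<integral>z. \<Phi> z \<xi> \<partial>lborel \<partial>lborel)"
    by (rule lborel_pair.Fubini_integral[OF int, symmetric])
  also have "\<dots> = L2_inner \<nu> f (transform \<nu> n' n g)"
  proof -
    have s': "s = \<nu> / (pi * sqrt (fact n' * fact n * \<nu> ^ (n' + n)))"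
      by (simp add: s_def add.commute mult.commute)
    show ?thesis
      unfolding L2_inner_def transform_def sym
      by (simp add: mult.assoc s' integral_cnj[symmetric] del: integral_cnj)
  qed
  finally show ?thesis .
qed

section \<open>Unitarity\<close>

text \<open>
  With $f = (A^*)^n h$ the transform is a multiple of $(A^*)^{n'}h$, and the two constants for the way there and
  back are reciprocal.
\<close>

lemma transform_fock:
  assumes "\<nu> > 0" "f \<in> fock \<nu> n"
  shows "transform \<nu> n n' f \<in> fock \<nu> n'" "transform \<nu> n' n (transform \<nu> n n' f) = f"
proof -
  obtain h where h: "h holomorphic_on UNIV" "h \<in> subgaussian (\<nu> / 2)" "f = creation \<nu> n h"
    using fock_representation[OF assms] by blast
  define c where "c = complex_of_real (sqrt ((fact n * \<nu> ^ n) / (fact n' * \<nu> ^ n')))"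
  have ch: "(\<lambda>z. c * h z) holomorphic_on UNIV" "(\<lambda>z. c * h z) \<in> subgaussian (\<nu> / 2)"
    using h subgaussian_cmult by (auto intro!: holomorphic_intros)
  have T: "transform \<nu> n n' f = creation \<nu> n' (\<lambda>z. c * h z)"
    using transform_creation[OF h(1,2), where \<nu>=\<nu> and n=n and n'=n'] creation_cmult[OF h(1)] assms(1)
    by (auto simp: fun_eq_iff h(3) c_def)
  have "creation \<nu> n' (\<lambda>z. c * h z) \<in> L2 \<nu>"
    by (rule transform_L2[OF assms(1) fock_L2[OF assms(2)] fock_continuous[OF assms(2)] continuous_on_creation[OF ch(1)], where n=n and n'=n'])
      (simp add: T)
  then show "transform \<nu> n n' f \<in> fock \<nu> n'"
    unfolding T by (rule creation_in_fock[OF ch(1)])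
  have "(fact n' * \<nu> ^ n') / (fact n * \<nu> ^ n) * ((fact n * \<nu> ^ n) / (fact n' * \<nu> ^ n')) = 1"
    using assms(1) by simp
  then have "complex_of_real (sqrt ((fact n' * \<nu> ^ n') / (fact n * \<nu> ^ n))) * c = 1"
    unfolding c_def of_real_mult[symmetric] real_sqrt_mult[symmetric] by (simp only: real_sqrt_one of_real_1)
  then show "transform \<nu> n' n (transform \<nu> n n' f) = f"
    using transform_creation[OF ch, where \<nu>=\<nu> and n=n' and n'=n] assms(1)
    unfolding T by (auto simp: fun_eq_iff h(3) creation_cmult[OF h(1)] mult.assoc[symmetric])
qed

lemma hermite_in_L2: "\<nu> > 0 \<Longrightarrow> hermite \<nu> m n \<in> L2 \<nu>"
  using kernel_envelope_integrable(2)[of \<nu> m n] borel_measurable_continuous_onI[OF continuous_on_hermite]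
  unfolding L2_flattened kernel_envelope_def flattened_def gaussian_eq norm_mult by (simp add: mult.commute)

theorem theorem3p7:
  fixes \<nu> :: real and n n' :: nat
  assumes "\<nu> > 0"
  shows "(\<forall>\<psi> \<in> fock \<nu> n. \<forall>z. integrable lborel (integrand \<nu> n n' \<psi> z)) \<and>
    unitary_onto \<nu> (transform \<nu> n n') (fock \<nu> n) (fock \<nu> n') \<and>
    (\<forall>f \<in> fock \<nu> n. transform \<nu> n' n (transform \<nu> n n' f) = f) \<and>
    (\<forall>g \<in> fock \<nu> n'. transform \<nu> n n' (transform \<nu> n' n g) = g) \<and>
    (\<forall>m. hermite \<nu> m n \<in> fock \<nu> n \<and>
      (\<forall>z. transform \<nu> n n' (hermite \<nu> m n) z =
        of_real (sqrt ((fact n * \<nu> ^ n) / (fact n' * \<nu> ^ n'))) * hermite \<nu> m n' z))"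
proof -
  have int: "integrable lborel (integrand \<nu> n n' f z)" if "f \<in> fock \<nu> n" for f z
    using integrand_integrable(1)[OF assms fock_L2[OF that] fock_continuous[OF that]] .
  have inv: "transform \<nu> n' n (transform \<nu> n n' f) = f" if "f \<in> fock \<nu> n" for f
    using transform_fock(2)[OF assms that] .
  have inv': "transform \<nu> n n' (transform \<nu> n' n g) = g" if "g \<in> fock \<nu> n'" for g
    using transform_fock(2)[OF assms that] .
  have "unitary_onto \<nu> (transform \<nu> n n') (fock \<nu> n) (fock \<nu> n')"
    unfolding unitary_onto_def
  proof (intro conjI ballI allI)
    fix f g assume fg: "f \<in> fock \<nu> n" "g \<in> fock \<nu> n"
    have "integrand \<nu> n n' (\<lambda>z. f z + g z) z = (\<lambda>\<xi>. integrand \<nu> n n' f z \<xi> + integrand \<nu> n n' g z \<xi>)" for z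
      by (simp add: integrand_def fun_eq_iff algebra_simps)
    then show "transform \<nu> n n' (\<lambda>z. f z + g z) = (\<lambda>z. transform \<nu> n n' f z + transform \<nu> n n' g z)"
      using int fg by (simp add: transform_def fun_eq_iff distrib_left)
    have "transform \<nu> n n' g \<in> fock \<nu> n'"
      using transform_fock(1)[OF assms fg(2)] .
    then show "L2_inner \<nu> (transform \<nu> n n' f) (transform \<nu> n n' g) = L2_inner \<nu> f g"
      using transform_adjoint[OF assms fock_L2[OF fg(1)] fock_continuous[OF fg(1)], of "transform \<nu> n n' g" n n']
        inv[OF fg(2)] fock_L2 fock_continuous by simp
  next
    fix c f assume "f \<in> fock \<nu> n"
    have "integrand \<nu> n n' (\<lambda>z. c * f z) z = (\<lambda>\<xi>. c * integrand \<nu> n n' f z \<xi>)" for z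
      by (simp add: integrand_def fun_eq_iff algebra_simps)
    then show "transform \<nu> n n' (\<lambda>z. c * f z) = (\<lambda>z. c * transform \<nu> n n' f z)"
      by (simp add: transform_def fun_eq_iff)
  next
    show "bij_betw (transform \<nu> n n') (fock \<nu> n) (fock \<nu> n')"
      by (rule bij_betw_byWitness[where f'="transform \<nu> n' n"])
        (use inv inv' transform_fock(1)[OF assms] in auto)
  qed
  moreover have "hermite \<nu> m n \<in> fock \<nu> n" for m
    using creation_in_fock[OF holomorphic_scaled_power, of \<nu> n \<nu> m] hermite_in_L2[OF assms]
    by (simp add: hermite_eq_creation)
  moreover have "transform \<nu> n n' (hermite \<nu> m n) z
      = of_real (sqrt ((fact n * \<nu> ^ n) / (fact n' * \<nu> ^ n'))) * hermite \<nu> m n' z" for m z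
    using transform_creation[OF holomorphic_scaled_power subgaussian_scaled_power, of \<nu> n n' \<nu> m z] assms
    by (simp add: hermite_eq_creation)
  ultimately show ?thesis
    using int inv inv' by blast
qed

end
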